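(* Let $n\ge 2$, let $\Omega,\Omega'\subset\mathbb R^n$ be domains, and let $f:\Omega\to\Omega'$ be a qns-morphism whose components belong to $W^{1,n}_{\rm loc}(\Omega)$. If, additionally, $J(x,f)\ge 0$ for almost every $x\in\Omega$, then $f$ is quasiregular.
   Context: $dm$ denotes Lebesgue measure normalized so that $m(B(0,1))=1$, $B(a,r)=\{x:|x-a|<r\}$. A locally bounded measurable function $u\ge0$ on a domain $D$ is quasi-nearly subharmonic (qns) if there is $C$ with $u(a)\le \frac{C}{r^n}\int_{B(a,r)}u\,dm$ whenever $B(a,r)\subset D$; set $\|u\|_{\rm qns}=\inf\{C\ge0: u(a)\le \frac{C}{r^n}\int_{B(a,r)}u\,dm \text{ for all } a\in D,\ 0<r\le d(a,\partial D)\}$. A mapping $f:\Omega\to\Omega'$ is a qns-morphism if there is $C<\infty$ such that $\|u\circ f\|_{\rm qns}\le C\|u\|_{\rm qns}$ for every qns function $u$ on $\Omega'$. $J(x,f)$ is the Jacobian determinant. $f$ is quasiregular if it is continuous, has components in $W^{1,n}_{\rm loc}$, and there is $K\ge1$ with $|Df(x)|^n\le K J(x,f)$ a.e. *)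

theory Defs
  imports "HOL-Analysis.Analysis"
begin

definition domain :: "(real^'n) set \<Rightarrow> bool" where
  "domain D \<longleftrightarrow> open D \<and> connected D \<and> D \<noteq> {}"

text \<open>Normalized Lebesgue measure: m = lebesgue / |B(0,1)|.\<close>
definition unit_ball_vol :: "'n::finite itself \<Rightarrow> real" where
  "unit_ball_vol _ = measure lebesgue (ball (0::real^'n) 1)"

definition locally_bounded_on :: "(real^'n) set \<Rightarrow> (real^'n \<Rightarrow> real) \<Rightarrow> bool" where
  "locally_bounded_on D u \<longleftrightarrow>
     (\<forall>x\<in>D. \<exists>e>0. \<exists>B. \<forall>y\<in>ball x e \<inter> D. \<bar>u y\<bar> \<le> B)"

definition qns_ineq :: "real \<Rightarrow> (real^'n) set \<Rightarrow> (real^'n \<Rightarrow> real) \<Rightarrow> bool" where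
  "qns_ineq C D u \<longleftrightarrow>
     (\<forall>a\<in>D. \<forall>r>0. ball a r \<subseteq> D \<longrightarrow>
        ennreal (u a) \<le> ennreal (C / (r ^ CARD('n) * unit_ball_vol TYPE('n)))
                         * (\<integral>\<^sup>+ x \<in> ball a r. ennreal (u x) \<partial>lebesgue))"

definition qns :: "(real^'n) set \<Rightarrow> (real^'n \<Rightarrow> real) \<Rightarrow> bool" where
  "qns D u \<longleftrightarrow> (\<forall>x\<in>D. 0 \<le> u x) \<and> u \<in> borel_measurable (lebesgue_on D)
      \<and> locally_bounded_on D u \<and> (\<exists>C. qns_ineq C D u)"

definition qns_norm :: "(real^'n) set \<Rightarrow> (real^'n \<Rightarrow> real) \<Rightarrow> real" where
  "qns_norm D u = Inf {C. 0 \<le> C \<and> qns_ineq C D u}"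

definition qns_morphism ::
  "(real^'n) set \<Rightarrow> (real^'n) set \<Rightarrow> (real^'n \<Rightarrow> real^'n) \<Rightarrow> bool" where
  "qns_morphism \<Omega> \<Omega>' f \<longleftrightarrow> f ` \<Omega> \<subseteq> \<Omega>' \<and>
     (\<exists>C. \<forall>u. qns \<Omega>' u \<longrightarrow>
          qns \<Omega> (u \<circ> f) \<and> qns_norm \<Omega> (u \<circ> f) \<le> C * qns_norm \<Omega>' u)"

fun iter_pd :: "'n list \<Rightarrow> (real^'n \<Rightarrow> real) \<Rightarrow> real^'n \<Rightarrow> real" where
  "iter_pd [] \<phi> = \<phi>"
| "iter_pd (i # is) \<phi> = (\<lambda>x. frechet_derivative (iter_pd is \<phi>) (at x) (axis i 1))"

definition smooth_fun :: "(real^'n \<Rightarrow> real) \<Rightarrow> bool" where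
  "smooth_fun \<phi> \<longleftrightarrow> (\<forall>is x. iter_pd is \<phi> differentiable (at x))"

definition test_fun :: "(real^'n) set \<Rightarrow> (real^'n \<Rightarrow> real) \<Rightarrow> bool" where
  "test_fun \<Omega> \<phi> \<longleftrightarrow> smooth_fun \<phi> \<and>
     (\<exists>K. compact K \<and> K \<subseteq> \<Omega> \<and> (\<forall>x. x \<notin> K \<longrightarrow> \<phi> x = 0))"

definition Lp_loc :: "real \<Rightarrow> (real^'n) set \<Rightarrow> (real^'n \<Rightarrow> real) \<Rightarrow> bool" where
  "Lp_loc p \<Omega> h \<longleftrightarrow> h \<in> borel_measurable (lebesgue_on \<Omega>) \<and>
     (\<forall>K. compact K \<and> K \<subseteq> \<Omega> \<longrightarrow> set_integrable lebesgue K (\<lambda>x. \<bar>h x\<bar> powr p))"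

definition weak_partial ::
  "(real^'n) set \<Rightarrow> (real^'n \<Rightarrow> real) \<Rightarrow> 'n \<Rightarrow> (real^'n \<Rightarrow> real) \<Rightarrow> bool" where
  "weak_partial \<Omega> h j g \<longleftrightarrow>
     (\<forall>\<phi>. test_fun \<Omega> \<phi> \<longrightarrow>
        (LINT x:\<Omega>|lebesgue. h x * iter_pd [j] \<phi> x) = - (LINT x:\<Omega>|lebesgue. g x * \<phi> x))"

definition sobolev_1n_loc :: "(real^'n) set \<Rightarrow> (real^'n \<Rightarrow> real) \<Rightarrow> bool" where
  "sobolev_1n_loc \<Omega> h \<longleftrightarrow> Lp_loc (real CARD('n)) \<Omega> h \<and>
     (\<forall>j. \<exists>g. Lp_loc (real CARD('n)) \<Omega> g \<and> weak_partial \<Omega> h j g)"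

definition weak_diff_matrix ::
  "(real^'n) set \<Rightarrow> (real^'n \<Rightarrow> real^'n) \<Rightarrow> (real^'n \<Rightarrow> real^'n^'n) \<Rightarrow> bool" where
  "weak_diff_matrix \<Omega> f D \<longleftrightarrow>
     (\<forall>i j. Lp_loc (real CARD('n)) \<Omega> (\<lambda>x. D x $ i $ j) \<and>
            weak_partial \<Omega> (\<lambda>x. f x $ i) j (\<lambda>x. D x $ i $ j))"

definition quasiregular :: "(real^'n) set \<Rightarrow> (real^'n \<Rightarrow> real^'n) \<Rightarrow> bool" where
  "quasiregular \<Omega> f \<longleftrightarrow> continuous_on \<Omega> f \<and> (\<forall>i. sobolev_1n_loc \<Omega> (\<lambda>x. f x $ i)) \<and>
     (\<exists>K\<ge>1. \<forall>D. weak_diff_matrix \<Omega> f D \<longrightarrow>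
        (AE x in lebesgue. x \<in> \<Omega> \<longrightarrow>
           onorm (\<lambda>v. D x *v v) ^ CARD('n) \<le> K * det (D x)))"

end

theory Submission
  imports Defs
begin

text \<open>If \<open>E\<close> is closed and every \<open>a \<in> E\<close> is the apex of a fixed cone of directions contained in \<open>E\<close>,
  the indicator of \<open>E\<close> is quasi-nearly subharmonic with a constant depending only on the dimension.
  Hence, for a qns-morphism \<open>f\<close>, the set \<open>f\<^sup>-\<^sup>1 E\<close> occupies at least a fixed fraction of every ball
  centred at one of its points.

  Half-spaces \<open>E\<close> give continuity: a jump of a component of \<open>f\<close> would produce, at every small scale
  \<open>r\<close>, two sets of measure comparable to \<open>r\<^sup>n\<close> on which the component differs by a fixed amount, and the
  Poincare inequality would bound \<open>\<integral>\<bar>Df\<bar>\<^sup>n\<close> over small balls from below.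

  Wedges \<open>E = {y. \<bar>(y - f x) \<bullet> w\<bar> \<le> (y - f x) \<bullet> v}\<close> with \<open>v\<close>, \<open>w\<close> orthonormal give distortion: almost
  everywhere \<open>f\<close> is approximately differentiable, so blowing up at \<open>x\<close> turns the preimage of \<open>E\<close> into a
  subset of a slab of relative width \<open>\<bar>A\<^sup>T v\<bar> / \<bar>A\<^sup>T w\<bar>\<close> with \<open>A = Df(x)\<close>; thus \<open>\<bar>A\<^sup>T w\<bar> \<le> K \<bar>A\<^sup>T v\<bar>\<close> for all
  orthonormal pairs, which bounds \<open>\<bar>A\<bar>\<^sup>n\<close> by a multiple of \<open>\<bar>det A\<bar>\<close>.

  Both steps rest on \<open>H(x + e) - H(x) = \<integral>\<^sub>0\<^sup>1 DH(x + s e) e ds\<close>, valid for every fixed \<open>e\<close> and almost every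
  \<open>x\<close>.\<close>

section \<open>Smooth bump functions\<close>

text \<open>The density bound is the only link between individual values of \<open>f\<close> and its
  Sobolev class: it attaches to the value \<open>f a\<close> a set of definite measure, on which
  \<open>f\<close> may be replaced by a Borel representative. The exponent n suffices for continuity
  because the n-energy is scale invariant, yet tends to 0 on shrinking balls by absolute continuity.
  The increment formula fails on a null set depending on \<open>e\<close>; therefore
  \<open>e\<close> is integrated over a ball, and Fubini allows averaging over x first. The blow-up
  then rests on continuity of translations of the gradient in L1: normalised first-order errors tend
  to 0 in mean, hence for a.e. x are arbitrarily small at suitable radii. One radius per tolerance
  is enough, since the density bound holds at every small radius. Finally,
  \<open>quasiregular\<close> speaks of every weak differential while the sign of the Jacobian is
  given for one of them, so weak differentials must be shown to agree a.e.\<close>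

definition flat_exp :: "nat \<Rightarrow> real \<Rightarrow> real" where
  "flat_exp k t = (if t > 0 then exp (- (1 / t)) / t ^ k else 0)"

lemma flat_exp_tendsto_0: "(flat_exp k \<longlongrightarrow> 0) (at 0)"
proof -
  have "((\<lambda>t::real. (inverse t) ^ k / exp (inverse t)) \<longlongrightarrow> 0) (at_right 0)"
    by (rule filterlim_compose[OF tendsto_power_div_exp_0 filterlim_inverse_at_top_right])
  moreover have "(\<lambda>t::real. (inverse t) ^ k / exp (inverse t)) = (\<lambda>t. exp (- (1 / t)) / t ^ k)"
    by (simp add: fun_eq_iff exp_minus field_simps)
  ultimately have "((\<lambda>t::real. exp (- (1 / t)) / t ^ k) \<longlongrightarrow> 0) (at_right 0)"
    by simp
  hence R: "(flat_exp k \<longlongrightarrow> 0) (at_right 0)"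
    by (rule Lim_transform_eventually)
       (auto simp: eventually_at_filter flat_exp_def)
  have "((\<lambda>t::real. 0::real) \<longlongrightarrow> 0) (at_left 0)"
    by simp
  hence L: "(flat_exp k \<longlongrightarrow> 0) (at_left 0)"
    by (rule Lim_transform_eventually)
       (auto simp: eventually_at_filter flat_exp_def)
  from L R show ?thesis
    by (simp add: filterlim_at_split)
qed

text \<open>Indexing by the power of 1 / t makes the family closed under differentiation up to
  linear combinations, so smoothness at 0 reduces to one limit.\<close>

lemma flat_exp_has_derivative:
  "(flat_exp k has_field_derivative (flat_exp (k + 2) t - real k * flat_exp (k + 1) t)) (at t)"
proof -
  consider "t < 0" | "t = 0" | "t > 0" by linarith
  then show ?thesis
  proof cases
    case 1
    have "((\<lambda>_. 0) has_field_derivative 0) (at t)" by simp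
    hence "(flat_exp k has_field_derivative 0) (at t)"
      by (rule has_field_derivative_transform_within_open[where S = "{..<0}"])
         (use 1 in \<open>auto simp: flat_exp_def\<close>)
    thus ?thesis using 1 by (simp add: flat_exp_def)
  next
    case 2
    \<comment> \<open>The difference quotient at 0 is the next member of the family, also at h = 0,
      where division by zero gives 0.\<close>
    have "(\<lambda>h. (flat_exp k (0 + h) - flat_exp k 0) / h) = flat_exp (k + 1)"
      by (auto simp: flat_exp_def fun_eq_iff)
    hence "(flat_exp k has_field_derivative 0) (at 0)"
      using flat_exp_tendsto_0[of "k + 1"] by (simp add: DERIV_def)
    thus ?thesis using 2 by (simp add: flat_exp_def)
  next
    case 3
    \<comment> \<open>The truncated exponent at k = 0 is harmless because of the factor
      \<open>real k\<close>.\<close>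
    have pow: "real k * t ^ (k - Suc 0) = real k * t ^ k / t"
      using 3 by (cases k) auto
    have "((\<lambda>t. exp (- (1 / t)) / t ^ k) has_field_derivative
        ((exp (- (1 / t)) * (1 / t\<^sup>2)) * t ^ k - exp (- (1 / t)) * (real k * t ^ (k - Suc 0))) / (t ^ k * t ^ k)) (at t)"
      using 3 by (auto intro!: derivative_eq_intros simp: power2_eq_square)
    also have "((exp (- (1 / t)) * (1 / t\<^sup>2)) * t ^ k - exp (- (1 / t)) * (real k * t ^ (k - Suc 0))) / (t ^ k * t ^ k)
      = exp (- (1 / t)) / t ^ (k + 2) - real k * (exp (- (1 / t)) / t ^ (k + 1))"
      unfolding pow using 3 by (simp add: field_simps power2_eq_square)
    finally have "((\<lambda>t. exp (- (1 / t)) / t ^ k) has_field_derivative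
        (exp (- (1 / t)) / t ^ (k + 2) - real k * (exp (- (1 / t)) / t ^ (k + 1)))) (at t)" .
    hence "(flat_exp k has_field_derivative
        (exp (- (1 / t)) / t ^ (k + 2) - real k * (exp (- (1 / t)) / t ^ (k + 1)))) (at t)"
      by (rule has_field_derivative_transform_within_open[where S = "{0<..}"])
         (use 3 in \<open>auto simp: flat_exp_def\<close>)
    thus ?thesis using 3 by (simp add: flat_exp_def)
  qed
qed

text \<open>\<open>smooth_fun\<close> asks for differentiability of all iterated partial
  derivatives. An algebra of differentiable functions that is stable under each partial derivative
  serves as the invariant for an induction over the list of directions.\<close>

inductive_set bump_algebra :: "real^'n \<Rightarrow> real \<Rightarrow> (real^'n \<Rightarrow> real) set"
  for c :: "real^'n" and \<rho> :: real where
  const: "(\<lambda>_. a) \<in> bump_algebra c \<rho>"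
| coord: "(\<lambda>x. x $ i) \<in> bump_algebra c \<rho>"
| add: "g \<in> bump_algebra c \<rho> \<Longrightarrow> h \<in> bump_algebra c \<rho> \<Longrightarrow> (\<lambda>x. g x + h x) \<in> bump_algebra c \<rho>"
| mult: "g \<in> bump_algebra c \<rho> \<Longrightarrow> h \<in> bump_algebra c \<rho> \<Longrightarrow> (\<lambda>x. g x * h x) \<in> bump_algebra c \<rho>"
| flat: "(\<lambda>x. flat_exp k (\<rho>\<^sup>2 - (x - c) \<bullet> (x - c))) \<in> bump_algebra c \<rho>"

lemma bump_algebra_deriv:
  assumes "g \<in> bump_algebra c \<rho>"
  shows "\<exists>g'. (\<forall>x. (g has_derivative g' x) (at x)) \<and> (\<forall>i. (\<lambda>x. g' x (axis i 1)) \<in> bump_algebra c \<rho>)"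
  using assms
proof induction
  case (const a)
  show ?case
    by (rule exI[of _ "\<lambda>x h. 0"]) (auto intro: bump_algebra.const)
next
  case (coord i)
  show ?case
    by (rule exI[of _ "\<lambda>x h. h $ i"])
       (auto intro: bump_algebra.const bounded_linear_imp_has_derivative bounded_linear_vec_nth)
next
  case (add g h)
  then obtain g' h' where
    g: "\<And>x. (g has_derivative g' x) (at x)" "\<And>i. (\<lambda>x. g' x (axis i 1)) \<in> bump_algebra c \<rho>" and
    h: "\<And>x. (h has_derivative h' x) (at x)" "\<And>i. (\<lambda>x. h' x (axis i 1)) \<in> bump_algebra c \<rho>"
    by blast
  show ?case
    by (rule exI[of _ "\<lambda>x v. g' x v + h' x v"])
       (auto intro!: bump_algebra.intros g h has_derivative_add)
next
  case (mult g h)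
  then obtain g' h' where
    g: "\<And>x. (g has_derivative g' x) (at x)" "\<And>i. (\<lambda>x. g' x (axis i 1)) \<in> bump_algebra c \<rho>" and
    h: "\<And>x. (h has_derivative h' x) (at x)" "\<And>i. (\<lambda>x. h' x (axis i 1)) \<in> bump_algebra c \<rho>"
    by blast
  show ?case
    by (rule exI[of _ "\<lambda>x v. g x * h' x v + g' x v * h x"])
       (auto intro!: bump_algebra.intros g h mult.hyps has_derivative_mult)
next
  case (flat k)
  define d where "d = (\<lambda>t. flat_exp (k + 2) t - real k * flat_exp (k + 1) t)"
  define q where "q = (\<lambda>x. \<rho>\<^sup>2 - (x - c) \<bullet> (x - c))"
  have q: "(q has_derivative (\<lambda>v. - (2 * ((x - c) \<bullet> v)))) (at x)" for x
    unfolding q_def by (auto intro!: derivative_eq_intros simp: inner_commute)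
  have 1: "((\<lambda>x. flat_exp k (q x)) has_derivative (\<lambda>v. d (q x) * - (2 * ((x - c) \<bullet> v)))) (at x)" for x
    using has_derivative_compose[OF q, of "flat_exp k" "\<lambda>h. d (q x) * h" x]
      flat_exp_has_derivative[of k "q x"]
    by (simp add: d_def has_field_derivative_def)
  have 2: "(\<lambda>x. d (q x) * - (2 * ((x - c) \<bullet> axis i 1))) \<in> bump_algebra c \<rho>" for i
  proof -
    have "(\<lambda>x. (flat_exp (k + 2) (\<rho>\<^sup>2 - (x - c) \<bullet> (x - c)) +
          (- real k) * flat_exp (k + 1) (\<rho>\<^sup>2 - (x - c) \<bullet> (x - c))) * ((- 2) * (x $ i + (- c $ i))))
        \<in> bump_algebra c \<rho>"
      by (intro bump_algebra.intros)
    thus ?thesis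
      by (simp add: d_def q_def inner_axis)
  qed
  show ?case
    using 1 2 unfolding q_def
    by (intro exI[of _ "\<lambda>x v. d (\<rho>\<^sup>2 - (x - c) \<bullet> (x - c)) * - (2 * ((x - c) \<bullet> v))"]) auto
qed

lemma iter_pd_bump_algebra:
  assumes "g \<in> bump_algebra c \<rho>"
  shows "iter_pd is g \<in> bump_algebra c \<rho>"
proof (induction "is")
  case (Cons i "is")
  obtain g' where g': "\<And>x. (iter_pd is g has_derivative g' x) (at x)"
      "\<And>i. (\<lambda>x. g' x (axis i 1)) \<in> bump_algebra c \<rho>"
    using bump_algebra_deriv[OF Cons.IH] by blast
  have "frechet_derivative (iter_pd is g) (at x) = g' x" for x
    using g'(1) by (metis frechet_derivative_at)
  thus ?case using g'(2) by simp
qed (use assms in simp)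

lemma bump_algebra_differentiable:
  "g \<in> bump_algebra c \<rho> \<Longrightarrow> g differentiable (at x)"
  using bump_algebra_deriv unfolding differentiable_def by blast

lemma bump_algebra_continuous: "g \<in> bump_algebra c \<rho> \<Longrightarrow> continuous_on S g"
  by (meson bump_algebra_differentiable continuous_at_imp_continuous_on differentiable_imp_continuous_within)

lemma smooth_bump_algebra: "g \<in> bump_algebra c \<rho> \<Longrightarrow> smooth_fun g"
  unfolding smooth_fun_def using iter_pd_bump_algebra bump_algebra_differentiable by blast

text \<open>The standard mollifier exp (-1 / (\<rho>^2 - |z|^2)) without its normalising
  factor.\<close>

definition bump :: "real \<Rightarrow> real^'n \<Rightarrow> real" where
  "bump \<rho> z = flat_exp 0 (\<rho>\<^sup>2 - z \<bullet> z)"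

lemma bump_translate_mem: "(\<lambda>y. bump \<rho> (y - c)) \<in> bump_algebra c \<rho>"
  unfolding bump_def by (rule bump_algebra.flat)

lemma bump_nonneg: "bump \<rho> z \<ge> 0"
  by (simp add: bump_def flat_exp_def)

lemma bump_pos: "norm z < \<rho> \<Longrightarrow> bump \<rho> z > 0"
  by (simp add: bump_def flat_exp_def power_strict_mono flip: power2_norm_eq_inner)

lemma bump_eq_0: "\<rho> \<le> norm z \<Longrightarrow> \<rho> > 0 \<Longrightarrow> bump \<rho> z = 0"
  by (simp add: bump_def flat_exp_def not_less flip: power2_norm_eq_inner)

lemma bump_le_1: "bump \<rho> z \<le> 1"
  by (auto simp: bump_def flat_exp_def)

lemma continuous_on_bump: "continuous_on S (bump \<rho> :: real^'n \<Rightarrow> real)"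
  using bump_algebra_continuous[OF bump_translate_mem[of \<rho> 0]] by simp

lemma borel_measurable_bump [measurable]: "(bump \<rho> :: real^'n \<Rightarrow> real) \<in> borel_measurable borel"
  by (simp add: borel_measurable_continuous_onI continuous_on_bump)

lemma test_fun_bump:
  assumes "\<rho> > 0" "cball c \<rho> \<subseteq> \<Omega>"
  shows "test_fun \<Omega> (\<lambda>y. bump \<rho> (y - c))"
  unfolding test_fun_def
proof (intro conjI exI[of _ "cball c \<rho>"] allI impI)
  show "smooth_fun (\<lambda>y. bump \<rho> (y - c))"
    using bump_translate_mem smooth_bump_algebra by blast
  show "bump \<rho> (x - c) = 0" if "x \<notin> cball c \<rho>" for x
    using that assms by (intro bump_eq_0) (auto simp: dist_norm norm_minus_commute)
qed (use assms in auto)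

text \<open>Taken in an arbitrary direction, because bumps are differentiated along the segment from
  x to x + e; \<open>weak_partial\<close> supplies only coordinate directions, and linearity joins
  the two.\<close>

definition bump_grad :: "real \<Rightarrow> real^'n \<Rightarrow> real^'n \<Rightarrow> real" where
  "bump_grad \<rho> z e = frechet_derivative (bump \<rho>) (at z) e"

lemma bump_has_derivative: "(bump \<rho> has_derivative bump_grad \<rho> z) (at z)"
  using bump_algebra_differentiable[OF bump_translate_mem[of \<rho> 0], of z]
  by (simp add: frechet_derivative_works bump_grad_def[abs_def])

lemma bump_translate_pd: "iter_pd [j] (\<lambda>y. bump \<rho> (y - c)) y = bump_grad \<rho> (y - c) (axis j 1)"
proof -
  have "((\<lambda>y. bump \<rho> (y - c)) has_derivative bump_grad \<rho> (y - c)) (at y)"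
    by (rule has_derivative_compose[where f = "\<lambda>y. y - c" and f' = "\<lambda>h. h", OF _ bump_has_derivative])
       (auto intro!: derivative_eq_intros)
  thus ?thesis by (simp flip: frechet_derivative_at)
qed

lemma bump_grad_expand: "bump_grad \<rho> z e = (\<Sum>j\<in>UNIV. e $ j * bump_grad \<rho> z (axis j 1))"
proof -
  have "linear (bump_grad \<rho> z)"
    using bump_has_derivative has_derivative_linear by blast
  then have "bump_grad \<rho> z (\<Sum>j\<in>UNIV. e $ j *\<^sub>R axis j 1)
      = (\<Sum>j\<in>UNIV. e $ j * bump_grad \<rho> z (axis j 1))"
    by (simp add: linear_sum linear_scale)
  thus ?thesis
    using basis_expansion[of e] by (simp add: scalar_mult_eq_scaleR)
qed

lemma continuous_on_bump_grad: "continuous_on S (\<lambda>z::real^'n. bump_grad \<rho> z e)"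
proof -
  have "continuous_on S (\<lambda>z::real^'n. bump_grad \<rho> z (axis j 1))" for j
    using bump_algebra_continuous[OF iter_pd_bump_algebra[OF bump_translate_mem[of \<rho> 0], of "[j]"]]
    by (simp add: bump_grad_def)
  hence "continuous_on S (\<lambda>z::real^'n. \<Sum>j\<in>UNIV. e $ j * bump_grad \<rho> z (axis j 1))"
    by (intro continuous_intros)
  thus ?thesis
    by (simp flip: bump_grad_expand)
qed

lemma borel_measurable_bump_grad [measurable]:
  "(\<lambda>z::real^'n. bump_grad \<rho> z e) \<in> borel_measurable borel"
  by (simp add: borel_measurable_continuous_onI continuous_on_bump_grad)

section \<open>Continuity of translation in the mean\<close>

lemma lborel_translate_nn:
  fixes g :: "'a::euclidean_space \<Rightarrow> ennreal"
  assumes [measurable]: "g \<in> borel_measurable borel"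
  shows "(\<integral>\<^sup>+x. g (z + x) \<partial>lborel) = (\<integral>\<^sup>+x. g x \<partial>lborel)"
proof -
  have "(\<integral>\<^sup>+x. g x \<partial>lborel) = (\<integral>\<^sup>+x. g x \<partial>distr lborel borel ((+) z))"
    by (simp add: lborel_distr_plus)
  also have "\<dots> = (\<integral>\<^sup>+x. g (z + x) \<partial>lborel)"
    by (subst nn_integral_distr) auto
  finally show ?thesis by simp
qed

lemma lborel_translate_integrable:
  fixes g :: "'a::euclidean_space \<Rightarrow> real"
  assumes "integrable lborel g"
  shows "integrable lborel (\<lambda>x. g (z + x))"
proof -
  have "integrable (distr lborel borel ((+) z)) g"
    using assms by (simp add: lborel_distr_plus)
  thus ?thesis using assms by (subst (asm) integrable_distr_eq) auto
qed

lemma lborel_translate_integral: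
  fixes g :: "'a::euclidean_space \<Rightarrow> real"
  assumes [measurable]: "g \<in> borel_measurable borel"
  shows "(\<integral>x. g (z + x) \<partial>lborel) = (\<integral>x. g x \<partial>lborel)"
proof -
  have "(\<integral>x. g x \<partial>lborel) = (\<integral>x. g x \<partial>distr lborel borel ((+) z))"
    by (simp add: lborel_distr_plus)
  also have "\<dots> = (\<integral>x. g (z + x) \<partial>lborel)"
    by (subst integral_distr) auto
  finally show ?thesis by simp
qed

definition transl_L1 :: "('a::euclidean_space \<Rightarrow> real) \<Rightarrow> 'a \<Rightarrow> real" where
  "transl_L1 g z = (\<integral>x. \<bar>g (z + x) - g x\<bar> \<partial>lborel)"

lemma transl_L1_nonneg: "transl_L1 g z \<ge> 0"
  by (simp add: transl_L1_def)

lemma transl_L1_integrable: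
  fixes g :: "'a::euclidean_space \<Rightarrow> real"
  assumes "integrable lborel g"
  shows "integrable lborel (\<lambda>x. \<bar>g (z + x) - g x\<bar>)"
  using lborel_translate_integrable[OF assms, of z] assms by auto

text \<open>A closed inner approximation is cut off by a large ball; the parts outside
  \<open>cball 0 n\<close> decrease to the empty set.\<close>

lemma compact_inner_approx:
  fixes A :: "'a::euclidean_space set"
  assumes "A \<in> sets lborel" "emeasure lborel A < \<infinity>" "\<epsilon> > 0"
  obtains K where "compact K" "K \<subseteq> A" "emeasure lborel (A - K) < ennreal \<epsilon>"
proof -
  have A: "A \<in> sets lebesgue" using assms(1) by auto
  obtain T where T: "closed T" "T \<subseteq> A" "A - T \<in> lmeasurable" "emeasure lebesgue (A - T) < ennreal (\<epsilon>/2)"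
    using sets_lebesgue_inner_closed[OF A, of "\<epsilon>/2"] assms by auto
  have [measurable]: "T \<in> sets borel" "A \<in> sets borel"
    using T assms by auto
  have "(\<lambda>n. emeasure lborel (T - cball 0 (real n))) \<longlonglongrightarrow> emeasure lborel (\<Inter>n. T - cball 0 (real n))"
  proof (rule Lim_emeasure_decseq)
    show "decseq (\<lambda>n. T - cball 0 (real n))"
      by (auto simp: decseq_def)
    fix n
    have "emeasure lborel (T - cball 0 (real n)) \<le> emeasure lborel A"
      using T by (intro emeasure_mono) auto
    thus "emeasure lborel (T - cball 0 (real n)) \<noteq> \<infinity>"
      using assms by auto
  qed auto
  moreover have "(\<Inter>n. T - cball 0 (real n)) = {}"
    using real_arch_simple by (fastforce simp: dist_norm)
  ultimately have "(\<lambda>n. emeasure lborel (T - cball 0 (real n))) \<longlonglongrightarrow> 0"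
    by (simp only: emeasure_empty)
  hence "\<forall>\<^sub>F n in sequentially. emeasure lborel (T - cball 0 (real n)) < ennreal (\<epsilon>/2)"
    using assms by (intro order_tendstoD) auto
  then obtain n where n: "emeasure lborel (T - cball 0 (real n)) < ennreal (\<epsilon>/2)"
    by (auto simp: eventually_sequentially)
  show thesis
  proof
    show "compact (T \<inter> cball 0 (real n))" using T by (simp add: closed_Int_compact)
    show "T \<inter> cball 0 (real n) \<subseteq> A" using T by auto
    have "emeasure lborel (A - T \<inter> cball 0 (real n)) \<le> emeasure lborel ((A - T) \<union> (T - cball 0 (real n)))"
      by (intro emeasure_mono) auto
    also have "\<dots> \<le> emeasure lborel (A - T) + emeasure lborel (T - cball 0 (real n))"
      by (intro emeasure_subadditive) auto
    also have "\<dots> < ennreal (\<epsilon>/2) + ennreal (\<epsilon>/2)"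
      using T(4) n by (intro add_strict_mono) auto
    also have "\<dots> = ennreal \<epsilon>" using assms by (simp flip: ennreal_plus)
    finally show "emeasure lborel (A - T \<inter> cball 0 (real n)) < ennreal \<epsilon>" .
  qed
qed

text \<open>Squeeze A between a compact K and an open U. For a shift z that keeps K inside U, the
  indicator of A can change between x and z + x only if one of these points lies in U - K, a set of
  small measure.\<close>

lemma transl_L1_tendsto_indicator:
  fixes A :: "'a::euclidean_space set"
  assumes A: "A \<in> sets lborel" "emeasure lborel A < \<infinity>"
  shows "(transl_L1 (indicator A) \<longlongrightarrow> 0) (at 0)"
proof (rule tendstoI)
  fix \<epsilon> :: real assume "\<epsilon> > 0"
  obtain K where K: "compact K" "K \<subseteq> A" "emeasure lborel (A - K) < ennreal (\<epsilon>/4)"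
    using compact_inner_approx[OF A, of "\<epsilon>/4"] \<open>\<epsilon> > 0\<close> by auto
  obtain U where U: "open U" "A \<subseteq> U" "emeasure lborel (U - A) < ennreal (\<epsilon>/4)"
    using outer_regular_lborel[of A "\<epsilon>/4"] A \<open>\<epsilon> > 0\<close> by auto
  have [measurable]: "A \<in> sets borel" "K \<in> sets borel" "U \<in> sets borel"
    using A K U by (auto intro: borel_compact)
  obtain \<delta> where \<delta>: "\<delta> > 0" "\<And>x. x \<in> K \<Longrightarrow> ball x \<delta> \<subseteq> U"
  proof (cases "K = {}")
    case True thus thesis using that[of 1] by auto
  next
    case False
    obtain d where "d > 0" "(\<Union>x\<in>K. ball x d) \<subseteq> U"
      using compact_subset_open_imp_ball_epsilon_subset[OF K(1) U(1)] K U by blast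
    thus thesis using that by blast
  qed
  have "transl_L1 (indicator A) z < \<epsilon>" if z: "norm z < \<delta>" for z
  proof -
    let ?D = "U - K"
    have eD: "emeasure lborel ?D < ennreal (\<epsilon>/2)"
    proof -
      have "emeasure lborel ?D \<le> emeasure lborel ((U - A) \<union> (A - K))"
        by (intro emeasure_mono) auto
      also have "\<dots> \<le> emeasure lborel (U - A) + emeasure lborel (A - K)"
        by (intro emeasure_subadditive) auto
      also have "\<dots> < ennreal (\<epsilon>/4) + ennreal (\<epsilon>/4)"
        using K U by (intro add_strict_mono) auto
      also have "\<dots> = ennreal (\<epsilon>/2)" using \<open>\<epsilon> > 0\<close> by (simp flip: ennreal_plus)
      finally show ?thesis .
    qed
    have le: "\<bar>indicator A (z + x) - indicator A x\<bar> \<le> (indicator ?D x + indicator ?D (z + x) :: real)" for x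
    proof -
      have "z + x \<in> U" if "x \<in> K"
        using \<delta>(2)[OF that] z by (auto simp: dist_norm)
      moreover have "x \<in> U" if "z + x \<in> K"
        using \<delta>(2)[OF that] z by (auto simp: dist_norm)
      ultimately show ?thesis
        using K(2) U(2) by (auto simp: indicator_def)
    qed
    have "ennreal (transl_L1 (indicator A) z) = (\<integral>\<^sup>+x. ennreal \<bar>indicator A (z + x) - indicator A x\<bar> \<partial>lborel)"
      unfolding transl_L1_def
      by (rule nn_integral_eq_integral[symmetric])
         (use A in \<open>auto intro!: transl_L1_integrable integrable_real_indicator\<close>)
    also have "\<dots> \<le> (\<integral>\<^sup>+x. indicator ?D x + indicator ?D (z + x) \<partial>lborel)"
    proof (rule nn_integral_mono)
      fix x
      have "ennreal \<bar>indicator A (z + x) - indicator A x\<bar> \<le> ennreal (indicator ?D x + indicator ?D (z + x))"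
        by (rule ennreal_leI[OF le])
      thus "ennreal \<bar>indicator A (z + x) - indicator A x\<bar> \<le> indicator ?D x + indicator ?D (z + x)"
        by (simp add: ennreal_indicator)
    qed
    also have "\<dots> = (\<integral>\<^sup>+x. indicator ?D x \<partial>lborel) + (\<integral>\<^sup>+x. indicator ?D (z + x) \<partial>lborel)"
      by (subst nn_integral_add) auto
    also have "\<dots> = emeasure lborel ?D + emeasure lborel ?D"
      by (subst lborel_translate_nn) auto
    also have "\<dots> < ennreal (\<epsilon>/2) + ennreal (\<epsilon>/2)"
      using eD by (intro add_strict_mono) auto
    also have "\<dots> = ennreal \<epsilon>" using \<open>\<epsilon> > 0\<close> by (simp flip: ennreal_plus)
    finally show ?thesis using \<open>\<epsilon> > 0\<close> by (simp add: ennreal_less_iff transl_L1_nonneg)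
  qed
  thus "\<forall>\<^sub>F x in at 0. dist (transl_L1 (indicator A) x) 0 < \<epsilon>"
    unfolding eventually_at using \<open>\<delta> > 0\<close>
    by (auto simp: dist_norm transl_L1_nonneg intro!: exI[of _ \<delta>])
qed

lemma transl_L1_add_le:
  fixes f g :: "'a::euclidean_space \<Rightarrow> real"
  assumes f: "integrable lborel f" and g: "integrable lborel g"
  shows "transl_L1 (\<lambda>x. f x + g x) z \<le> transl_L1 f z + transl_L1 g z"
proof -
  have "transl_L1 (\<lambda>x. f x + g x) z \<le> (\<integral>x. \<bar>f (z + x) - f x\<bar> + \<bar>g (z + x) - g x\<bar> \<partial>lborel)"
    unfolding transl_L1_def
    by (rule integral_mono)
       (use transl_L1_integrable[of "\<lambda>x. f x + g x"] transl_L1_integrable[OF f] transl_L1_integrable[OF g] f g in auto)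
  also have "\<dots> = transl_L1 f z + transl_L1 g z"
    unfolding transl_L1_def using transl_L1_integrable[OF f] transl_L1_integrable[OF g] by simp
  finally show ?thesis .
qed

lemma transl_L1_le:
  fixes f :: "'a::euclidean_space \<Rightarrow> real"
  assumes f: "integrable lborel f"
  shows "transl_L1 f z \<le> 2 * (\<integral>x. \<bar>f x\<bar> \<partial>lborel)"
proof -
  have i: "integrable lborel (\<lambda>x. \<bar>f (z + x)\<bar>)"
    using lborel_translate_integrable[OF f] by auto
  have "transl_L1 f z \<le> (\<integral>x. \<bar>f (z + x)\<bar> + \<bar>f x\<bar> \<partial>lborel)"
    unfolding transl_L1_def
    by (rule integral_mono) (use transl_L1_integrable[OF f] f i in auto)
  also have "\<dots> = (\<integral>x. \<bar>f (z + x)\<bar> \<partial>lborel) + (\<integral>x. \<bar>f x\<bar> \<partial>lborel)"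
    using f i by simp
  also have "(\<integral>x. \<bar>f (z + x)\<bar> \<partial>lborel) = (\<integral>x. \<bar>f x\<bar> \<partial>lborel)"
    by (rule lborel_translate_integral) (use f in auto)
  finally show ?thesis by simp
qed

text \<open>The claim holds for indicators, survives scaling and sums, and passes to L1 limits
  because \<open>transl_L1\<close> is at most twice the L1 norm, uniformly in the shift.\<close>

lemma transl_L1_tendsto_0:
  fixes f :: "'a::euclidean_space \<Rightarrow> real"
  assumes "integrable lborel f"
  shows "(transl_L1 f \<longlongrightarrow> 0) (at 0)"
  using assms
proof (induction rule: integrable_induct)
  case (base A c)
  have "transl_L1 (\<lambda>x. indicator A x *\<^sub>R c) = (\<lambda>z. transl_L1 (indicator A) z * \<bar>c\<bar>)"
    by (simp add: transl_L1_def fun_eq_iff left_diff_distrib[symmetric] abs_mult)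
  thus ?case
    using tendsto_mult_left_zero[OF transl_L1_tendsto_indicator[OF base]] by simp
next
  case (add f g)
  have "((\<lambda>z. transl_L1 f z + transl_L1 g z) \<longlongrightarrow> 0) (at 0)"
    using tendsto_add[OF add.IH] by simp
  thus ?case
    by (rule tendsto_sandwich[OF _ _ tendsto_const, rotated 2])
       (auto simp: transl_L1_nonneg intro!: transl_L1_add_le add.hyps always_eventually)
next
  case (lim f s)
  have f_m: "f \<in> borel_measurable lborel" and fi: "integrable lborel f" using lim by auto
  have "(\<lambda>n. \<integral>x. \<bar>f x - s n x\<bar> \<partial>lborel) \<longlonglongrightarrow> (\<integral>x. 0 \<partial>(lborel :: 'a measure))"
  \<comment> \<open>The approximants satisfy |s n| \<le> 2 |f|, hence the majorant 3 |f|.\<close>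
  proof (rule integral_dominated_convergence[where w = "\<lambda>x. 3 * \<bar>f x\<bar>"])
    show "AE x in lborel. (\<lambda>n. \<bar>f x - s n x\<bar>) \<longlonglongrightarrow> 0"
    proof (rule AE_I2)
      fix x
      have "(\<lambda>n. s n x) \<longlonglongrightarrow> f x" using lim.hyps(2)[of x] by simp
      from tendsto_rabs[OF tendsto_diff[OF tendsto_const[of "f x"] this]]
      show "(\<lambda>n. \<bar>f x - s n x\<bar>) \<longlonglongrightarrow> 0" by simp
    qed
    fix n
    have "norm \<bar>f x - s n x\<bar> \<le> 3 * \<bar>f x\<bar>" for x
      using lim.hyps(3)[of x n] by auto
    thus "AE x in lborel. norm \<bar>f x - s n x\<bar> \<le> 3 * \<bar>f x\<bar>" by auto
  qed (use lim in auto)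
  hence L: "(\<lambda>n. \<integral>x. \<bar>f x - s n x\<bar> \<partial>lborel) \<longlonglongrightarrow> 0" by simp
  show ?case
  proof (rule tendstoI)
    fix \<epsilon> :: real assume "\<epsilon> > 0"
    hence "\<forall>\<^sub>F n in sequentially. (\<integral>x. \<bar>f x - s n x\<bar> \<partial>lborel) < \<epsilon>/4"
      by (intro order_tendstoD(2)[OF L]) auto
    then obtain n where n: "(\<integral>x. \<bar>f x - s n x\<bar> \<partial>lborel) < \<epsilon>/4"
      by (auto simp: eventually_sequentially)
    have "\<forall>\<^sub>F z in at 0. transl_L1 (s n) z < \<epsilon>/2"
      using \<open>\<epsilon> > 0\<close> by (intro order_tendstoD(2)[OF lim.IH]) auto
    thus "\<forall>\<^sub>F z in at 0. dist (transl_L1 f z) 0 < \<epsilon>"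
    proof eventually_elim
      case (elim z)
      have i: "integrable lborel (\<lambda>x. f x - s n x)" using lim by auto
      have "transl_L1 f z \<le> transl_L1 (\<lambda>x. f x - s n x) z + transl_L1 (s n) z"
        using transl_L1_add_le[OF i lim.hyps(1)[of n], of z] by simp
      also have "\<dots> < \<epsilon>"
        using transl_L1_le[OF i, of z] n elim by linarith
      finally show ?case by (simp add: transl_L1_nonneg)
    qed
  qed
qed

lemma transl_L1_small:
  fixes f :: "'a::euclidean_space \<Rightarrow> real"
  assumes "integrable lborel f" "\<epsilon> > 0"
  obtains \<delta> where "\<delta> > 0" "\<And>z. norm z < \<delta> \<Longrightarrow> transl_L1 f z < \<epsilon>"
proof -
  have "\<forall>\<^sub>F z in at 0. transl_L1 f z < \<epsilon>"
    using order_tendstoD(2)[OF transl_L1_tendsto_0[OF assms(1)]] assms(2) by blast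
  then obtain \<delta> where \<delta>: "\<delta> > 0" "\<And>z. z \<noteq> 0 \<Longrightarrow> norm z < \<delta> \<Longrightarrow> transl_L1 f z < \<epsilon>"
    unfolding eventually_at by (auto simp: dist_norm)
  moreover have "transl_L1 f 0 < \<epsilon>" using assms(2) by (simp add: transl_L1_def)
  ultimately show thesis using that by metis
qed

section \<open>Testing against bumps\<close>

lemma integrable_bump: "integrable lborel (bump \<rho> :: real^'n \<Rightarrow> real)" if "\<rho> > 0"
proof -
  have "integrable lborel (\<lambda>x::real^'n. indicator (cball 0 \<rho>) x :: real)"
    using emeasure_lborel_cball_finite by (intro integrable_real_indicator) auto
  thus ?thesis
  proof (rule Bochner_Integration.integrable_bound)
    show "AE x::real^'n in lborel. norm (bump \<rho> x) \<le> norm (indicator (cball 0 \<rho>) x :: real)"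
    proof (rule AE_I2)
      fix x :: "real^'n"
      show "norm (bump \<rho> x) \<le> norm (indicator (cball 0 \<rho>) x :: real)"
        using bump_eq_0[of \<rho> x] that by (auto simp: bump_nonneg bump_le_1 indicator_def)
    qed
  qed auto
qed

lemma integral_bump_pos: "(\<integral>x. bump \<rho> (x::real^'n) \<partial>lborel) > 0" if "\<rho> > 0"
proof (rule ccontr)
  assume "\<not> ?thesis"
  hence "(\<integral>x. bump \<rho> (x::real^'n) \<partial>lborel) = 0"
    by (meson Bochner_Integration.integral_nonneg bump_nonneg dual_order.order_iff_strict)
  hence "AE x::real^'n in lborel. bump \<rho> x = 0"
    using integral_nonneg_eq_0_iff_AE[OF integrable_bump[OF that, where 'n = 'n]] by (simp add: bump_nonneg)
  hence "AE x::real^'n in lborel. x \<notin> ball 0 \<rho>"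
    by eventually_elim (use bump_pos in \<open>force\<close>)
  hence "emeasure lborel (ball 0 \<rho> :: (real^'n) set) = 0"
    by (subst (asm) AE_iff_measurable[of "ball 0 \<rho>"]) auto
  thus False using content_ball_pos[OF that, of "0::real^'n"] by (simp add: measure_def)
qed

lemma integrable_mult_bounded:
  fixes f g :: "'a \<Rightarrow> real"
  assumes "integrable M f" "g \<in> borel_measurable M" "\<And>x. \<bar>g x\<bar> \<le> B"
  shows "integrable M (\<lambda>x. f x * g x)"
proof (rule Bochner_Integration.integrable_bound)
  show "integrable M (\<lambda>x. B * f x)" using assms by simp
  show "AE x in M. norm (f x * g x) \<le> norm (B * f x)"
  proof (rule AE_I2)
    fix x
    have "\<bar>g x\<bar> \<le> \<bar>B\<bar>" using assms(3)[of x] by linarith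
    thus "norm (f x * g x) \<le> norm (B * f x)"
      by (simp add: abs_mult mult.commute[of "\<bar>f x\<bar>"] mult_right_mono)
  qed
qed (use assms in auto)

text \<open>A local form of the fundamental lemma of the calculus of variations. Orthogonality at x
  turns P x times the mass of the bump into minus the integral of (P (z + x) - P x) against the
  bump. Integrating over x in K and exchanging integrals bounds the L1 norm of P on K by
  \<open>transl_L1 P z\<close> over small z.\<close>

lemma bump_orthogonal_imp_AE_0:
  fixes P :: "real^'n \<Rightarrow> real"
  assumes P: "integrable lborel P" and K: "K \<in> sets borel" and "\<delta> > 0"
    and orth: "\<And>x \<rho>. x \<in> K \<Longrightarrow> 0 < \<rho> \<Longrightarrow> \<rho> < \<delta> \<Longrightarrow> (\<integral>y. P y * bump \<rho> (y - x) \<partial>lborel) = 0"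
  shows "AE x in lborel. x \<in> K \<longrightarrow> P x = 0"
proof -
  have [measurable]: "P \<in> borel_measurable borel" "K \<in> sets borel"
    using P K by auto
  have le: "(\<integral>\<^sup>+x. indicator K x * ennreal \<bar>P x\<bar> \<partial>lborel) \<le> ennreal \<epsilon>" if "\<epsilon> > 0" for \<epsilon>
  proof -
    obtain \<delta>' where \<delta>': "\<delta>' > 0" "\<And>z. norm z < \<delta>' \<Longrightarrow> transl_L1 P z < \<epsilon>"
      using transl_L1_small[OF P \<open>\<epsilon> > 0\<close>] by metis
    define \<rho> where "\<rho> = min \<delta> \<delta>' / 2"
    have \<rho>: "\<rho> > 0" "\<rho> < \<delta>" "\<rho> < \<delta>'" using \<open>\<delta> > 0\<close> \<delta>' by (auto simp: \<rho>_def)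
    define I where "I = (\<integral>z. bump \<rho> (z::real^'n) \<partial>lborel)"
    have I: "I > 0" unfolding I_def by (rule integral_bump_pos[OF \<rho>(1)])
    have bI: "(\<integral>\<^sup>+z. ennreal (bump \<rho> (z::real^'n)) \<partial>lborel) = ennreal I"
      unfolding I_def by (intro nn_integral_eq_integral integrable_bump \<rho>) (auto simp: bump_nonneg)
    have pt: "ennreal (\<bar>P x\<bar> * I) \<le> (\<integral>\<^sup>+z. ennreal (\<bar>P (z + x) - P x\<bar> * bump \<rho> z) \<partial>lborel)"
      if "x \<in> K" for x
    proof -
      have i1: "integrable lborel (\<lambda>z. P (z + x) * bump \<rho> z)"
        using lborel_translate_integrable[OF P, of x]
        by (intro integrable_mult_bounded[where B = 1]) (auto simp: add.commute bump_nonneg bump_le_1)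
      have i2: "integrable lborel (\<lambda>z::real^'n. P x * bump \<rho> z)"
        using integrable_bump[OF \<rho>(1), where 'n = 'n] by simp
      have "(\<integral>z. P (z + x) * bump \<rho> z \<partial>lborel) = (\<integral>y. P y * bump \<rho> (y - x) \<partial>lborel)"
        using lborel_translate_integral[of "\<lambda>y. P y * bump \<rho> (y - x)" x] by (simp add: add.commute)
      also have "\<dots> = 0" by (rule orth[OF that \<rho>(1,2)])
      finally have "(\<integral>z. P (z + x) * bump \<rho> z - P x * bump \<rho> z \<partial>lborel) = - (P x * I)"
        using i1 i2 by (simp add: I_def)
      hence "\<bar>P x\<bar> * I = norm (\<integral>z. P (z + x) * bump \<rho> z - P x * bump \<rho> z \<partial>lborel)"
        using I by (simp add: abs_mult)
      also have "ennreal \<dots> \<le> (\<integral>\<^sup>+z. norm (P (z + x) * bump \<rho> z - P x * bump \<rho> z) \<partial>lborel)"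
        by (rule integral_norm_bound_ennreal) (use i1 i2 in simp)
      also have "\<dots> = (\<integral>\<^sup>+z. ennreal (\<bar>P (z + x) - P x\<bar> * bump \<rho> z) \<partial>lborel)"
        by (simp add: left_diff_distrib[symmetric] abs_mult bump_nonneg)
      finally show ?thesis .
    qed
    have "(\<integral>\<^sup>+x. indicator K x * ennreal \<bar>P x\<bar> \<partial>lborel) * ennreal I
        = (\<integral>\<^sup>+x. indicator K x * ennreal (\<bar>P x\<bar> * I) \<partial>lborel)"
      using I by (simp add: nn_integral_multc[symmetric] ennreal_mult' mult.assoc)
    also have "\<dots> \<le> (\<integral>\<^sup>+x. (\<integral>\<^sup>+z. ennreal (\<bar>P (z + x) - P x\<bar> * bump \<rho> z) \<partial>lborel) \<partial>lborel)"
      using pt by (intro nn_integral_mono) (auto simp: indicator_def)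
    also have "\<dots> = (\<integral>\<^sup>+z. (\<integral>\<^sup>+x. ennreal (\<bar>P (z + x) - P x\<bar> * bump \<rho> z) \<partial>lborel) \<partial>lborel)"
      by (rule lborel_pair.Fubini'[symmetric]) measurable
    also have "\<dots> \<le> (\<integral>\<^sup>+z. ennreal \<epsilon> * ennreal (bump \<rho> (z::real^'n)) \<partial>lborel)"
    proof (rule nn_integral_mono)
      fix z :: "real^'n"
      have "(\<integral>\<^sup>+x. ennreal (\<bar>P (z + x) - P x\<bar> * bump \<rho> z) \<partial>lborel)
          = (\<integral>\<^sup>+x. ennreal \<bar>P (z + x) - P x\<bar> \<partial>lborel) * ennreal (bump \<rho> z)"
        by (simp add: nn_integral_multc[symmetric] ennreal_mult' bump_nonneg)
      also have "(\<integral>\<^sup>+x. ennreal \<bar>P (z + x) - P x\<bar> \<partial>lborel) = ennreal (transl_L1 P z)"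
        unfolding transl_L1_def by (rule nn_integral_eq_integral) (auto intro: transl_L1_integrable P)
      also have "ennreal (transl_L1 P z) * ennreal (bump \<rho> z) \<le> ennreal \<epsilon> * ennreal (bump \<rho> z)"
      proof (cases "norm z < \<rho>")
        case True thus ?thesis
          using \<delta>'(2)[of z] \<rho> by (intro mult_right_mono ennreal_leI) auto
      qed (use bump_eq_0[of \<rho> z] \<rho> in auto)
      finally show "(\<integral>\<^sup>+x. ennreal (\<bar>P (z + x) - P x\<bar> * bump \<rho> z) \<partial>lborel) \<le> ennreal \<epsilon> * ennreal (bump \<rho> z)" .
    qed
    also have "\<dots> = ennreal \<epsilon> * ennreal I"
      by (simp add: nn_integral_cmult bI)
    finally show ?thesis
      using I by (simp add: ennreal_mult_le_mult_iff mult.commute[of _ "ennreal I"])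
  qed
  have "(\<integral>\<^sup>+x. indicator K x * ennreal \<bar>P x\<bar> \<partial>lborel) \<le> 0"
    by (rule ennreal_le_epsilon) (use le in auto)
  hence "(\<integral>\<^sup>+x. indicator K x * ennreal \<bar>P x\<bar> \<partial>lborel) = 0" by simp
  hence "AE x in lborel. indicator K x * ennreal \<bar>P x\<bar> = 0"
    by (subst (asm) nn_integral_0_iff_AE) auto
  thus ?thesis
    by eventually_elim (auto simp: indicator_def split: if_splits)
qed

section \<open>Increments of a function as line integrals of its weak gradient\<close>

lemma bump_grad_eq_0:
  fixes z :: "real^'n"
  assumes "\<rho> > 0" "norm z > \<rho>"
  shows "bump_grad \<rho> z e = 0"
proof -
  have "((\<lambda>_::real^'n. 0::real) has_derivative (\<lambda>_. 0)) (at z)" by simp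
  hence "(bump \<rho> has_derivative (\<lambda>_. 0)) (at z)"
    by (rule has_derivative_transform_within_open[where s = "- cball 0 \<rho>"])
       (use assms in \<open>auto simp: dist_norm intro: bump_eq_0\<close>)
  thus ?thesis
    using has_derivative_unique[OF bump_has_derivative] by metis
qed

lemma bump_grad_bounded:
  assumes "\<rho> > 0"
  obtains B where "\<And>z::real^'n. \<bar>bump_grad \<rho> z e\<bar> \<le> B"
proof -
  have "bounded ((\<lambda>z::real^'n. bump_grad \<rho> z e) ` cball 0 \<rho>)"
    by (intro compact_imp_bounded compact_continuous_image continuous_on_bump_grad) auto
  then obtain B where "\<forall>z\<in>cball (0::real^'n) \<rho>. \<bar>bump_grad \<rho> z e\<bar> \<le> B"
    by (auto simp: bounded_iff)
  hence B: "\<bar>bump_grad \<rho> z e\<bar> \<le> B" if "norm z \<le> \<rho>" for z :: "real^'n"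
    using that by simp
  have "\<bar>bump_grad \<rho> z e\<bar> \<le> \<bar>B\<bar>" for z :: "real^'n"
    using B[of z] bump_grad_eq_0[of \<rho> z] assms by (cases "norm z \<le> \<rho>") auto
  thus thesis using that by blast
qed

lemma bump_line_integral:
  fixes w e :: "real^'n"
  shows "(\<integral>s. bump_grad \<rho> (w - s *\<^sub>R e) e * indicator {0..1} s \<partial>lborel) = bump \<rho> w - bump \<rho> (w - e)"
proof -
  have "(\<integral>s. bump_grad \<rho> (w - s *\<^sub>R e) e * indicator {0..1} s \<partial>lborel)
      = (- bump \<rho> (w - 1 *\<^sub>R e)) - (- bump \<rho> (w - 0 *\<^sub>R e))"
  proof (rule integral_FTC_Icc_real)
    fix s :: real
    have lin: "linear (bump_grad \<rho> (w - s *\<^sub>R e))"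
      using bump_has_derivative has_derivative_linear by blast
    have "((\<lambda>s. bump \<rho> (w - s *\<^sub>R e)) has_derivative (\<lambda>h. bump_grad \<rho> (w - s *\<^sub>R e) (- (h *\<^sub>R e)))) (at s)"
      by (rule has_derivative_compose[where f = "\<lambda>s. w - s *\<^sub>R e" and f' = "\<lambda>h. - (h *\<^sub>R e)", OF _ bump_has_derivative])
         (auto intro!: derivative_eq_intros)
    moreover have "(\<lambda>h. bump_grad \<rho> (w - s *\<^sub>R e) (- (h *\<^sub>R e))) = (*) (- bump_grad \<rho> (w - s *\<^sub>R e) e)"
      using lin by (simp add: linear_neg linear_scale fun_eq_iff)
    ultimately have "((\<lambda>s. bump \<rho> (w - s *\<^sub>R e)) has_field_derivative (- bump_grad \<rho> (w - s *\<^sub>R e) e)) (at s)"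
      by (simp only: has_field_derivative_def)
    from DERIV_minus[OF this]
    show "((\<lambda>s. - bump \<rho> (w - s *\<^sub>R e)) has_real_derivative bump_grad \<rho> (w - s *\<^sub>R e) e) (at s)"
      by simp
    show "isCont (\<lambda>s. bump_grad \<rho> (w - s *\<^sub>R e) e) s"
      using continuous_on_compose2[OF continuous_on_bump_grad[of UNIV \<rho> e], of UNIV "\<lambda>s. w - s *\<^sub>R e"]
      by (auto simp: continuous_on_eq_continuous_at intro!: continuous_intros)
  qed simp
  thus ?thesis by simp
qed

text \<open>Let P be the difference of the two sides of the formula. Tested against a bump at x, its
  line integral of G becomes an integral of H against a difference of two bumps, which is exactly
  what the increment of H gives; so P is orthogonal to all small bumps centred in K. The hypothesis
  \<open>seg\<close> expresses that bumps centred on the whole segment are admissible.\<close>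

lemma weak_gradient_increment:
  fixes H :: "real^'n \<Rightarrow> real" and G :: "'n \<Rightarrow> real^'n \<Rightarrow> real"
  assumes H: "integrable lborel H" and G: "\<And>j. integrable lborel (G j)"
    and K: "K \<in> sets borel" and "\<delta> > 0"
    and seg: "\<And>x s \<rho> j. x \<in> K \<Longrightarrow> 0 \<le> s \<Longrightarrow> s \<le> 1 \<Longrightarrow> 0 < \<rho> \<Longrightarrow> \<rho> < \<delta> \<Longrightarrow>
       (\<integral>y. H y * bump_grad \<rho> (y - (x + s *\<^sub>R e)) (axis j 1) \<partial>lborel)
        = - (\<integral>y. G j y * bump \<rho> (y - (x + s *\<^sub>R e)) \<partial>lborel)"
  shows "AE x in lborel. x \<in> K \<longrightarrow>
     integrable lborel (\<lambda>s. (\<Sum>j\<in>UNIV. e $ j * G j (x + s *\<^sub>R e)) * indicator {0..1} s) \<and>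
     H (x + e) - H x = (\<integral>s. (\<Sum>j\<in>UNIV. e $ j * G j (x + s *\<^sub>R e)) * indicator {0..1} s \<partial>lborel)"
proof -
  define Ge where "Ge = (\<lambda>x. \<Sum>j\<in>UNIV. e $ j * G j x)"
  define f where "f = (\<lambda>s x. Ge (x + s *\<^sub>R e) * indicator {0..1::real} s)"
  have [measurable]: "H \<in> borel_measurable borel" "\<And>j. G j \<in> borel_measurable borel"
    using H G by auto
  have Ge: "integrable lborel Ge" unfolding Ge_def using G by auto
  have [measurable]: "Ge \<in> borel_measurable borel" using Ge by auto
  have fm: "case_prod f \<in> borel_measurable (lborel \<Otimes>\<^sub>M lborel)"
    unfolding f_def by measurable
  have Ge_s: "integrable lborel (\<lambda>x. Ge (x + s *\<^sub>R e))" for s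
    using lborel_translate_integrable[OF Ge, of "s *\<^sub>R e"] by (simp add: add.commute)
  have fi: "integrable (lborel \<Otimes>\<^sub>M lborel) (case_prod f)"
  proof (rule lborel_pair.Fubini_integrable)
    show "AE s in lborel. integrable lborel (\<lambda>x. case_prod f (s, x))"
      using Ge_s by (auto simp: f_def)
    have "(\<integral>x. norm (case_prod f (s, x)) \<partial>lborel) = (\<integral>x. \<bar>Ge x\<bar> \<partial>lborel) * indicator {0..1} s" for s
      using lborel_translate_integral[of "\<lambda>x. \<bar>Ge x\<bar>" "s *\<^sub>R e"]
      by (simp add: f_def abs_mult add.commute)
    thus "integrable lborel (\<lambda>s. \<integral>x. norm (case_prod f (s, x)) \<partial>lborel)"
      by simp
  qed (rule fm)
  define A where "A = (\<lambda>x. \<integral>s. f s x \<partial>lborel)"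
  have A: "integrable lborel A"
    unfolding A_def by (rule lborel_pair.integrable_snd[OF fi])
  define P where "P = (\<lambda>x. H (e + x) - H x - A x)"
  have H_e: "integrable lborel (\<lambda>x. H (e + x))" by (rule lborel_translate_integrable[OF H])
  have P: "integrable lborel P" unfolding P_def using H_e H A by auto
  have "AE x in lborel. x \<in> K \<longrightarrow> P x = 0"
  proof (rule bump_orthogonal_imp_AE_0[OF P K \<open>\<delta> > 0\<close>])
    fix x \<rho> assume x: "x \<in> K" and \<rho>: "0 < \<rho>" "\<rho> < \<delta>"
    let ?b = "\<lambda>y. bump \<rho> (y - x)"
    have mb: "integrable lborel (\<lambda>y. g y * ?b y)" if "integrable lborel g" for g :: "real^'n \<Rightarrow> real"
      by (rule integrable_mult_bounded[OF that, where B = 1]) (auto simp: bump_nonneg bump_le_1)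
    obtain B where B: "\<And>z::real^'n. \<bar>bump_grad \<rho> z e\<bar> \<le> B"
      using bump_grad_bounded[OF \<rho>(1)] by metis
    have weak: "(\<integral>y. Ge y * bump \<rho> (y - (x + s *\<^sub>R e)) \<partial>lborel)
        = - (\<integral>y. H y * bump_grad \<rho> (y - (x + s *\<^sub>R e)) e \<partial>lborel)" if "0 \<le> s" "s \<le> 1" for s
    proof -
      let ?c = "x + s *\<^sub>R e"
      have i1: "integrable lborel (\<lambda>y. G j y * bump \<rho> (y - ?c))" for j
        by (rule integrable_mult_bounded[OF G, where B = 1]) (auto simp: bump_nonneg bump_le_1)
      have i2: "integrable lborel (\<lambda>y. H y * bump_grad \<rho> (y - ?c) (axis j 1))" for j
      proof -
        obtain B where "\<And>z::real^'n. \<bar>bump_grad \<rho> z (axis j 1)\<bar> \<le> B"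
          using bump_grad_bounded[OF \<rho>(1)] by metis
        thus ?thesis by (intro integrable_mult_bounded[OF H, where B = B]) auto
      qed
      have "(\<integral>y. Ge y * bump \<rho> (y - ?c) \<partial>lborel) = (\<integral>y. (\<Sum>j\<in>UNIV. e $ j * (G j y * bump \<rho> (y - ?c))) \<partial>lborel)"
        by (simp add: Ge_def sum_distrib_right mult.assoc)
      also have "\<dots> = (\<Sum>j\<in>UNIV. e $ j * (\<integral>y. G j y * bump \<rho> (y - ?c) \<partial>lborel))"
        using i1 by simp
      also have "\<dots> = - (\<Sum>j\<in>UNIV. e $ j * (\<integral>y. H y * bump_grad \<rho> (y - ?c) (axis j 1) \<partial>lborel))"
        using seg[OF x that \<rho>] by (simp add: sum_negf[symmetric])
      also have "(\<Sum>j\<in>UNIV. e $ j * (\<integral>y. H y * bump_grad \<rho> (y - ?c) (axis j 1) \<partial>lborel))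
          = (\<integral>y. (\<Sum>j\<in>UNIV. e $ j * (H y * bump_grad \<rho> (y - ?c) (axis j 1))) \<partial>lborel)"
        using i2 by simp
      also have "\<dots> = (\<integral>y. H y * bump_grad \<rho> (y - ?c) e \<partial>lborel)"
        by (subst bump_grad_expand[of \<rho> _ e]) (simp add: sum_distrib_left mult_ac)
      finally show ?thesis .
    qed
    have "(\<integral>y. A y * ?b y \<partial>lborel) = (\<integral>y. (\<integral>s. f s y * ?b y \<partial>lborel) \<partial>lborel)"
      by (simp add: A_def)
    also have "\<dots> = (\<integral>s. (\<integral>y. f s y * ?b y \<partial>lborel) \<partial>lborel)"
    proof (rule lborel_pair.Fubini_integral)
      have "integrable (lborel \<Otimes>\<^sub>M lborel) (\<lambda>p. case_prod f p * ?b (snd p))"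
        by (rule integrable_mult_bounded[OF fi, where B = 1]) (auto simp: bump_nonneg bump_le_1)
      thus "integrable (lborel \<Otimes>\<^sub>M lborel) (\<lambda>(s, y). f s y * ?b y)"
        by (simp add: case_prod_beta')
    qed
    \<comment> \<open>A change of variables moves the shift s e from \<open>Ge\<close> to the bump,
      whose centre becomes x + s e, and \<open>weak\<close> applies there. For s outside [0, 1] both
      sides vanish.\<close>
    also have "\<dots> = (\<integral>s. - (\<integral>y. H y * (bump_grad \<rho> (y - (x + s *\<^sub>R e)) e * indicator {0..1} s) \<partial>lborel) \<partial>lborel)"
    proof (rule Bochner_Integration.integral_cong[OF refl])
      fix s :: real
      have "(\<integral>y. Ge (y + s *\<^sub>R e) * ?b y \<partial>lborel) = (\<integral>y. Ge y * bump \<rho> (y - (x + s *\<^sub>R e)) \<partial>lborel)"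
        using lborel_translate_integral[of "\<lambda>y. Ge y * bump \<rho> (y - (x + s *\<^sub>R e))" "s *\<^sub>R e"]
        by (simp add: algebra_simps)
      thus "(\<integral>y. f s y * ?b y \<partial>lborel) = - (\<integral>y. H y * (bump_grad \<rho> (y - (x + s *\<^sub>R e)) e * indicator {0..1} s) \<partial>lborel)"
        using weak[of s] by (cases "s \<in> {0..1}") (auto simp: f_def)
    qed
    also have "\<dots> = - (\<integral>s. (\<integral>y. H y * (bump_grad \<rho> (y - (x + s *\<^sub>R e)) e * indicator {0..1} s) \<partial>lborel) \<partial>lborel)"
      by simp
    also have "(\<integral>s. (\<integral>y. H y * (bump_grad \<rho> (y - (x + s *\<^sub>R e)) e * indicator {0..1} s) \<partial>lborel) \<partial>lborel)
       = (\<integral>y. (\<integral>s. H y * (bump_grad \<rho> (y - (x + s *\<^sub>R e)) e * indicator {0..1} s) \<partial>lborel) \<partial>lborel)"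
    proof (rule lborel_pair.Fubini_integral[symmetric])
      have m: "(\<lambda>z::real^'n. bump_grad \<rho> z e) \<in> borel_measurable borel" by measurable
      have "integrable (lborel \<Otimes>\<^sub>M lborel) (\<lambda>(s::real, y). indicator {0..1} s * H y)"
      proof (rule lborel_pair.Fubini_integrable)
        show "integrable lborel (\<lambda>s::real. \<integral>y. norm (case (s, y) of (s, y) \<Rightarrow> indicator {0..1} s * H y) \<partial>lborel)"
          by (simp add: abs_mult)
        show "AE s::real in lborel. integrable lborel (\<lambda>y. case (s, y) of (s, y) \<Rightarrow> indicator {0..1} s * H y)"
          using H by simp
      qed measurable
      hence "integrable (lborel \<Otimes>\<^sub>M lborel)
          (\<lambda>p. (case p of (s::real, y) \<Rightarrow> indicator {0..1} s * H y) * bump_grad \<rho> (snd p - (x + fst p *\<^sub>R e)) e)"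
        by (rule integrable_mult_bounded[where B = B])
           (use B in \<open>auto intro!: measurable_compose[OF _ m]\<close>)
      thus "integrable (lborel \<Otimes>\<^sub>M lborel)
          (\<lambda>(s, y). H y * (bump_grad \<rho> (y - (x + s *\<^sub>R e)) e * indicator {0..1} s))"
        by (simp add: case_prod_beta' mult_ac)
    qed
    \<comment> \<open>The s-integral is evaluated by the fundamental theorem: the integrand is minus
      the s-derivative of the bump that travels along the segment.\<close>
    also have "\<dots> = (\<integral>y. H y * (?b y - bump \<rho> (y - x - e)) \<partial>lborel)"
      using bump_line_integral[of \<rho> _ e] by (simp add: diff_diff_eq[symmetric])
    also have "\<dots> = (\<integral>y. H y * ?b y \<partial>lborel) - (\<integral>y. H y * bump \<rho> (y - x - e) \<partial>lborel)"
    proof -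
      have "integrable lborel (\<lambda>y. H y * bump \<rho> (y - x - e))"
        by (rule integrable_mult_bounded[OF H, where B = 1]) (auto simp: bump_nonneg bump_le_1)
      thus ?thesis using mb[OF H] by (simp add: right_diff_distrib)
    qed
    also have "(\<integral>y. H y * bump \<rho> (y - x - e) \<partial>lborel) = (\<integral>y. H (e + y) * ?b y \<partial>lborel)"
      using lborel_translate_integral[of "\<lambda>y. H y * bump \<rho> (y - x - e)" e] by (simp add: algebra_simps)
    finally have "(\<integral>y. A y * ?b y \<partial>lborel)
       = (\<integral>y. H (e + y) * ?b y \<partial>lborel) - (\<integral>y. H y * ?b y \<partial>lborel)" by simp
    moreover have "(\<integral>y. P y * ?b y \<partial>lborel)
       = (\<integral>y. H (e + y) * ?b y - H y * ?b y - A y * ?b y \<partial>lborel)"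
      by (simp add: P_def left_diff_distrib)
    ultimately show "(\<integral>y. P y * ?b y \<partial>lborel) = 0"
      using mb[OF H] mb[OF H_e] mb[OF A] by simp
  qed
  moreover have "AE x in lborel. integrable lborel (\<lambda>s. f s x)"
    using lborel_pair.AE_integrable_snd[OF fi] .
  ultimately show ?thesis
    by eventually_elim (auto simp: P_def A_def f_def Ge_def add.commute)
qed

section \<open>Increments of Sobolev functions\<close>

text \<open>H and G are integrable on the whole space, so that translations and Fubini apply without
  domain conditions; V restricts only the test functions. Bumps alone are enough as test functions
  by \<open>bump_orthogonal_imp_AE_0\<close>.\<close>

definition weak_grad_on :: "(real^'n) set \<Rightarrow> (real^'n \<Rightarrow> real) \<Rightarrow> ('n \<Rightarrow> real^'n \<Rightarrow> real) \<Rightarrow> bool" where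
  "weak_grad_on V H G \<longleftrightarrow> integrable lborel H \<and> (\<forall>j. integrable lborel (G j)) \<and>
     (\<forall>c \<rho> j. \<rho> > 0 \<longrightarrow> cball c \<rho> \<subseteq> V \<longrightarrow>
       (\<integral>y. H y * bump_grad \<rho> (y - c) (axis j 1) \<partial>lborel) = - (\<integral>y. G j y * bump \<rho> (y - c) \<partial>lborel))"

text \<open>The quantifier over \<open>a\<close> stands inside the almost-everywhere statement: the
  null set does not depend on the comparison vector, which may therefore later vary with x.\<close>

lemma weak_grad_increment_bound:
  fixes H :: "real^'n \<Rightarrow> real"
  assumes wg: "weak_grad_on V H G" and K: "K \<in> sets borel" and "\<delta> > 0"
    and V: "\<And>x s. x \<in> K \<Longrightarrow> 0 \<le> s \<Longrightarrow> s \<le> 1 \<Longrightarrow> ball (x + s *\<^sub>R e) \<delta> \<subseteq> V"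
  shows "AE x in lborel. x \<in> K \<longrightarrow> (\<forall>a. ennreal \<bar>H (x + e) - H x - (\<Sum>j\<in>UNIV. e $ j * a j)\<bar>
     \<le> (\<integral>\<^sup>+s. (\<Sum>j\<in>UNIV. ennreal (\<bar>e $ j\<bar> * \<bar>G j (x + s *\<^sub>R e) - a j\<bar>) * indicator {0..1} s) \<partial>lborel))"
proof -
  have G: "\<And>j. integrable lborel (G j)" and H: "integrable lborel H" using wg by (auto simp: weak_grad_on_def)
  have "AE x in lborel. x \<in> K \<longrightarrow>
     integrable lborel (\<lambda>s. (\<Sum>j\<in>UNIV. e $ j * G j (x + s *\<^sub>R e)) * indicator {0..1} s) \<and>
     H (x + e) - H x = (\<integral>s. (\<Sum>j\<in>UNIV. e $ j * G j (x + s *\<^sub>R e)) * indicator {0..1} s \<partial>lborel)"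
  proof (rule weak_gradient_increment[OF H G K \<open>\<delta> > 0\<close>])
    fix x s \<rho> and j :: 'n assume *: "x \<in> K" "0 \<le> s" "s \<le> (1::real)" "0 < \<rho>" "\<rho> < \<delta>"
    have "cball (x + s *\<^sub>R e) \<rho> \<subseteq> V"
      using V[OF *(1-3)] *(5) by (auto simp: subset_iff)
    thus "(\<integral>y. H y * bump_grad \<rho> (y - (x + s *\<^sub>R e)) (axis j 1) \<partial>lborel)
        = - (\<integral>y. G j y * bump \<rho> (y - (x + s *\<^sub>R e)) \<partial>lborel)"
      using wg *(4) unfolding weak_grad_on_def by blast
  qed
  thus ?thesis
  proof eventually_elim
    case (elim x)
    show ?case
    proof (intro impI allI)
      fix a assume "x \<in> K"
      with elim have i: "integrable lborel (\<lambda>s. (\<Sum>j\<in>UNIV. e $ j * G j (x + s *\<^sub>R e)) * indicator {0..1} s)"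
        and eq: "H (x + e) - H x = (\<integral>s. (\<Sum>j\<in>UNIV. e $ j * G j (x + s *\<^sub>R e)) * indicator {0..1} s \<partial>lborel)"
        by auto
      let ?c = "\<Sum>j\<in>UNIV. e $ j * a j"
      have i2: "integrable lborel (\<lambda>s::real. ?c * indicator {0..1} s)" by simp
      have "H (x + e) - H x - ?c
        = (\<integral>s. (\<Sum>j\<in>UNIV. e $ j * G j (x + s *\<^sub>R e)) * indicator {0..1} s - ?c * indicator {0..1} s \<partial>lborel)"
        using i i2 eq by simp
      hence "ennreal \<bar>H (x + e) - H x - ?c\<bar>
        \<le> (\<integral>\<^sup>+s. norm ((\<Sum>j\<in>UNIV. e $ j * G j (x + s *\<^sub>R e)) * indicator {0..1} s - ?c * indicator {0..1} s) \<partial>lborel)"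
        using integral_norm_bound_ennreal[OF Bochner_Integration.integrable_diff[OF i i2]] by simp
      also have "\<dots> \<le> (\<integral>\<^sup>+s. (\<Sum>j\<in>UNIV. ennreal (\<bar>e $ j\<bar> * \<bar>G j (x + s *\<^sub>R e) - a j\<bar>) * indicator {0..1} s) \<partial>lborel)"
      proof (rule nn_integral_mono)
        fix s :: real
        have "\<bar>(\<Sum>j\<in>UNIV. e $ j * G j (x + s *\<^sub>R e)) - ?c\<bar> = \<bar>\<Sum>j\<in>UNIV. e $ j * (G j (x + s *\<^sub>R e) - a j)\<bar>"
          by (simp add: sum_subtractf right_diff_distrib)
        also have "\<dots> \<le> (\<Sum>j\<in>UNIV. \<bar>e $ j\<bar> * \<bar>G j (x + s *\<^sub>R e) - a j\<bar>)"
          by (rule order_trans[OF sum_abs]) (simp add: abs_mult)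
        finally have "ennreal \<bar>(\<Sum>j\<in>UNIV. e $ j * G j (x + s *\<^sub>R e)) - ?c\<bar>
           \<le> (\<Sum>j\<in>UNIV. ennreal (\<bar>e $ j\<bar> * \<bar>G j (x + s *\<^sub>R e) - a j\<bar>))"
          by (subst sum_ennreal) (auto intro: ennreal_leI)
        thus "ennreal (norm ((\<Sum>j\<in>UNIV. e $ j * G j (x + s *\<^sub>R e)) * indicator {0..1} s - ?c * indicator {0..1} s))
          \<le> (\<Sum>j\<in>UNIV. ennreal (\<bar>e $ j\<bar> * \<bar>G j (x + s *\<^sub>R e) - a j\<bar>) * indicator {0..1} s)"
          by (cases "s \<in> {0..1}") auto
      qed
      finally show "ennreal \<bar>H (x + e) - H x - ?c\<bar>
        \<le> (\<integral>\<^sup>+s. (\<Sum>j\<in>UNIV. ennreal (\<bar>e $ j\<bar> * \<bar>G j (x + s *\<^sub>R e) - a j\<bar>) * indicator {0..1} s) \<partial>lborel)" .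
    qed
  qed
qed

text \<open>Used with two comparison fields: A = 0 yields a Poincare-type estimate for continuity, A
  = G the first-order error for approximate differentiability.\<close>

lemma weak_grad_increment_L1:
  fixes H :: "real^'n \<Rightarrow> real" and M :: "'n \<Rightarrow> ennreal"
  assumes wg: "weak_grad_on V H G" and K: "K \<in> sets borel" and "\<delta> > 0"
    and V: "\<And>x s. x \<in> K \<Longrightarrow> 0 \<le> s \<Longrightarrow> s \<le> 1 \<Longrightarrow> ball (x + s *\<^sub>R e) \<delta> \<subseteq> V"
    and A: "\<And>j. A j \<in> borel_measurable borel"
    and M: "\<And>j s. 0 \<le> s \<Longrightarrow> s \<le> 1 \<Longrightarrow>
      (\<integral>\<^sup>+x. ennreal \<bar>G j (x + s *\<^sub>R e) - A j x\<bar> * indicator K x \<partial>lborel) \<le> M j"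
  shows "(\<integral>\<^sup>+x. ennreal \<bar>H (x + e) - H x - (\<Sum>j\<in>UNIV. e $ j * A j x)\<bar> * indicator K x \<partial>lborel)
     \<le> ennreal (norm e) * (\<Sum>j\<in>UNIV. M j)"
proof -
  have "integrable lborel (G j)" for j
    using wg by (simp add: weak_grad_on_def)
  hence [measurable]: "G j \<in> borel_measurable borel" for j
    by auto
  have [measurable]: "H \<in> borel_measurable borel" "\<And>j. A j \<in> borel_measurable borel" "K \<in> sets borel"
    using wg A K by (auto simp: weak_grad_on_def)
  have "(\<integral>\<^sup>+x. ennreal \<bar>H (x + e) - H x - (\<Sum>j\<in>UNIV. e $ j * A j x)\<bar> * indicator K x \<partial>lborel)
     \<le> (\<integral>\<^sup>+x. (\<integral>\<^sup>+s. (\<Sum>j\<in>UNIV. ennreal (\<bar>e $ j\<bar> * \<bar>G j (x + s *\<^sub>R e) - A j x\<bar>) * indicator {0..1::real} s) \<partial>lborel) * indicator K x \<partial>lborel)"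
  proof (rule nn_integral_mono_AE)
    have "AE x in lborel. x \<in> K \<longrightarrow> (\<forall>a. ennreal \<bar>H (x + e) - H x - (\<Sum>j\<in>UNIV. e $ j * a j)\<bar>
       \<le> (\<integral>\<^sup>+s. (\<Sum>j\<in>UNIV. ennreal (\<bar>e $ j\<bar> * \<bar>G j (x + s *\<^sub>R e) - a j\<bar>) * indicator {0..1} s) \<partial>lborel))"
      by (rule weak_grad_increment_bound[OF wg K \<open>\<delta> > 0\<close>]) (rule V)
    thus "AE x in lborel. ennreal \<bar>H (x + e) - H x - (\<Sum>j\<in>UNIV. e $ j * A j x)\<bar> * indicator K x
       \<le> (\<integral>\<^sup>+s. (\<Sum>j\<in>UNIV. ennreal (\<bar>e $ j\<bar> * \<bar>G j (x + s *\<^sub>R e) - A j x\<bar>) * indicator {0..1::real} s) \<partial>lborel) * indicator K x"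
      by eventually_elim (auto simp: indicator_def)
  qed
  also have "\<dots> = (\<integral>\<^sup>+x. (\<integral>\<^sup>+s. (\<Sum>j\<in>UNIV. ennreal (\<bar>e $ j\<bar> * \<bar>G j (x + s *\<^sub>R e) - A j x\<bar>) * indicator {0..1::real} s) * indicator K x \<partial>lborel) \<partial>lborel)"
    by (simp add: nn_integral_multc)
  also have "\<dots> = (\<integral>\<^sup>+s. (\<integral>\<^sup>+x. (\<Sum>j\<in>UNIV. ennreal (\<bar>e $ j\<bar> * \<bar>G j (x + s *\<^sub>R e) - A j x\<bar>) * indicator {0..1::real} s) * indicator K x \<partial>lborel) \<partial>lborel)"
    by (rule lborel_pair.Fubini') measurable
  also have "\<dots> \<le> (\<integral>\<^sup>+s. (\<Sum>j\<in>UNIV. ennreal \<bar>e $ j\<bar> * M j) * indicator {0..1::real} s \<partial>lborel)"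
  proof (rule nn_integral_mono)
    fix s :: real
    show "(\<integral>\<^sup>+x. (\<Sum>j\<in>UNIV. ennreal (\<bar>e $ j\<bar> * \<bar>G j (x + s *\<^sub>R e) - A j x\<bar>) * indicator {0..1::real} s) * indicator K x \<partial>lborel)
       \<le> (\<Sum>j\<in>UNIV. ennreal \<bar>e $ j\<bar> * M j) * indicator {0..1::real} s"
    proof (cases "s \<in> {0..1}")
      case True
      have "(\<integral>\<^sup>+x. (\<Sum>j\<in>UNIV. ennreal (\<bar>e $ j\<bar> * \<bar>G j (x + s *\<^sub>R e) - A j x\<bar>) * indicator {0..1::real} s) * indicator K x \<partial>lborel)
        = (\<integral>\<^sup>+x. (\<Sum>j\<in>UNIV. ennreal \<bar>e $ j\<bar> * (ennreal \<bar>G j (x + s *\<^sub>R e) - A j x\<bar> * indicator K x)) \<partial>lborel)"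
        using True by (simp add: ennreal_mult' sum_distrib_right mult.assoc)
      also have "\<dots> = (\<Sum>j\<in>UNIV. ennreal \<bar>e $ j\<bar> * (\<integral>\<^sup>+x. ennreal \<bar>G j (x + s *\<^sub>R e) - A j x\<bar> * indicator K x \<partial>lborel))"
        by (simp add: nn_integral_sum nn_integral_cmult)
      also have "\<dots> \<le> (\<Sum>j\<in>UNIV. ennreal \<bar>e $ j\<bar> * M j)"
        using True by (intro sum_mono mult_left_mono M) auto
      finally show ?thesis using True by simp
    qed auto
  qed
  also have "\<dots> = (\<Sum>j\<in>UNIV. ennreal \<bar>e $ j\<bar> * M j)"
    by (simp add: nn_integral_cmult)
  also have "\<dots> \<le> (\<Sum>j\<in>UNIV. ennreal (norm e) * M j)"
    by (intro sum_mono mult_right_mono ennreal_leI component_le_norm_cart) auto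
  also have "\<dots> = ennreal (norm e) * (\<Sum>j\<in>UNIV. M j)"
    by (simp add: sum_distrib_left)
  finally show ?thesis .
qed

section \<open>Decay of the gradient on small balls and exclusion of jumps\<close>

lemma emeasure_ball_cart:
  fixes c :: "real^'n"
  assumes "r \<ge> 0"
  shows "emeasure lborel (ball c r) = ennreal (r ^ CARD('n) * unit_ball_vol TYPE('n))"
proof -
  have "measure lborel (ball c r) = r ^ CARD('n) * unit_ball_vol TYPE('n)"
    using content_ball[of r c] content_ball[of 1 "0::real^'n"] assms
    by (simp add: unit_ball_vol_def measure_completion)
  thus ?thesis
    using emeasure_lborel_ball_finite[of c r] by (simp add: emeasure_eq_ennreal_measure)
qed

lemma sets_borel_ball [measurable]: "ball c r \<in> sets borel"
  by simp

lemma unit_ball_vol_pos: "unit_ball_vol TYPE('n::finite) > 0"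
  using content_ball_pos[of 1 "0::real^'n"] by (simp add: unit_ball_vol_def measure_completion)

lemma integral_small_ball:
  fixes g :: "real^'n \<Rightarrow> real"
  assumes g: "integrable lborel g" and "\<epsilon> > 0"
  obtains r0 where "r0 > 0" "\<And>r. 0 < r \<Longrightarrow> r \<le> r0 \<Longrightarrow> (\<integral>x. \<bar>g x\<bar> * indicator (ball x0 r) x \<partial>lborel) < \<epsilon>"
proof -
  have "(\<lambda>k. \<integral>x. \<bar>g x\<bar> * indicator (ball x0 (1 / Suc k)) x \<partial>lborel) \<longlonglongrightarrow> (\<integral>x. 0 \<partial>(lborel :: (real^'n) measure))"
  proof (rule integral_dominated_convergence[where w = "\<lambda>x. \<bar>g x\<bar>"])
    have "AE x in lborel. x \<noteq> x0" by (rule AE_lborel_singleton)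
    thus "AE x in lborel. (\<lambda>k. \<bar>g x\<bar> * indicator (ball x0 (1 / Suc k)) x) \<longlonglongrightarrow> 0"
    proof eventually_elim
      case (elim x)
      have "(\<lambda>k. 1 / real (Suc k)) \<longlonglongrightarrow> 0" using LIMSEQ_inverse_real_of_nat by (simp add: inverse_eq_divide)
      hence "\<forall>\<^sub>F k in sequentially. 1 / real (Suc k) < dist x0 x"
        using elim by (intro order_tendstoD) auto
      hence "\<forall>\<^sub>F k in sequentially. \<bar>g x\<bar> * indicator (ball x0 (1 / Suc k)) x = 0"
        by eventually_elim auto
      thus ?case by (rule tendsto_eventually)
    qed
  qed (use g in \<open>auto simp: indicator_def\<close>)
  hence "\<forall>\<^sub>F k in sequentially. (\<integral>x. \<bar>g x\<bar> * indicator (ball x0 (1 / Suc k)) x \<partial>lborel) < \<epsilon>"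
    using \<open>\<epsilon> > 0\<close> by (intro order_tendstoD) auto
  then obtain k where k: "(\<integral>x. \<bar>g x\<bar> * indicator (ball x0 (1 / Suc k)) x \<partial>lborel) < \<epsilon>"
    by (auto simp: eventually_sequentially)
  have i: "integrable lborel (\<lambda>x. \<bar>g x\<bar> * indicator (ball x0 r) x)" for r
    by (rule integrable_mult_bounded[where B = 1]) (use g in \<open>auto simp: indicator_def\<close>)
  show thesis
  proof (rule that)
    show "1 / real (Suc k) > 0" by simp
    fix r assume "0 < r" "r \<le> 1 / real (Suc k)"
    have "(\<integral>x. \<bar>g x\<bar> * indicator (ball x0 r) x \<partial>lborel) \<le> (\<integral>x. \<bar>g x\<bar> * indicator (ball x0 (1 / Suc k)) x \<partial>lborel)"
      by (rule integral_mono[OF i i]) (use \<open>r \<le> _\<close> in \<open>auto simp: indicator_def\<close>)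
    with k show "(\<integral>x. \<bar>g x\<bar> * indicator (ball x0 r) x \<partial>lborel) < \<epsilon>" by simp
  qed
qed

text \<open>Plays the role of Hoelder's inequality: |G| \<le> t + |G|^n / t^(n-1) at the level t
  proportional to 1 / r, combined with the n-energy of small balls tending to 0. The radius 4 r is
  that of the ball swept out by shifts of length below 3 r starting in a ball of radius r.\<close>

lemma sum_integral_small_ball:
  fixes G :: "'n::finite \<Rightarrow> real^'n \<Rightarrow> real"
  assumes G: "\<And>j. integrable lborel (G j)" and Gn: "\<And>j. integrable lborel (\<lambda>x. \<bar>G j x\<bar> ^ CARD('n))" and "\<epsilon> > 0"
  obtains r0 where "r0 > 0"
    "\<And>r. 0 < r \<Longrightarrow> r \<le> r0 \<Longrightarrow> (\<Sum>j\<in>UNIV. \<integral>x. \<bar>G j x\<bar> * indicator (ball x0 (4 * r)) x \<partial>lborel) < \<epsilon> * r ^ (CARD('n) - 1)"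
proof -
  define N where "N = CARD('n)"
  define \<omega> where "\<omega> = unit_ball_vol TYPE('n)"
  have N: "N > 0" by (simp add: N_def)
  have \<omega>: "\<omega> > 0" unfolding \<omega>_def by (rule unit_ball_vol_pos)
  \<comment> \<open>With t = \<tau> / r the two terms of the splitting integrate to (\<tau> / r) (4
    r)^N \<omega> and less than (r / \<tau>)^(N-1) \<epsilon>'. The constants \<open>\<tau>\<close>
    and \<open>\<epsilon>'\<close> make each of these values \<epsilon> r^(N-1) / (2 N).\<close>
  define \<tau> where "\<tau> = \<epsilon> / (2 * real N * (\<omega> * 4 ^ N))"
  have \<tau>: "\<tau> > 0" using N \<omega> \<open>\<epsilon> > 0\<close> by (simp add: \<tau>_def)
  define \<epsilon>' where "\<epsilon>' = \<epsilon> / (2 * real N) * \<tau> ^ (N - 1)"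
  have \<epsilon>': "\<epsilon>' > 0" using N \<tau> \<open>\<epsilon> > 0\<close> by (simp add: \<epsilon>'_def)
  have "\<exists>s>0. \<forall>r. 0 < r \<longrightarrow> r \<le> s \<longrightarrow> (\<integral>x. \<bar>G j x\<bar> ^ N * indicator (ball x0 r) x \<partial>lborel) < \<epsilon>'" for j
  proof -
    obtain s where s: "s > 0" "\<And>r. 0 < r \<Longrightarrow> r \<le> s \<Longrightarrow>
       (\<integral>x. \<bar>\<bar>G j x\<bar> ^ N\<bar> * indicator (ball x0 r) x \<partial>lborel) < \<epsilon>'"
      using integral_small_ball[OF Gn \<epsilon>'] unfolding N_def by metis
    thus ?thesis by auto
  qed
  then obtain s where s: "\<And>j. s j > 0"
    "\<And>j r. 0 < r \<Longrightarrow> r \<le> s j \<Longrightarrow> (\<integral>x. \<bar>G j x\<bar> ^ N * indicator (ball x0 r) x \<partial>lborel) < \<epsilon>'"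
    by metis
  define r0 where "r0 = Min (range s) / 4"
  have r0: "r0 > 0" "\<And>j. 4 * r0 \<le> s j" using s(1) by (auto simp: r0_def)
  show thesis
  proof (rule that[OF r0(1)])
    fix r :: real assume r: "0 < r" "r \<le> r0"
    have "(\<integral>x. \<bar>G j x\<bar> * indicator (ball x0 (4 * r)) x \<partial>lborel) < \<epsilon> / real N * r ^ (N - 1)" for j
    proof -
      let ?B = "ball x0 (4 * r)"
      define t where "t = \<tau> / r"
      have t: "t > 0" using \<tau> r by (simp add: t_def)
      have iB: "integrable lborel (\<lambda>x. indicator ?B x :: real)"
        using emeasure_lborel_ball_finite by (intro integrable_real_indicator) auto
      have i1: "integrable lborel (\<lambda>x. \<bar>G j x\<bar> ^ N * indicator ?B x)"
        unfolding N_def by (rule integrable_mult_bounded[where B = 1, OF Gn]) (auto simp: indicator_def)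
      have i2: "integrable lborel (\<lambda>x. \<bar>G j x\<bar> * indicator ?B x)"
        by (rule integrable_mult_bounded[where B = 1]) (use G in \<open>auto simp: indicator_def\<close>)
      have "(\<integral>x. indicator ?B x \<partial>lborel) = measure lborel ?B" by simp
      also have "\<dots> = (4 * r) ^ N * \<omega>"
        using emeasure_ball_cart[of "4 * r" x0] r \<omega> by (simp add: measure_def N_def \<omega>_def)
      finally have vB: "(\<integral>x. indicator ?B x \<partial>lborel) = (4 * r) ^ N * \<omega>" .
      have pt: "\<bar>G j x\<bar> * indicator ?B x \<le> t * indicator ?B x + inverse (t ^ (N - 1)) * (\<bar>G j x\<bar> ^ N * indicator ?B x)" for x
      proof (cases "\<bar>G j x\<bar> \<le> t")
        case True
        have "inverse (t ^ (N - 1)) * (\<bar>G j x\<bar> ^ N * indicator ?B x) \<ge> 0" using t by simp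
        moreover have "\<bar>G j x\<bar> * indicator ?B x \<le> t * indicator ?B x"
          using True by (intro mult_right_mono) auto
        ultimately show ?thesis by linarith
      next
        case False
        hence "t ^ (N - 1) \<le> \<bar>G j x\<bar> ^ (N - 1)" using t by (intro power_mono) auto
        hence "\<bar>G j x\<bar> * t ^ (N - 1) \<le> \<bar>G j x\<bar> * \<bar>G j x\<bar> ^ (N - 1)" by (intro mult_left_mono) auto
        also have "\<dots> = \<bar>G j x\<bar> ^ N" using N by (simp flip: power_Suc)
        finally have "\<bar>G j x\<bar> \<le> inverse (t ^ (N - 1)) * \<bar>G j x\<bar> ^ N"
          using t by (simp add: field_simps)
        thus ?thesis using t by (auto simp: indicator_def)
      qed
      have "(\<integral>x. \<bar>G j x\<bar> * indicator ?B x \<partial>lborel)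
        \<le> (\<integral>x. t * indicator ?B x + inverse (t ^ (N - 1)) * (\<bar>G j x\<bar> ^ N * indicator ?B x) \<partial>lborel)"
        by (rule integral_mono) (use i1 i2 iB pt in auto)
      also have "\<dots> = t * ((4 * r) ^ N * \<omega>) + inverse (t ^ (N - 1)) * (\<integral>x. \<bar>G j x\<bar> ^ N * indicator ?B x \<partial>lborel)"
        using i1 iB vB by simp
      also have "\<dots> < t * ((4 * r) ^ N * \<omega>) + inverse (t ^ (N - 1)) * \<epsilon>'"
        using s(2)[of "4 * r" j] r r0(2)[of j] t by (intro add_strict_left_mono mult_strict_left_mono) auto
      also have "t * ((4 * r) ^ N * \<omega>) = \<epsilon> / (2 * real N) * r ^ (N - 1)"
      proof -
        have "(4 * r) ^ N = 4 ^ N * (r * r ^ (N - 1))"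
          using N by (simp add: power_mult_distrib flip: power_Suc)
        thus ?thesis using r \<omega> N by (simp add: t_def \<tau>_def field_simps)
      qed
      also have "inverse (t ^ (N - 1)) * \<epsilon>' = \<epsilon> / (2 * real N) * r ^ (N - 1)"
        using r \<tau> N by (simp add: t_def \<epsilon>'_def power_divide field_simps)
      finally show ?thesis using N by (simp add: field_simps)
    qed
    hence "(\<Sum>j\<in>UNIV. \<integral>x. \<bar>G j x\<bar> * indicator (ball x0 (4 * r)) x \<partial>lborel)
       < (\<Sum>j\<in>(UNIV::'n set). \<epsilon> / real N * r ^ (N - 1))"
      by (intro sum_strict_mono) auto
    thus "(\<Sum>j\<in>UNIV. \<integral>x. \<bar>G j x\<bar> * indicator (ball x0 (4 * r)) x \<partial>lborel) < \<epsilon> * r ^ (CARD('n) - 1)"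
      by (simp add: N_def)
  qed
qed

text \<open>Sets of density bounded below on which \<open>H\<close> differs by at least \<open>\<eta>\<close> would, by a Poincare
  inequality, force the \<open>n\<close>-energy on all small balls to stay bounded away from \<open>0\<close>.\<close>

lemma weak_grad_no_jump:
  fixes H :: "real^'n \<Rightarrow> real"
  assumes wg: "weak_grad_on (ball x0 R) H G" and "R > 0"
    and Gn: "\<And>j. integrable lborel (\<lambda>x. \<bar>G j x\<bar> ^ CARD('n))" and "\<kappa> > 0" "\<eta> > 0"
  obtains r0 where "r0 > 0"
    "\<And>r S S'. 0 < r \<Longrightarrow> r \<le> r0 \<Longrightarrow> S \<in> sets borel \<Longrightarrow> S' \<in> sets borel \<Longrightarrow>
       S \<subseteq> ball x0 r \<Longrightarrow> S' \<subseteq> ball x0 (2 * r) \<Longrightarrow>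
       ennreal (\<kappa> * r ^ CARD('n)) \<le> emeasure lborel S \<Longrightarrow>
       ennreal (\<kappa> * r ^ CARD('n)) \<le> emeasure lborel S' \<Longrightarrow>
       \<exists>x\<in>S. \<exists>y\<in>S'. \<bar>H x - H y\<bar> < \<eta>"
proof -
  define N where "N = CARD('n)"
  define \<omega> where "\<omega> = unit_ball_vol TYPE('n)"
  have N: "N > 0" by (simp add: N_def)
  have \<omega>: "\<omega> > 0" unfolding \<omega>_def by (rule unit_ball_vol_pos)
  have G: "\<And>j. integrable lborel (G j)" and H: "integrable lborel H"
    using wg by (auto simp: weak_grad_on_def)
  have [measurable]: "G j \<in> borel_measurable borel" for j using G[of j] by auto
  have [measurable]: "H \<in> borel_measurable borel" using H by auto
  \<comment> \<open>Chosen so that the upper bound 3 r (\<epsilon> r^(N-1)) (3 r)^N \<omega> below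
    equals the lower bound \<eta> (\<kappa> r^N)^2.\<close>
  define \<epsilon> where "\<epsilon> = \<eta> * \<kappa>\<^sup>2 / (3 ^ N * \<omega> * 3)"
  have \<epsilon>: "\<epsilon> > 0" using \<omega> \<open>\<eta> > 0\<close> \<open>\<kappa> > 0\<close> by (simp add: \<epsilon>_def)
  obtain r1 where r1: "r1 > 0" "\<And>r. 0 < r \<Longrightarrow> r \<le> r1 \<Longrightarrow>
      (\<Sum>j\<in>UNIV. \<integral>x. \<bar>G j x\<bar> * indicator (ball x0 (4 * r)) x \<partial>lborel) < \<epsilon> * r ^ (N - 1)"
    by (rule sum_integral_small_ball[where G = G and ?x0.0 = x0, OF G Gn \<epsilon>]) (auto simp: N_def)
  \<comment> \<open>Segments starting in \<open>ball x0 r\<close> stay in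
    \<open>ball x0 (4 * r)\<close>, and bumps on them need a further margin r.\<close>
  define r0 where "r0 = min r1 (R / 5)"
  show thesis
  proof (rule that[of r0])
    show "r0 > 0" using r1 \<open>R > 0\<close> by (simp add: r0_def)
    fix r S S' assume r: "0 < r" "r \<le> r0" and [measurable]: "S \<in> sets borel" "S' \<in> sets borel"
      and S: "S \<subseteq> ball x0 r" "S' \<subseteq> ball x0 (2 * r)"
      and vS: "ennreal (\<kappa> * r ^ CARD('n)) \<le> emeasure lborel S" "ennreal (\<kappa> * r ^ CARD('n)) \<le> emeasure lborel S'"
    show "\<exists>x\<in>S. \<exists>y\<in>S'. \<bar>H x - H y\<bar> < \<eta>"
    proof (rule ccontr)
      assume "\<not> ?thesis"
      hence jump: "\<eta> \<le> \<bar>H y - H x\<bar>" if "x \<in> S" "y \<in> S'" for x y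
        using that by (force simp: abs_minus_commute)
      define M where "M = (\<lambda>j. \<integral>x. \<bar>G j x\<bar> * indicator (ball x0 (4 * r)) x \<partial>lborel)"
      have M0: "M j \<ge> 0" for j by (simp add: M_def)
      have Mnn: "(\<integral>\<^sup>+x. ennreal \<bar>G j x\<bar> * indicator (ball x0 (4 * r)) x \<partial>lborel) = ennreal (M j)" for j
      proof -
        have "integrable lborel (\<lambda>x. \<bar>G j x\<bar> * indicator (ball x0 (4 * r)) x)"
          by (rule integrable_mult_bounded[where B = 1]) (use G in \<open>auto simp: indicator_def\<close>)
        hence "(\<integral>\<^sup>+x. ennreal (\<bar>G j x\<bar> * indicator (ball x0 (4 * r)) x) \<partial>lborel) = ennreal (M j)"
          unfolding M_def by (rule nn_integral_eq_integral) auto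
        thus ?thesis by (simp add: ennreal_mult' ennreal_indicator)
      qed
      \<comment> \<open>With comparison field 0, an increment by e averaged over
        \<open>ball x0 r\<close> costs |e| times the L1 norm of the gradient on the ball of radius 4
        r.\<close>
      have step: "(\<integral>\<^sup>+x. ennreal \<bar>H (x + e) - H x\<bar> * indicator (ball x0 r) x \<partial>lborel)
          \<le> ennreal (3 * r * (\<Sum>j\<in>UNIV. M j))" if e: "norm e < 3 * r" for e
      proof -
        have "(\<integral>\<^sup>+x. ennreal \<bar>H (x + e) - H x - (\<Sum>j\<in>UNIV. e $ j * 0)\<bar> * indicator (ball x0 r) x \<partial>lborel)
          \<le> ennreal (norm e) * (\<Sum>j\<in>UNIV. ennreal (M j))"
        proof (rule weak_grad_increment_L1[OF wg, where \<delta> = r])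
          fix x :: "real^'n" and s :: real assume x: "x \<in> ball x0 r" and s: "0 \<le> s" "s \<le> 1"
          have "norm (s *\<^sub>R e) \<le> norm e" using s by (simp add: mult_left_le_one_le)
          hence "norm (s *\<^sub>R e) < 3 * r" using e by simp
          hence d: "dist x0 (x + s *\<^sub>R e) < 4 * r"
            using x norm_triangle_ineq4[of "x0 - x" "s *\<^sub>R e"] by (simp add: dist_norm algebra_simps)
          have "5 * r \<le> R" using r by (simp add: r0_def)
          show "ball (x + s *\<^sub>R e) r \<subseteq> ball x0 R"
          proof
            fix z assume "z \<in> ball (x + s *\<^sub>R e) r"
            thus "z \<in> ball x0 R"
              using d \<open>5 * r \<le> R\<close> dist_triangle[of x0 z "x + s *\<^sub>R e"] by simp
          qed
        next
          fix j :: 'n and s :: real assume s: "0 \<le> s" "s \<le> 1"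
          have "norm (s *\<^sub>R e) \<le> norm e" using s by (simp add: mult_left_le_one_le)
          hence ns: "norm (s *\<^sub>R e) < 3 * r" using e by simp
          have "(\<integral>\<^sup>+x. ennreal \<bar>G j (x + s *\<^sub>R e) - 0\<bar> * indicator (ball x0 r) x \<partial>lborel)
            \<le> (\<integral>\<^sup>+x. ennreal \<bar>G j (s *\<^sub>R e + x)\<bar> * indicator (ball x0 (4 * r)) (s *\<^sub>R e + x) \<partial>lborel)"
          proof (rule nn_integral_mono)
            fix x
            have "s *\<^sub>R e + x \<in> ball x0 (4 * r)" if "x \<in> ball x0 r"
              using that ns norm_triangle_ineq4[of "x0 - x" "s *\<^sub>R e"] by (simp add: dist_norm algebra_simps)
            thus "ennreal \<bar>G j (x + s *\<^sub>R e) - 0\<bar> * indicator (ball x0 r) x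
              \<le> ennreal \<bar>G j (s *\<^sub>R e + x)\<bar> * indicator (ball x0 (4 * r)) (s *\<^sub>R e + x)"
              by (auto simp: indicator_def add.commute)
          qed
          also have "\<dots> = ennreal (M j)"
          proof -
            have "(\<lambda>x. ennreal \<bar>G j x\<bar> * indicator (ball x0 (4 * r)) x) \<in> borel_measurable borel"
              by measurable
            from lborel_translate_nn[OF this, of "s *\<^sub>R e"] show ?thesis by (simp only: Mnn)
          qed
          finally show "(\<integral>\<^sup>+x. ennreal \<bar>G j (x + s *\<^sub>R e) - 0\<bar> * indicator (ball x0 r) x \<partial>lborel) \<le> ennreal (M j)" .
        qed (use r in auto)
        also have "\<dots> = ennreal (norm e * (\<Sum>j\<in>UNIV. M j))"
          by (simp add: M0 sum_nonneg ennreal_mult')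
        also have "\<dots> \<le> ennreal (3 * r * (\<Sum>j\<in>UNIV. M j))"
          using e by (intro ennreal_leI mult_right_mono sum_nonneg M0) auto
        finally show ?thesis by simp
      qed
      \<comment> \<open>The product S x S' carries at least \<eta> (\<kappa> r^N)^2 of the double
        integral of |H y - H x|. Writing y = x + e gives |e| < 3 r, and exchanging the integrals
        lets \<open>step\<close> bound it from above.\<close>
      have "ennreal (\<eta> * (\<kappa> * r ^ N) * (\<kappa> * r ^ N)) = ennreal \<eta> * ennreal (\<kappa> * r ^ N) * ennreal (\<kappa> * r ^ N)"
        using \<open>\<eta> > 0\<close> \<open>\<kappa> > 0\<close> r by (simp add: ennreal_mult')
      also have "\<dots> \<le> ennreal \<eta> * emeasure lborel S' * emeasure lborel S"
        using vS unfolding N_def by (intro mult_mono order_refl) auto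
      also have "\<dots> = (\<integral>\<^sup>+x. (\<integral>\<^sup>+y. ennreal \<eta> * indicator S' y \<partial>lborel) * indicator S x \<partial>lborel)"
        by (simp add: nn_integral_cmult_indicator nn_integral_cmult)
      also have "\<dots> \<le> (\<integral>\<^sup>+x. (\<integral>\<^sup>+e. ennreal \<bar>H (x + e) - H x\<bar> * indicator (ball 0 (3 * r)) e * indicator (ball x0 r) x \<partial>lborel) \<partial>lborel)"
      proof (rule nn_integral_mono)
        fix x
        show "(\<integral>\<^sup>+y. ennreal \<eta> * indicator S' y \<partial>lborel) * indicator S x
          \<le> (\<integral>\<^sup>+e. ennreal \<bar>H (x + e) - H x\<bar> * indicator (ball 0 (3 * r)) e * indicator (ball x0 r) x \<partial>lborel)"
        proof (cases "x \<in> S")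
          case True
          hence xb: "x \<in> ball x0 r" using S by auto
          have "(\<integral>\<^sup>+y. ennreal \<eta> * indicator S' y \<partial>lborel) = (\<integral>\<^sup>+e. ennreal \<eta> * indicator S' (x + e) \<partial>lborel)"
            by (rule lborel_translate_nn[symmetric]) auto
          also have "\<dots> \<le> (\<integral>\<^sup>+e. ennreal \<bar>H (x + e) - H x\<bar> * indicator (ball 0 (3 * r)) e * indicator (ball x0 r) x \<partial>lborel)"
          proof (rule nn_integral_mono)
            fix e
            have "e \<in> ball 0 (3 * r)" if "x + e \<in> S'"
            proof -
              have "dist x0 (x + e) < 2 * r" "dist x0 x < r" using that S xb by auto
              thus ?thesis using norm_triangle_ineq4[of "x0 - x" "x0 - (x + e)"] by (simp add: dist_norm)
            qed
            thus "ennreal \<eta> * indicator S' (x + e)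
               \<le> ennreal \<bar>H (x + e) - H x\<bar> * indicator (ball 0 (3 * r)) e * indicator (ball x0 r) x"
              using jump[OF True, of "x + e"] xb by (cases "x + e \<in> S'") (auto intro: ennreal_leI)
          qed
          finally show ?thesis using True by simp
        qed auto
      qed
      also have "\<dots> = (\<integral>\<^sup>+e. (\<integral>\<^sup>+x. ennreal \<bar>H (x + e) - H x\<bar> * indicator (ball 0 (3 * r)) e * indicator (ball x0 r) x \<partial>lborel) \<partial>lborel)"
        by (rule lborel_pair.Fubini') measurable
      also have "\<dots> \<le> (\<integral>\<^sup>+e. ennreal (3 * r * (\<Sum>j\<in>UNIV. M j)) * indicator (ball (0::real^'n) (3 * r)) e \<partial>lborel)"
        using step by (intro nn_integral_mono) (auto simp: indicator_def)
      also have "\<dots> = ennreal (3 * r * (\<Sum>j\<in>UNIV. M j)) * ennreal ((3 * r) ^ N * \<omega>)"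
        using emeasure_ball_cart[of "3 * r" "0::real^'n"] r by (simp add: nn_integral_cmult_indicator N_def \<omega>_def)
      also have "\<dots> = ennreal (3 * r * (\<Sum>j\<in>UNIV. M j) * ((3 * r) ^ N * \<omega>))"
        using r M0 \<omega> by (subst ennreal_mult) (auto intro!: mult_nonneg_nonneg sum_nonneg)
      finally have "\<eta> * (\<kappa> * r ^ N) * (\<kappa> * r ^ N) \<le> 3 * r * (\<Sum>j\<in>UNIV. M j) * ((3 * r) ^ N * \<omega>)"
        using r M0 \<omega> by (subst (asm) ennreal_le_iff) (auto intro!: mult_nonneg_nonneg sum_nonneg)
      also have "\<dots> < 3 * r * (\<epsilon> * r ^ (N - 1)) * ((3 * r) ^ N * \<omega>)"
        using r1(2)[of r] r \<omega> unfolding M_def r0_def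
        by (intro mult_strict_right_mono mult_strict_left_mono) auto
      also have "\<dots> = \<epsilon> * (3 ^ N * \<omega> * 3) * ((r * r ^ (N - 1)) * r ^ N)"
        by (simp add: power_mult_distrib)
      also have "\<dots> = \<eta> * \<kappa>\<^sup>2 * ((r * r ^ (N - 1)) * r ^ N)"
        using \<omega> by (simp add: \<epsilon>_def)
      also have "r * r ^ (N - 1) = r ^ N" using N by (simp flip: power_Suc)
      finally show False by (simp add: power2_eq_square algebra_simps)
    qed
  qed
qed

section \<open>Borel representatives\<close>

text \<open>Completed Lebesgue measure is awkward for product measures and translations, so the
  function is cut off by the ball and changed on a null set to become Borel and integrable over the
  whole space.\<close>

lemma Lp_loc_borel_rep:
  fixes h :: "real^'n \<Rightarrow> real"
  assumes L: "Lp_loc (real CARD('n)) \<Omega> h" and "open \<Omega>" and sub: "cball x0 R \<subseteq> \<Omega>"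
  obtains H where "integrable lborel H" "integrable lborel (\<lambda>x. \<bar>H x\<bar> ^ CARD('n))"
    "AE x in lebesgue. indicator (cball x0 R) x * h x = H x"
proof -
  let ?K = "cball x0 R"
  define N where "N = CARD('n)"
  have N: "N > 0" by (simp add: N_def)
  have \<Omega>: "\<Omega> \<in> sets lebesgue" using \<open>open \<Omega>\<close> by auto
  have K: "?K \<in> sets lebesgue" by auto
  have "(\<lambda>x. indicator \<Omega> x *\<^sub>R h x) \<in> borel_measurable lebesgue"
    using L \<Omega> by (subst (asm) Lp_loc_def) (auto simp: borel_measurable_restrict_space_iff)
  hence "(\<lambda>x. indicator ?K x * (indicator \<Omega> x *\<^sub>R h x)) \<in> borel_measurable lebesgue"
    using borel_measurable_indicator[OF K] by (intro borel_measurable_times)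
  also have "(\<lambda>x. indicator ?K x * (indicator \<Omega> x *\<^sub>R h x)) = (\<lambda>x. indicator ?K x * h x)"
    using sub by (auto simp: fun_eq_iff indicator_def)
  finally have hm: "(\<lambda>x. indicator ?K x * h x) \<in> borel_measurable lebesgue" .
  obtain H' where H': "H' \<in> borel_measurable lborel" "AE x in lborel. indicator ?K x * h x = H' x"
    using completion_ex_borel_measurable_real[OF hm] by blast
  have [measurable]: "H' \<in> borel_measurable borel" "?K \<in> sets borel" using H' by auto
  define H where "H = (\<lambda>x. indicator ?K x * H' x)"
  have Hm: "H \<in> borel_measurable lborel" by (simp add: H_def)
  have "AE x in lborel. indicator ?K x * h x = H x"
    using H'(2) by eventually_elim (auto simp: H_def indicator_def)
  hence ae: "AE x in lebesgue. indicator ?K x * h x = H x" by (rule AE_completion)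
  have "set_integrable lebesgue ?K (\<lambda>x. \<bar>h x\<bar> powr real N)"
    using L sub by (simp add: Lp_loc_def N_def)
  hence i: "integrable lebesgue (\<lambda>x. indicator ?K x *\<^sub>R (\<bar>h x\<bar> powr real N))"
    by (simp add: set_integrable_def)
  have ae_N: "AE x in lebesgue. indicator ?K x *\<^sub>R (\<bar>h x\<bar> powr real N) = \<bar>H x\<bar> ^ N"
    using ae
  proof eventually_elim
    case (elim x)
    show ?case
    proof (cases "x \<in> ?K")
      case True
      hence "h x = H x" using elim by simp
      \<comment> \<open>Where H vanishes the two powers agree because N is positive.\<close>
      moreover have "\<bar>H x\<bar> powr real N = \<bar>H x\<bar> ^ N"
        using N by (cases "H x = 0") (simp_all add: powr_realpow)
      ultimately show ?thesis using True by simp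
    next
      case False
      thus ?thesis using N by (simp add: H_def)
    qed
  qed
  have Nm: "(\<lambda>x. \<bar>H x\<bar> ^ N) \<in> borel_measurable lborel"
    using Hm by measurable
  have "integrable lebesgue (\<lambda>x. \<bar>H x\<bar> ^ N)"
    using ae_N by (intro integrable_cong_AE_imp[OF i measurable_completion[OF Nm]]) (auto elim: eventually_mono)
  hence HN: "integrable lborel (\<lambda>x. \<bar>H x\<bar> ^ N)"
    by (simp only: integrable_completion[OF Nm])
  have "integrable lborel (\<lambda>x. indicator ?K x :: real)"
    using emeasure_lborel_cball_finite by (intro integrable_real_indicator) auto
  hence "integrable lborel (\<lambda>x. indicator ?K x + \<bar>H x\<bar> ^ N)" using HN by simp
  hence H: "integrable lborel H"
  proof (rule Bochner_Integration.integrable_bound[OF _ Hm])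
    \<comment> \<open>The ball has finite measure, so this pointwise bound derives integrability
      from n-integrability.\<close>
    have "\<bar>H x\<bar> \<le> indicator ?K x + \<bar>H x\<bar> ^ N" for x
    proof (cases "x \<in> ?K")
      case True
      show ?thesis
      proof (cases "\<bar>H x\<bar> \<le> 1")
        case False
        hence "\<bar>H x\<bar> ^ 1 \<le> \<bar>H x\<bar> ^ N" using N by (intro power_increasing) auto
        thus ?thesis using True by simp
      qed (use True in \<open>simp add: add_increasing2\<close>)
    qed (simp add: H_def)
    thus "AE x in lborel. norm (H x) \<le> norm (indicator ?K x + \<bar>H x\<bar> ^ N)"
      by auto
  qed
  show thesis using that[OF H] HN ae unfolding N_def by blast
qed

lemma integral_weak_lebesgue_lborel:
  fixes h H d :: "real^'n \<Rightarrow> real"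
  assumes h: "h \<in> borel_measurable (lebesgue_on \<Omega>)" and "open \<Omega>"
    and H: "H \<in> borel_measurable lborel" and d: "d \<in> borel_measurable borel"
    and ae: "AE x in lebesgue. indicator (cball x0 R) x * h x = H x" and sub: "cball x0 R \<subseteq> \<Omega>"
    and d0: "\<And>x. x \<notin> cball x0 R \<Longrightarrow> d x = 0"
  shows "(LINT x:\<Omega>|lebesgue. h x * d x) = (\<integral>x. H x * d x \<partial>lborel)"
proof -
  have \<Omega>: "\<Omega> \<in> sets lebesgue" using \<open>open \<Omega>\<close> by auto
  have "(\<lambda>x. indicator \<Omega> x *\<^sub>R h x) \<in> borel_measurable lebesgue"
    using h \<Omega> by (auto simp: borel_measurable_restrict_space_iff)
  moreover have dm: "d \<in> borel_measurable lebesgue" using d by (auto intro: measurable_completion)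
  ultimately have m: "(\<lambda>x. (indicator \<Omega> x *\<^sub>R h x) * d x) \<in> borel_measurable lebesgue" by measurable
  have "(LINT x:\<Omega>|lebesgue. h x * d x) = (\<integral>x. (indicator \<Omega> x *\<^sub>R h x) * d x \<partial>lebesgue)"
    by (simp add: set_lebesgue_integral_def mult.assoc)
  also have "\<dots> = (\<integral>x. H x * d x \<partial>lebesgue)"
  proof (rule integral_cong_AE[OF m])
    show "(\<lambda>x. H x * d x) \<in> borel_measurable lebesgue"
      using H d by (auto intro!: measurable_completion)
    show "AE x in lebesgue. indicator \<Omega> x *\<^sub>R h x * d x = H x * d x"
      using ae
    proof eventually_elim
      case (elim x)
      thus ?case using d0[of x] sub by (cases "x \<in> cball x0 R") auto
    qed
  qed
  also have "\<dots> = (\<integral>x. H x * d x \<partial>lborel)"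
    using H d by (intro integral_completion) auto
  finally show ?thesis .
qed

lemma weak_partial_local_rep:
  fixes h :: "real^'n \<Rightarrow> real" and g :: "'n \<Rightarrow> real^'n \<Rightarrow> real"
  assumes h: "Lp_loc (real CARD('n)) \<Omega> h" and g: "\<And>j. Lp_loc (real CARD('n)) \<Omega> (g j)"
    and w: "\<And>j. weak_partial \<Omega> h j (g j)" and "open \<Omega>" and sub: "cball x0 R \<subseteq> \<Omega>"
  obtains H G where "weak_grad_on (ball x0 R) H G" "\<And>j. integrable lborel (\<lambda>x. \<bar>G j x\<bar> ^ CARD('n))"
    "AE x in lebesgue. x \<in> ball x0 R \<longrightarrow> h x = H x"
    "\<And>j. AE x in lebesgue. x \<in> ball x0 R \<longrightarrow> g j x = G j x"
proof -
  obtain H where H: "integrable lborel H" "AE x in lebesgue. indicator (cball x0 R) x * h x = H x"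
    by (rule Lp_loc_borel_rep[OF h \<open>open \<Omega>\<close> sub]) blast
  have "\<forall>j. \<exists>G. integrable lborel G \<and> integrable lborel (\<lambda>x. \<bar>G x\<bar> ^ CARD('n)) \<and>
     (AE x in lebesgue. indicator (cball x0 R) x * g j x = G x)"
  proof
    fix j
    show "\<exists>G. integrable lborel G \<and> integrable lborel (\<lambda>x. \<bar>G x\<bar> ^ CARD('n)) \<and>
       (AE x in lebesgue. indicator (cball x0 R) x * g j x = G x)"
      by (rule Lp_loc_borel_rep[OF g[of j] \<open>open \<Omega>\<close> sub]) blast
  qed
  from choice[OF this] obtain G where "\<forall>j. integrable lborel (G j) \<and>
     integrable lborel (\<lambda>x. \<bar>G j x\<bar> ^ CARD('n)) \<and>
     (AE x in lebesgue. indicator (cball x0 R) x * g j x = G j x)" ..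
  hence G: "integrable lborel (G j)" "integrable lborel (\<lambda>x. \<bar>G j x\<bar> ^ CARD('n))"
     "AE x in lebesgue. indicator (cball x0 R) x * g j x = G j x" for j
    by blast+
  show thesis
  proof (rule that)
    show "weak_grad_on (ball x0 R) H G"
      unfolding weak_grad_on_def
    proof (intro conjI allI impI)
      fix c :: "real^'n" and \<rho> :: real and j assume \<rho>: "0 < \<rho>" and c: "cball c \<rho> \<subseteq> ball x0 R"
      have c': "cball c \<rho> \<subseteq> cball x0 R" using c ball_subset_cball by blast
      hence tf: "test_fun \<Omega> (\<lambda>y. bump \<rho> (y - c))" using \<rho> sub by (intro test_fun_bump) auto
      have out: "norm (x - c) > \<rho>" if "x \<notin> cball x0 R" for x
      proof -
        have "x \<notin> cball c \<rho>" using that c' by blast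
        thus ?thesis by (simp add: dist_norm norm_minus_commute)
      qed
      have d0: "bump_grad \<rho> (x - c) (axis j 1) = 0" "bump \<rho> (x - c) = 0" if "x \<notin> cball x0 R" for x
        using bump_grad_eq_0[OF \<rho> out[OF that]] bump_eq_0[OF less_imp_le[OF out[OF that]] \<rho>] by auto
      have meas: "h \<in> borel_measurable (lebesgue_on \<Omega>)" "g j \<in> borel_measurable (lebesgue_on \<Omega>)"
        using h g by (simp_all add: Lp_loc_def)
      have Hm: "H \<in> borel_measurable lborel" "G j \<in> borel_measurable lborel" using H(1) G(1)[of j] by auto
      have dm: "(\<lambda>x. bump_grad \<rho> (x - c) (axis j 1)) \<in> borel_measurable borel"
           "(\<lambda>x. bump \<rho> (x - c)) \<in> borel_measurable borel"
        by (rule measurable_compose[OF _ borel_measurable_bump_grad], simp) measurable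
      have "(LINT x:\<Omega>|lebesgue. h x * iter_pd [j] (\<lambda>y. bump \<rho> (y - c)) x)
         = - (LINT x:\<Omega>|lebesgue. g j x * bump \<rho> (x - c))"
        using w[of j] tf unfolding weak_partial_def by blast
      moreover have "(LINT x:\<Omega>|lebesgue. h x * bump_grad \<rho> (x - c) (axis j 1))
          = (\<integral>y. H y * bump_grad \<rho> (y - c) (axis j 1) \<partial>lborel)"
        by (rule integral_weak_lebesgue_lborel[OF meas(1) \<open>open \<Omega>\<close> Hm(1) dm(1) H(2) sub d0(1)])
      moreover have "(LINT x:\<Omega>|lebesgue. g j x * bump \<rho> (x - c)) = (\<integral>y. G j y * bump \<rho> (y - c) \<partial>lborel)"
        by (rule integral_weak_lebesgue_lborel[OF meas(2) \<open>open \<Omega>\<close> Hm(2) dm(2) G(3)[of j] sub d0(2)])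
      ultimately show "(\<integral>y. H y * bump_grad \<rho> (y - c) (axis j 1) \<partial>lborel) = - (\<integral>y. G j y * bump \<rho> (y - c) \<partial>lborel)"
        by (simp only: bump_translate_pd)
    qed (use H(1) G(1) in auto)
    show "AE x in lebesgue. x \<in> ball x0 R \<longrightarrow> h x = H x"
      using H(2) by eventually_elim (auto simp: indicator_def split: if_splits)
    show "AE x in lebesgue. x \<in> ball x0 R \<longrightarrow> g j x = G j x" for j
      using G(3)[of j] by eventually_elim (auto simp: indicator_def split: if_splits)
  qed (rule G(2))
qed

section \<open>Indicators of sets with interior cones\<close>

text \<open>The uniform interior cone condition under which indicators are quasi-nearly subharmonic with
  a constant depending only on the dimension.\<close>

definition fat_cone_set :: "(real^'n) set \<Rightarrow> bool" where
  "fat_cone_set E \<longleftrightarrow> closed E \<and>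
     (\<exists>v. norm v = 1 \<and> (\<forall>a\<in>E. \<forall>r>0. ball (a + (r / 2) *\<^sub>R v) (r / 4) \<subseteq> E))"

text \<open>The ball of radius r / 4 about a + (r / 2) v lies in E and in \<open>ball a r\<close>,
  and fills the fraction 4^(-n) of the latter. The constant is thus the same for all E and for every
  domain.\<close>

lemma qns_ineq_fat_cone:
  fixes E :: "(real^'n) set"
  assumes "fat_cone_set E"
  shows "qns_ineq (4 ^ CARD('n)) D (indicator E)"
  unfolding qns_ineq_def
proof (intro ballI allI impI)
  fix a and r :: real assume "a \<in> D" and r: "r > 0" and "ball a r \<subseteq> D"
  define N where "N = CARD('n)"
  define \<omega> where "\<omega> = unit_ball_vol TYPE('n)"
  have \<omega>: "\<omega> > 0" unfolding \<omega>_def by (rule unit_ball_vol_pos)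
  obtain v where v: "norm v = 1" "\<And>a r. a \<in> E \<Longrightarrow> r > 0 \<Longrightarrow> ball (a + (r / 2) *\<^sub>R v) (r / 4) \<subseteq> E"
    using assms by (auto simp: fat_cone_set_def)
  show "ennreal (indicator E a) \<le> ennreal (4 ^ CARD('n) / (r ^ CARD('n) * unit_ball_vol TYPE('n)))
          * (\<integral>\<^sup>+x\<in>ball a r. ennreal (indicator E x) \<partial>lebesgue)"
  proof (cases "a \<in> E")
    case True
    let ?B = "ball (a + (r / 2) *\<^sub>R v) (r / 4)"
    have sub: "?B \<subseteq> E" by (rule v(2)[OF True r])
    have sub': "?B \<subseteq> ball a r"
    proof
      fix z assume "z \<in> ?B"
      moreover have "dist a (a + (r / 2) *\<^sub>R v) = r / 2" using v(1) r by (simp add: dist_norm)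
      ultimately show "z \<in> ball a r"
        using dist_triangle[of a z "a + (r / 2) *\<^sub>R v"] r by simp
    qed
    have "ennreal ((r / 4) ^ N * \<omega>) = emeasure lebesgue ?B"
      using emeasure_ball_cart[of "r / 4" "a + (r / 2) *\<^sub>R v"] r by (simp add: N_def \<omega>_def)
    also have "\<dots> = (\<integral>\<^sup>+x. indicator ?B x \<partial>lebesgue)" by simp
    also have "\<dots> \<le> (\<integral>\<^sup>+x\<in>ball a r. ennreal (indicator E x) \<partial>lebesgue)"
      using sub sub' by (intro nn_integral_mono) (auto simp: indicator_def)
    finally have "ennreal (4 ^ N / (r ^ N * \<omega>)) * ennreal ((r / 4) ^ N * \<omega>)
       \<le> ennreal (4 ^ N / (r ^ N * \<omega>)) * (\<integral>\<^sup>+x\<in>ball a r. ennreal (indicator E x) \<partial>lebesgue)"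
      by (intro mult_left_mono) auto
    moreover have "ennreal (4 ^ N / (r ^ N * \<omega>)) * ennreal ((r / 4) ^ N * \<omega>) = 1"
      using r \<omega> by (subst ennreal_mult[symmetric]) (auto simp: power_divide)
    ultimately show ?thesis using True by (simp add: N_def \<omega>_def)
  qed simp
qed

lemma qns_fat_cone:
  fixes E :: "(real^'n) set"
  assumes E: "fat_cone_set E" and "open D"
  shows "qns D (indicator E)"
  unfolding qns_def
proof (intro conjI)
  have "indicator E \<in> borel_measurable lebesgue"
    using E by (auto simp: fat_cone_set_def intro!: borel_measurable_indicator)
  thus "indicator E \<in> borel_measurable (lebesgue_on D)"
    by (rule measurable_restrict_space1)
  show "locally_bounded_on D (indicator E)"
    unfolding locally_bounded_on_def
    by (intro ballI exI[of _ 1] conjI) (auto simp: indicator_def)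
  show "\<exists>C. qns_ineq C D (indicator E)" using qns_ineq_fat_cone[OF E] by blast
qed auto

section \<open>From the qns norm to lower density bounds for preimages\<close>

lemma qns_norm_le: "0 \<le> C \<Longrightarrow> qns_ineq C D u \<Longrightarrow> qns_norm D u \<le> C"
  unfolding qns_norm_def by (intro cInf_lower bdd_belowI[of _ 0]) auto

lemma qns_ineq_mono:
  fixes D :: "(real^'n) set"
  assumes "qns_ineq C D u" "C \<le> C'"
  shows "qns_ineq C' D u"
  unfolding qns_ineq_def
proof (intro ballI allI impI)
  fix a and r :: real assume *: "a \<in> D" "r > 0" "ball a r \<subseteq> D"
  have "C / (r ^ CARD('n) * unit_ball_vol TYPE('n)) \<le> C' / (r ^ CARD('n) * unit_ball_vol TYPE('n))"
    using assms(2) *(2) unit_ball_vol_pos[where 'n = 'n] by (intro divide_right_mono) auto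
  hence "ennreal (C / (r ^ CARD('n) * unit_ball_vol TYPE('n))) * (\<integral>\<^sup>+x\<in>ball a r. ennreal (u x) \<partial>lebesgue)
     \<le> ennreal (C' / (r ^ CARD('n) * unit_ball_vol TYPE('n))) * (\<integral>\<^sup>+x\<in>ball a r. ennreal (u x) \<partial>lebesgue)"
    by (intro mult_right_mono ennreal_leI) auto
  moreover have "ennreal (u a) \<le> ennreal (C / (r ^ CARD('n) * unit_ball_vol TYPE('n)))
     * (\<integral>\<^sup>+x\<in>ball a r. ennreal (u x) \<partial>lebesgue)"
    using assms(1) * unfolding qns_ineq_def by blast
  ultimately show "ennreal (u a) \<le> ennreal (C' / (r ^ CARD('n) * unit_ball_vol TYPE('n)))
     * (\<integral>\<^sup>+x\<in>ball a r. ennreal (u x) \<partial>lebesgue)" by (rule order_trans[rotated])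
qed

text \<open>The strict inequality provides an admissible constant below C without deciding whether
  the infimum is attained.\<close>

lemma qns_ineq_of_norm_less:
  assumes "qns D u" "qns_norm D u < C"
  shows "qns_ineq C D u"
proof -
  obtain C0 where "qns_ineq C0 D u" using assms by (auto simp: qns_def)
  hence "qns_ineq (max 0 C0) D u" by (rule qns_ineq_mono) simp
  hence "{C. 0 \<le> C \<and> qns_ineq C D u} \<noteq> {}" by (auto intro: exI[of _ "max 0 C0"])
  from cInf_lessD[OF this assms(2)[unfolded qns_norm_def]]
  show ?thesis by (auto intro: qns_ineq_mono)
qed

text \<open>The indicator of the preimage of E equals 1 at a, so its qns inequality there is a lower
  bound for a measure. One \<open>\<kappa>\<close> serves all E because the norms of their
  indicators share the bound 4^n. Measurability of the preimage is part of \<open>qns\<close> for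
  the composition.\<close>

lemma qns_morphism_density:
  fixes f :: "real^'n \<Rightarrow> real^'n"
  assumes f: "qns_morphism \<Omega> \<Omega>' f" and "open \<Omega>" "open \<Omega>'"
  obtains \<kappa> where "\<kappa> > 0"
    "\<And>E. fat_cone_set E \<Longrightarrow> {x\<in>\<Omega>. f x \<in> E} \<in> sets lebesgue"
    "\<And>E a r. fat_cone_set E \<Longrightarrow> a \<in> \<Omega> \<Longrightarrow> f a \<in> E \<Longrightarrow> r > 0 \<Longrightarrow> ball a r \<subseteq> \<Omega> \<Longrightarrow>
       ennreal (\<kappa> * r ^ CARD('n)) \<le> emeasure lebesgue {x\<in>ball a r. f x \<in> E}"
proof -
  obtain C where C: "\<And>u. qns \<Omega>' u \<Longrightarrow> qns \<Omega> (u \<circ> f) \<and> qns_norm \<Omega> (u \<circ> f) \<le> C * qns_norm \<Omega>' u"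
    using f by (auto simp: qns_morphism_def)
  define N where "N = CARD('n)"
  define \<omega> where "\<omega> = unit_ball_vol TYPE('n)"
  have \<omega>: "\<omega> > 0" unfolding \<omega>_def by (rule unit_ball_vol_pos)
  \<comment> \<open>The morphism constant carries no sign condition, hence the absolute value; the
    summand 1 gives the strict inequality that \<open>qns_ineq_of_norm_less\<close> asks
    for.\<close>
  define C1 where "C1 = \<bar>C\<bar> * 4 ^ N + 1"
  have C1: "C1 > 0" by (simp add: C1_def add_nonneg_pos)
  have \<Omega>: "\<Omega> \<in> sets lebesgue" using \<open>open \<Omega>\<close> by auto
  have q: "qns \<Omega> (indicator E \<circ> f)" if E: "fat_cone_set E" for E
    using C[OF qns_fat_cone[OF E \<open>open \<Omega>'\<close>]] by blast
  have meas: "{x\<in>\<Omega>. f x \<in> E} \<in> sets lebesgue" if E: "fat_cone_set E" for E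
  proof -
    have "(indicator E \<circ> f :: real^'n \<Rightarrow> real) \<in> borel_measurable (lebesgue_on \<Omega>)"
      using q[OF E] by (simp add: qns_def)
    from measurable_sets[OF this, of "{1::real}"]
    have "(indicator E \<circ> f) -` {1::real} \<inter> \<Omega> \<in> sets (lebesgue_on \<Omega>)" by simp
    also have "(indicator E \<circ> f) -` {1::real} \<inter> \<Omega> = {x\<in>\<Omega>. f x \<in> E}"
      by (auto simp: indicator_def split: if_splits)
    finally show ?thesis using \<Omega> by (simp add: sets_restrict_space_iff)
  qed
  show thesis
  proof (rule that[of "\<omega> / C1"])
    show "\<omega> / C1 > 0" using \<omega> C1 by simp
    show "{x\<in>\<Omega>. f x \<in> E} \<in> sets lebesgue" if "fat_cone_set E" for E by (rule meas[OF that])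
    fix E a r assume E: "fat_cone_set E" and a: "a \<in> \<Omega>" "f a \<in> E" and r: "r > (0::real)" "ball a r \<subseteq> \<Omega>"
    let ?u = "indicator E \<circ> f :: real^'n \<Rightarrow> real"
    let ?S = "{x\<in>ball a r. f x \<in> E}"
    have "?S = {x\<in>\<Omega>. f x \<in> E} \<inter> ball a r" using r by auto
    hence S: "?S \<in> sets lebesgue" using meas[OF E] by auto
    have "qns_norm \<Omega> ?u \<le> C * qns_norm \<Omega>' (indicator E)"
      using C[OF qns_fat_cone[OF E \<open>open \<Omega>'\<close>]] by blast
    also have "\<dots> \<le> \<bar>C\<bar> * 4 ^ N"
    proof -
      have "qns_norm \<Omega>' (indicator E) \<ge> 0"
        unfolding qns_norm_def using qns_ineq_fat_cone[OF E, of \<Omega>']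
        by (intro cInf_greatest) (auto intro: exI[of _ "4 ^ CARD('n)"])
      moreover have "qns_norm \<Omega>' (indicator E) \<le> 4 ^ N"
        unfolding N_def by (intro qns_norm_le qns_ineq_fat_cone E) auto
      ultimately show ?thesis by (intro mult_mono) auto
    qed
    also have "\<dots> < C1" by (simp add: C1_def)
    finally have "qns_ineq C1 \<Omega> ?u" by (intro qns_ineq_of_norm_less q E)
    hence "ennreal (?u a) \<le> ennreal (C1 / (r ^ N * \<omega>)) * (\<integral>\<^sup>+x\<in>ball a r. ennreal (?u x) \<partial>lebesgue)"
      using a r unfolding qns_ineq_def N_def \<omega>_def by blast
    also have "(\<integral>\<^sup>+x\<in>ball a r. ennreal (?u x) \<partial>lebesgue) = (\<integral>\<^sup>+x. indicator ?S x \<partial>lebesgue)"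
      by (intro nn_integral_cong) (auto simp: indicator_def)
    also have "\<dots> = emeasure lebesgue ?S" using S by simp
    finally have "1 \<le> ennreal (C1 / (r ^ N * \<omega>)) * emeasure lebesgue ?S" using a by simp
    hence "ennreal (\<omega> / C1 * r ^ N) * 1 \<le> ennreal (\<omega> / C1 * r ^ N) * (ennreal (C1 / (r ^ N * \<omega>)) * emeasure lebesgue ?S)"
      by (rule mult_left_mono) simp
    also have "\<dots> = ennreal (\<omega> / C1 * r ^ N * (C1 / (r ^ N * \<omega>))) * emeasure lebesgue ?S"
      using r \<omega> C1 by (subst ennreal_mult[of "\<omega> / C1 * r ^ N"]) (auto simp: mult.assoc)
    also have "\<omega> / C1 * r ^ N * (C1 / (r ^ N * \<omega>)) = 1" using r \<omega> C1 by simp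
    finally show "ennreal (\<omega> / C1 * r ^ CARD('n)) \<le> emeasure lebesgue ?S" by (simp add: N_def)
  qed
qed

section \<open>Continuity\<close>

text \<open>Moving by r / 2 along -\<sigma> times the i-th unit vector lowers \<sigma> y_i by r / 2,
  which outweighs a perturbation below r / 4. Both signs are kept because continuity needs sublevel
  and superlevel sets.\<close>

lemma fat_cone_set_halfspace:
  fixes i :: "'n::finite"
  assumes "\<sigma> = 1 \<or> \<sigma> = -1"
  shows "fat_cone_set {y::real^'n. \<sigma> * y $ i \<le> t}"
  unfolding fat_cone_set_def
proof (intro conjI exI[of _ "(- \<sigma>) *\<^sub>R axis i 1"] ballI allI impI subsetI)
  show "closed {y::real^'n. \<sigma> * y $ i \<le> t}"
    by (intro closed_Collect_le continuous_intros)
  show "norm ((- \<sigma>) *\<^sub>R axis i 1 :: real^'n) = 1" using assms by auto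
  fix a z :: "real^'n" and r :: real
  assume a: "a \<in> {y. \<sigma> * y $ i \<le> t}" and r: "r > 0"
    and z: "z \<in> ball (a + (r / 2) *\<^sub>R ((- \<sigma>) *\<^sub>R axis i 1)) (r / 4)"
  let ?w = "z - (a + (r / 2) *\<^sub>R ((- \<sigma>) *\<^sub>R axis i 1))"
  have "\<bar>?w $ i\<bar> \<le> norm ?w" by (rule component_le_norm_cart)
  also have "\<dots> < r / 4" using z by (simp add: dist_norm norm_minus_commute)
  finally have "\<bar>z $ i - a $ i + r / 2 * \<sigma>\<bar> < r / 4" by (simp add: axis_def algebra_simps)
  hence "z $ i - a $ i + r / 2 * \<sigma> < r / 4" "- (r / 4) < z $ i - a $ i + r / 2 * \<sigma>"
    by linarith+
  thus "z \<in> {y. \<sigma> * y $ i \<le> t}" using a r assms by auto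
qed

lemma emeasure_lebesgue_lborel_AE:
  assumes "A \<in> sets lebesgue" "B \<in> sets borel" "AE x in lebesgue. x \<in> A \<longleftrightarrow> x \<in> B"
  shows "emeasure lebesgue A = emeasure lborel B"
proof -
  have "emeasure lebesgue A = emeasure lebesgue B"
    by (rule emeasure_eq_AE) (use assms in auto)
  thus ?thesis using assms by simp
qed

text \<open>For a near x0, H is on the correct side of f x0 on a large part of a ball about x0, and
  on the opposite side of f a on a large part of a ball about a. \<open>weak_grad_no_jump\<close>
  finds points of these two sets with nearby H-values. Since \<open>\<kappa>\<close> and the radius
  do not depend on a, the exact values of f are controlled, not just those of a
  representative.\<close>

lemma qns_morphism_continuous:
  fixes f :: "real^'n \<Rightarrow> real^'n"
  assumes f: "qns_morphism \<Omega> \<Omega>' f" and \<Omega>: "open \<Omega>" "open \<Omega>'" and D: "weak_diff_matrix \<Omega> f D"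
    and L: "\<And>i. Lp_loc (real CARD('n)) \<Omega> (\<lambda>x. f x $ i)"
  shows "continuous_on \<Omega> f"
proof -
  obtain \<kappa> where \<kappa>: "\<kappa> > 0"
    and meas: "\<And>E. fat_cone_set E \<Longrightarrow> {x\<in>\<Omega>. f x \<in> E} \<in> sets lebesgue"
    and dens: "\<And>E a r. fat_cone_set E \<Longrightarrow> a \<in> \<Omega> \<Longrightarrow> f a \<in> E \<Longrightarrow> r > 0 \<Longrightarrow> ball a r \<subseteq> \<Omega> \<Longrightarrow>
       ennreal (\<kappa> * r ^ CARD('n)) \<le> emeasure lebesgue {x\<in>ball a r. f x \<in> E}"
    by (rule qns_morphism_density[OF f \<Omega>]) blast
  have "isCont (\<lambda>x. f x $ i) x0" if x0: "x0 \<in> \<Omega>" for i x0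
  proof -
    obtain R where R: "R > 0" "cball x0 R \<subseteq> \<Omega>"
      using \<Omega>(1) x0 open_contains_cball by blast
    have Lg: "Lp_loc (real CARD('n)) \<Omega> (\<lambda>x. D x $ i $ j)"
      and w: "weak_partial \<Omega> (\<lambda>x. f x $ i) j (\<lambda>x. D x $ i $ j)" for j
      using D by (simp_all add: weak_diff_matrix_def)
    obtain H G where wg: "weak_grad_on (ball x0 R) H G"
      and Gn: "\<And>j. integrable lborel (\<lambda>x. \<bar>G j x\<bar> ^ CARD('n))"
      and fH: "AE x in lebesgue. x \<in> ball x0 R \<longrightarrow> f x $ i = H x"
      by (rule weak_partial_local_rep[OF L Lg w \<Omega>(1) R(2)]) blast
    have "integrable lborel H" using wg by (simp add: weak_grad_on_def)
    hence [measurable]: "H \<in> borel_measurable borel" by auto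
    have lev: "ennreal (\<kappa> * r ^ CARD('n)) \<le> emeasure lborel {x\<in>ball a r. \<sigma> * H x \<le> \<sigma> * f a $ i}"
      if \<sigma>: "\<sigma> = 1 \<or> \<sigma> = -1" and r: "r > 0" "ball a r \<subseteq> ball x0 R" for a r and \<sigma> :: real
    proof -
      let ?E = "{y. \<sigma> * y $ i \<le> \<sigma> * f a $ i}"
      have E: "fat_cone_set ?E" by (rule fat_cone_set_halfspace[OF \<sigma>])
      have sub: "ball a r \<subseteq> \<Omega>" using r R ball_subset_cball by blast
      hence a: "a \<in> \<Omega>" using r by auto
      have "{x\<in>ball a r. f x \<in> ?E} = ball a r \<inter> {x\<in>\<Omega>. f x \<in> ?E}" using sub by auto
      hence m: "{x\<in>ball a r. f x \<in> ?E} \<in> sets lebesgue" using meas[OF E] by auto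
      have "emeasure lebesgue {x\<in>ball a r. f x \<in> ?E} = emeasure lborel {x\<in>ball a r. \<sigma> * H x \<le> \<sigma> * f a $ i}"
      proof (rule emeasure_lebesgue_lborel_AE[OF m])
        show "{x\<in>ball a r. \<sigma> * H x \<le> \<sigma> * f a $ i} \<in> sets borel" by measurable
        show "AE x in lebesgue. x \<in> {x\<in>ball a r. f x \<in> ?E} \<longleftrightarrow> x \<in> {x\<in>ball a r. \<sigma> * H x \<le> \<sigma> * f a $ i}"
          using fH by eventually_elim (use r in auto)
      qed
      thus ?thesis using dens[OF E a _ r(1) sub] by simp
    qed
    show ?thesis
      unfolding continuous_at_eps_delta
    proof (intro allI impI)
      fix \<eta> :: real assume "\<eta> > 0"
      obtain r0 where r0: "r0 > 0" and nj: "\<And>r S S'. 0 < r \<Longrightarrow> r \<le> r0 \<Longrightarrow> S \<in> sets borel \<Longrightarrow> S' \<in> sets borel \<Longrightarrow>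
         S \<subseteq> ball x0 r \<Longrightarrow> S' \<subseteq> ball x0 (2 * r) \<Longrightarrow>
         ennreal (\<kappa> * r ^ CARD('n)) \<le> emeasure lborel S \<Longrightarrow>
         ennreal (\<kappa> * r ^ CARD('n)) \<le> emeasure lborel S' \<Longrightarrow> \<exists>x\<in>S. \<exists>y\<in>S'. \<bar>H x - H y\<bar> < \<eta>"
        by (rule weak_grad_no_jump[OF wg R(1) Gn \<kappa> \<open>\<eta> > 0\<close>]) blast
      \<comment> \<open>\<open>R / 2\<close> keeps \<open>ball a r\<close>, which lies in
        \<open>ball x0 (2 * r)\<close>, inside the ball where H represents the component.\<close>
      define r where "r = min r0 (R / 2)"
      have r: "r > 0" "r \<le> r0" "2 * r \<le> R" using r0 R by (auto simp: r_def)
      have "\<bar>f a $ i - f x0 $ i\<bar> < \<eta>" if a: "dist x0 a < r" for a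
      proof -
        have b2: "ball a r \<subseteq> ball x0 (2 * r)"
        proof
          fix z assume "z \<in> ball a r"
          thus "z \<in> ball x0 (2 * r)" using a dist_triangle[of x0 z a] by simp
        qed
        have bR: "ball a r \<subseteq> ball x0 R" "ball x0 r \<subseteq> ball x0 R"
          using b2 r by (auto simp: subset_iff)
        have "\<sigma> * (f a $ i - f x0 $ i) < \<eta>" if \<sigma>: "\<sigma> = 1 \<or> \<sigma> = -1" for \<sigma> :: real
        proof -
          \<comment> \<open>The sign is reversed at a: there the set \<sigma> H \<ge> \<sigma> f a
            is used, at x0 the set \<sigma> H \<le> \<sigma> f x0, so that close H-values bound
            \<sigma> (f a - f x0) from above.\<close>
          have "- \<sigma> = 1 \<or> - \<sigma> = -1" using \<sigma> by auto
          from lev[OF this r(1) bR(1)]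
          have *: "ennreal (\<kappa> * r ^ CARD('n)) \<le> emeasure lborel {x\<in>ball a r. - \<sigma> * H x \<le> - \<sigma> * f a $ i}" .
          have "\<exists>x\<in>{x\<in>ball x0 r. \<sigma> * H x \<le> \<sigma> * f x0 $ i}. \<exists>y\<in>{x\<in>ball a r. - \<sigma> * H x \<le> - \<sigma> * f a $ i}. \<bar>H x - H y\<bar> < \<eta>"
          proof (rule nj[OF r(1,2) _ _ _ _ lev[OF \<sigma> r(1) bR(2)] *])
            show "{x\<in>ball x0 r. \<sigma> * H x \<le> \<sigma> * f x0 $ i} \<in> sets borel" by measurable
            show "{x\<in>ball a r. - \<sigma> * H x \<le> - \<sigma> * f a $ i} \<in> sets borel" by measurable
          qed (use b2 in auto)
          then obtain x y where "\<sigma> * H x \<le> \<sigma> * f x0 $ i" "- \<sigma> * H y \<le> - \<sigma> * f a $ i" "\<bar>H x - H y\<bar> < \<eta>"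
            by auto
          thus ?thesis using \<sigma> by auto
        qed
        from this[of 1] this[of "-1"] show ?thesis by auto
      qed
      thus "\<exists>d>0. \<forall>y. dist y x0 < d \<longrightarrow> dist (f y $ i) (f x0 $ i) < \<eta>"
        using r(1) by (intro exI[of _ r]) (auto simp: dist_real_def dist_commute)
    qed
  qed
  note cont = this
  have "isCont f x0" if "x0 \<in> \<Omega>" for x0
    unfolding isCont_def
  proof (rule vec_tendstoI)
    fix i
    show "((\<lambda>x. f x $ i) \<longlongrightarrow> f x0 $ i) (at x0)"
      using cont[OF that] by (simp only: isCont_def)
  qed
  thus ?thesis by (simp add: continuous_at_imp_continuous_on)
qed

section \<open>Volume and determinant estimates\<close>

lemma abs_det_le_fact:
  fixes M :: "real^'n^'n"
  assumes "\<And>i j. \<bar>M $ i $ j\<bar> \<le> c"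
  shows "\<bar>det M\<bar> \<le> fact CARD('n) * c ^ CARD('n)"
proof -
  have "\<bar>det M\<bar> \<le> (\<Sum>p | p permutes (UNIV :: 'n set). \<bar>of_int (sign p) * (\<Prod>i\<in>UNIV. M $ i $ p i)\<bar>)"
    unfolding det_def by (rule sum_abs)
  also have "\<dots> \<le> (\<Sum>p | p permutes (UNIV :: 'n set). c ^ CARD('n))"
  proof (rule sum_mono)
    fix p :: "'n \<Rightarrow> 'n"
    have "(\<Prod>i\<in>UNIV. \<bar>M $ i $ p i\<bar>) \<le> (\<Prod>i\<in>(UNIV::'n set). c)"
      by (rule prod_mono) (use assms in auto)
    moreover have "\<bar>real_of_int (sign p)\<bar> = 1" by (simp add: sign_def)
    ultimately show "\<bar>of_int (sign p) * (\<Prod>i\<in>UNIV. M $ i $ p i)\<bar> \<le> c ^ CARD('n)"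
      by (simp add: abs_mult abs_prod)
  qed
  also have "\<dots> = fact CARD('n) * c ^ CARD('n)"
    using card_permutations[of "UNIV :: 'n set" "CARD('n)"] by simp
  finally show ?thesis .
qed

text \<open>Apply the Leibniz bound to the inverse matrix: its entries are at most 1 / m, so the
  determinant of the inverse is at most n! / m^n in absolute value.\<close>

lemma abs_det_ge_expansion:
  fixes B :: "real^'n^'n"
  assumes "m > 0" and "\<And>x. m * norm x \<le> norm (B *v x)"
  shows "m ^ CARD('n) \<le> fact CARD('n) * \<bar>det B\<bar>"
proof -
  have "inj ((*v) B)"
  proof (rule injI)
    fix x y assume "B *v x = B *v y"
    hence "B *v (x - y) = 0" by (simp add: matrix_vector_mult_diff_distrib)
    hence "m * norm (x - y) \<le> 0" using assms(2)[of "x - y"] by simp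
    thus "x = y" using assms(1) by (simp add: mult_le_0_iff)
  qed
  then obtain M where "M ** B = mat 1" using matrix_left_invertible_injective[of B] by (auto simp: inj_on_def)
  hence BM: "B ** M = mat 1" using matrix_left_right_inverse by blast
  have "\<bar>M $ i $ j\<bar> \<le> 1 / m" for i j
  proof -
    have "\<bar>M $ i $ j\<bar> = \<bar>(M *v axis j 1) $ i\<bar>" by (simp add: matrix_vector_mult_basis column_def)
    also have "\<dots> \<le> norm (M *v axis j 1)" by (rule component_le_norm_cart)
    also have "m * \<dots> \<le> norm (B *v (M *v axis j 1))" by (rule assms(2))
    hence "norm (M *v axis j 1) \<le> 1 / m"
      using assms(1) by (simp add: matrix_vector_mul_assoc BM field_simps)
    finally show ?thesis .
  qed
  hence "\<bar>det M\<bar> \<le> fact CARD('n) * (1 / m) ^ CARD('n)" by (rule abs_det_le_fact)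
  hence "m ^ CARD('n) * \<bar>det M\<bar> \<le> fact CARD('n)"
    using assms(1) by (simp add: power_divide field_simps)
  hence "m ^ CARD('n) * \<bar>det M\<bar> * \<bar>det B\<bar> \<le> fact CARD('n) * \<bar>det B\<bar>"
    by (rule mult_right_mono) simp
  moreover have "\<bar>det M\<bar> * \<bar>det B\<bar> = 1"
    using BM by (metis abs_mult abs_one det_I det_mul mult.commute)
  ultimately show ?thesis by (simp add: mult.assoc)
qed

text \<open>Let the unit vector v minimise |A^T v| and let m be the minimum. The hypothesis at v
  bounds A^T by K m on the orthogonal complement, hence by (1 + K) m everywhere, while A^T expands
  by at least m. So |A|^n \<le> (1 + K)^n m^n and m^n \<le> n! |det A|.\<close>

lemma onorm_power_le_det:
  fixes A :: "real^'n^'n"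
  assumes K: "\<And>v w. norm v = 1 \<Longrightarrow> norm w = 1 \<Longrightarrow> v \<bullet> w = 0 \<Longrightarrow> norm (transpose A *v w) \<le> K * norm (transpose A *v v)"
    and "K \<ge> 0" and det: "det A \<ge> 0"
  shows "onorm (\<lambda>v. A *v v) ^ CARD('n) \<le> (1 + K) ^ CARD('n) * fact CARD('n) * det A"
proof -
  define B where "B = transpose A"
  have "\<exists>v\<in>sphere 0 1. \<forall>w\<in>sphere 0 1. norm (B *v v) \<le> norm (B *v w)"
  proof (rule continuous_attains_inf)
    show "sphere (0::real^'n) 1 \<noteq> {}"
      using norm_axis_1 by (metis dist_0_norm empty_iff mem_sphere)
    show "continuous_on (sphere 0 1) (\<lambda>v. norm (B *v v))"
      by (intro continuous_on_norm linear_continuous_on matrix_vector_mul_bounded_linear)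
  qed simp
  then obtain v where v: "norm v = 1" and min: "\<And>w. norm w = 1 \<Longrightarrow> norm (B *v v) \<le> norm (B *v w)"
    by auto
  define m where "m = norm (B *v v)"
  have m0: "m \<ge> 0" by (simp add: m_def)
  have low: "m * norm x \<le> norm (B *v x)" for x
  proof (cases "x = 0")
    case False
    have "m \<le> norm (B *v (inverse (norm x) *\<^sub>R x))"
      unfolding m_def by (rule min) (use False in simp)
    also have "\<dots> = norm (B *v x) / norm x"
      by (simp add: matrix_vector_mult_scaleR field_simps)
    finally show ?thesis using False by (simp add: field_simps)
  qed simp
  have up: "norm (B *v x) \<le> (1 + K) * m * norm x" for x
  proof -
    define y where "y = x - (v \<bullet> x) *\<^sub>R v"
    have "v \<bullet> v = 1" using v by (simp add: norm_eq_1)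
    hence vy: "v \<bullet> y = 0" by (simp add: y_def inner_diff_right)
    have x: "x = (v \<bullet> x) *\<^sub>R v + y" by (simp add: y_def)
    have "(norm x)\<^sup>2 = (norm ((v \<bullet> x) *\<^sub>R v))\<^sup>2 + (norm y)\<^sup>2"
      by (subst x) (rule norm_add_Pythagorean, simp add: orthogonal_def vy)
    hence "(norm y)\<^sup>2 \<le> (norm x)\<^sup>2" by simp
    hence ny: "norm y \<le> norm x" by (simp add: power2_le_iff_abs_le)
    have By: "norm (B *v y) \<le> K * m * norm y"
    proof (cases "y = 0")
      case False
      have "norm (B *v (inverse (norm y) *\<^sub>R y)) \<le> K * m"
        unfolding m_def B_def by (rule K) (use v vy False in simp_all)
      thus ?thesis using False by (simp add: matrix_vector_mult_scaleR field_simps)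
    qed simp
    have "norm (B *v x) = norm ((v \<bullet> x) *\<^sub>R (B *v v) + B *v y)"
      by (subst x) (simp add: matrix_vector_right_distrib matrix_vector_mult_scaleR)
    also have "\<dots> \<le> \<bar>v \<bullet> x\<bar> * m + norm (B *v y)"
      using norm_triangle_ineq[of "(v \<bullet> x) *\<^sub>R (B *v v)" "B *v y"] by (simp add: m_def)
    also have "\<dots> \<le> norm x * m + K * m * norm x"
    proof (rule add_mono)
      have "\<bar>v \<bullet> x\<bar> \<le> norm x" using Cauchy_Schwarz_ineq2[of v x] v by simp
      thus "\<bar>v \<bullet> x\<bar> * m \<le> norm x * m" using m0 by (rule mult_right_mono)
      have "K * m * norm y \<le> K * m * norm x" using ny m0 \<open>K \<ge> 0\<close> by (intro mult_left_mono) auto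
      thus "norm (B *v y) \<le> K * m * norm x" using By by simp
    qed
    finally show ?thesis by (simp add: algebra_simps)
  qed
  \<comment> \<open>The bound passes from A^T to A through |A z|^2 = (A^T (A z)) . z.\<close>
  have "norm (A *v z) \<le> (1 + K) * m * norm z" for z
  proof (cases "A *v z = 0")
    case False
    have "norm (A *v z) * norm (A *v z) = (A *v z) \<bullet> (A *v z)"
      by (simp add: power2_norm_eq_inner[symmetric] power2_eq_square)
    also have "\<dots> = (B *v (A *v z)) \<bullet> z"
      by (simp add: B_def dot_lmul_matrix)
    also have "\<dots> \<le> norm (B *v (A *v z)) * norm z" by (rule norm_cauchy_schwarz)
    also have "\<dots> \<le> (1 + K) * m * norm (A *v z) * norm z"
      by (intro mult_right_mono up) auto
    finally have "norm (A *v z) * norm (A *v z) \<le> norm (A *v z) * ((1 + K) * m * norm z)"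
      by (simp add: mult_ac)
    thus ?thesis using False by simp
  qed (use m0 \<open>K \<ge> 0\<close> in simp)
  hence on: "onorm (\<lambda>v. A *v v) \<le> (1 + K) * m"
    using m0 \<open>K \<ge> 0\<close> by (intro onorm_bound) auto
  have "m ^ CARD('n) \<le> fact CARD('n) * det A"
  proof (cases "m = 0")
    case True
    thus ?thesis using det by (simp add: zero_power)
  next
    case False
    hence "m ^ CARD('n) \<le> fact CARD('n) * \<bar>det B\<bar>" using m0 low by (intro abs_det_ge_expansion) auto
    thus ?thesis using det by (simp add: B_def)
  qed
  hence "(1 + K) ^ CARD('n) * m ^ CARD('n) \<le> (1 + K) ^ CARD('n) * (fact CARD('n) * det A)"
    using \<open>K \<ge> 0\<close> by (intro mult_left_mono) auto
  moreover have "onorm (\<lambda>v. A *v v) ^ CARD('n) \<le> ((1 + K) * m) ^ CARD('n)"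
    by (intro power_mono on onorm_pos_le matrix_vector_mul_bounded_linear)
  ultimately show ?thesis by (simp add: power_mult_distrib mult.assoc)
qed

text \<open>Averages the slab over its translates by \<open>k *\<^sub>R u\<close> with \<open>0 \<le> k \<le> r\<close>.\<close>

lemma emeasure_slab_le:
  fixes u :: "real^'n"
  assumes u: "norm u = 1" and r: "r > 0" and t: "t \<ge> 0"
  shows "emeasure lborel {z\<in>ball 0 r. \<bar>u \<bullet> z\<bar> \<le> t}
    \<le> ennreal (2 * t / r * ((2 * r) ^ CARD('n) * unit_ball_vol TYPE('n)))"
proof -
  define V where "V = (2 * r) ^ CARD('n) * unit_ball_vol TYPE('n)"
  have V: "V > 0" using r unit_ball_vol_pos[where 'n = 'n] by (simp add: V_def)
  define S where "S = {z\<in>ball 0 r. \<bar>u \<bullet> z\<bar> \<le> t}"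
  have [measurable]: "S \<in> sets borel" unfolding S_def by measurable
  have "ennreal r * emeasure lborel S = (\<integral>\<^sup>+k. emeasure lborel S * indicator {0..r} k \<partial>lborel)"
    using r by (simp add: nn_integral_cmult_indicator mult.commute)
  also have "\<dots> = (\<integral>\<^sup>+k. (\<integral>\<^sup>+z. indicator S (- (k *\<^sub>R u) + z) * indicator {0..r} k \<partial>lborel) \<partial>lborel)"
  proof (rule nn_integral_cong)
    fix k :: real
    have "(\<integral>\<^sup>+z. indicator S (- (k *\<^sub>R u) + z) * indicator {0..r} k \<partial>lborel)
       = (\<integral>\<^sup>+z. indicator S (- (k *\<^sub>R u) + z) \<partial>lborel) * indicator {0..r} k"
      by (rule nn_integral_multc) measurable
    also have "(\<integral>\<^sup>+z. indicator S (- (k *\<^sub>R u) + z) \<partial>lborel) = (\<integral>\<^sup>+z. indicator S z \<partial>lborel)"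
      by (rule lborel_translate_nn) measurable
    finally show "emeasure lborel S * indicator {0..r} k
       = (\<integral>\<^sup>+z. indicator S (- (k *\<^sub>R u) + z) * indicator {0..r} k \<partial>lborel)" by simp
  qed
  also have "\<dots> = (\<integral>\<^sup>+z. (\<integral>\<^sup>+k. indicator S (- (k *\<^sub>R u) + z) * indicator {0..r} k \<partial>lborel) \<partial>lborel)"
    by (rule lborel_pair.Fubini') measurable
  \<comment> \<open>For fixed z the admissible k lie in an interval of length 2 t about u . z, and
    every translate of the slab stays in the ball of radius 2 r.\<close>
  also have "\<dots> \<le> (\<integral>\<^sup>+z. ennreal (2 * t) * indicator (ball (0::real^'n) (2 * r)) z \<partial>lborel)"
  proof (rule nn_integral_mono)
    fix z :: "real^'n"
    have "(\<integral>\<^sup>+k. indicator S (- (k *\<^sub>R u) + z) * indicator {0..r} k \<partial>lborel)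
      \<le> (\<integral>\<^sup>+k. indicator (ball 0 (2 * r)) z * indicator {u \<bullet> z - t .. u \<bullet> z + t} k \<partial>lborel)"
    proof (rule nn_integral_mono)
      fix k :: real
      have "z \<in> ball 0 (2 * r) \<and> k \<in> {u \<bullet> z - t .. u \<bullet> z + t}" if "- (k *\<^sub>R u) + z \<in> S" "k \<in> {0..r}"
      proof -
        have "u \<bullet> u = 1" using u by (simp add: norm_eq_1)
        hence "\<bar>u \<bullet> z - k\<bar> \<le> t" "norm (z - k *\<^sub>R u) < r"
          using that(1) by (auto simp: S_def inner_diff_right)
        moreover have "norm z \<le> norm (z - k *\<^sub>R u) + norm (k *\<^sub>R u)"
          using norm_triangle_ineq[of "z - k *\<^sub>R u" "k *\<^sub>R u"] by simp
        ultimately show ?thesis using that(2) u by auto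
      qed
      thus "indicator S (- (k *\<^sub>R u) + z) * indicator {0..r} k
         \<le> (indicator (ball 0 (2 * r)) z * indicator {u \<bullet> z - t .. u \<bullet> z + t} k :: ennreal)"
        by (auto simp: indicator_def)
    qed
    also have "\<dots> = ennreal (2 * t) * indicator (ball 0 (2 * r)) z"
      using t by (simp add: nn_integral_cmult_indicator mult.commute)
    finally show "(\<integral>\<^sup>+k. indicator S (- (k *\<^sub>R u) + z) * indicator {0..r} k \<partial>lborel)
      \<le> ennreal (2 * t) * indicator (ball 0 (2 * r)) z" .
  qed
  also have "\<dots> = ennreal (2 * t) * ennreal V"
    using emeasure_ball_cart[of "2 * r" "0::real^'n"] r by (simp add: nn_integral_cmult_indicator V_def)
  finally have "ennreal (1 / r) * (ennreal r * emeasure lborel S) \<le> ennreal (1 / r) * (ennreal (2 * t) * ennreal V)"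
    by (rule mult_left_mono) simp
  moreover have "ennreal (1 / r) * (ennreal r * emeasure lborel S) = emeasure lborel S"
    using r by (simp add: mult.assoc[symmetric] ennreal_mult[symmetric])
  moreover have "ennreal (1 / r) * (ennreal (2 * t) * ennreal V) = ennreal (2 * t / r * V)"
    using r t V by (simp add: ennreal_mult[symmetric])
  ultimately show ?thesis by (simp add: S_def V_def)
qed

section \<open>Approximate differentiability\<close>

text \<open>Unnormalised L1 error of the first-order expansion at x. It compares with r^(n+1): r^n
  for the volume and one r for the size of the increment.\<close>

definition diff_err :: "('n \<Rightarrow> real^'n \<Rightarrow> real) \<Rightarrow> ('n \<Rightarrow> 'n \<Rightarrow> real^'n \<Rightarrow> real) \<Rightarrow> real \<Rightarrow> real^'n \<Rightarrow> ennreal" where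
  "diff_err H G r x = (\<integral>\<^sup>+e. (\<Sum>i\<in>UNIV. ennreal \<bar>H i (x + e) - H i x - (\<Sum>j\<in>UNIV. e $ j * G i j x)\<bar>)
     * indicator (ball 0 r) e \<partial>lborel)"

lemma borel_measurable_vec_nth [measurable]: "(\<lambda>x::real^'n. x $ j) \<in> borel_measurable borel"
  by (intro borel_measurable_continuous_onI continuous_intros)

lemma borel_measurable_diff_err:
  fixes H :: "'n::finite \<Rightarrow> real^'n \<Rightarrow> real"
  assumes [measurable]: "\<And>i. H i \<in> borel_measurable borel" "\<And>i j. G i j \<in> borel_measurable borel"
  shows "diff_err H G r \<in> borel_measurable borel"
  unfolding diff_err_def[abs_def] by measurable

lemma weak_grad_onD:
  assumes "weak_grad_on V H G"
  shows "H \<in> borel_measurable borel" "G j \<in> borel_measurable borel" "integrable lborel (G j)"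
proof -
  show "integrable lborel (G j)" using assms by (simp add: weak_grad_on_def)
  thus "G j \<in> borel_measurable borel" by auto
  have "integrable lborel H" using assms by (simp add: weak_grad_on_def)
  thus "H \<in> borel_measurable borel" by auto
qed

text \<open>With e fixed and x integrated first, the error is at most |e| times the L1 distance
  between the gradient and its translates along the segment. The radii R / 2 for x and R / 4 for e
  leave a margin R / 4 for the bumps.\<close>

lemma diff_err_L1:
  fixes H :: "'n \<Rightarrow> real^'n \<Rightarrow> real"
  assumes wg: "\<And>i. weak_grad_on (ball x0 R) (H i) (G i)" and r: "0 < r" "r < R / 4"
    and small: "\<And>i j z. norm z < r \<Longrightarrow> transl_L1 (G i j) z \<le> \<epsilon>" and "\<epsilon> \<ge> 0"
  shows "(\<integral>\<^sup>+x. diff_err H G r x * indicator (ball x0 (R / 2)) x \<partial>lborel)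
     \<le> ennreal (r * (real CARD('n) * real CARD('n) * \<epsilon>) * (r ^ CARD('n) * unit_ball_vol TYPE('n)))"
proof -
  let ?K = "ball x0 (R / 2)"
  \<comment> \<open>One factor n counts the components i, the other the partial derivatives
    j.\<close>
  define c where "c = real CARD('n) * real CARD('n) * \<epsilon>"
  have c: "c \<ge> 0" using \<open>\<epsilon> \<ge> 0\<close> by (simp add: c_def)
  have [measurable]: "H i \<in> borel_measurable borel" "G i j \<in> borel_measurable borel" for i j
    using weak_grad_onD[OF wg] by auto
  have inc: "(\<integral>\<^sup>+x. ennreal \<bar>H i (x + e) - H i x - (\<Sum>j\<in>UNIV. e $ j * G i j x)\<bar> * indicator ?K x \<partial>lborel)
      \<le> ennreal (norm e) * (\<Sum>j\<in>(UNIV :: 'n set). ennreal \<epsilon>)" if e: "norm e < r" for i e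
  proof (rule weak_grad_increment_L1[OF wg, where \<delta> = "R / 4"])
    fix x :: "real^'n" and s :: real assume x: "x \<in> ?K" and s: "0 \<le> s" "s \<le> 1"
    have "norm (s *\<^sub>R e) \<le> norm e" using s by (simp add: mult_left_le_one_le)
    hence ns: "norm (s *\<^sub>R e) < R / 4" using e r by simp
    show "ball (x + s *\<^sub>R e) (R / 4) \<subseteq> ball x0 R"
    proof
      fix z assume "z \<in> ball (x + s *\<^sub>R e) (R / 4)"
      hence "dist (x + s *\<^sub>R e) z < R / 4" by simp
      moreover have "dist x (x + s *\<^sub>R e) < R / 4" using ns by (simp add: dist_norm)
      moreover have "dist x0 x < R / 2" using x by simp
      ultimately show "z \<in> ball x0 R"
        using dist_triangle[of x0 z x] dist_triangle[of x z "x + s *\<^sub>R e"] by simp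
    qed
  next
    fix j :: 'n and s :: real assume s: "0 \<le> s" "s \<le> 1"
    have "norm (s *\<^sub>R e) \<le> norm e" using s by (simp add: mult_left_le_one_le)
    hence ns: "norm (s *\<^sub>R e) < r" using e by simp
    have "(\<integral>\<^sup>+x. ennreal \<bar>G i j (x + s *\<^sub>R e) - G i j x\<bar> * indicator ?K x \<partial>lborel)
      \<le> (\<integral>\<^sup>+x. ennreal \<bar>G i j (s *\<^sub>R e + x) - G i j x\<bar> \<partial>lborel)"
      by (intro nn_integral_mono) (auto simp: indicator_def add.commute)
    also have "\<dots> = ennreal (transl_L1 (G i j) (s *\<^sub>R e))"
      unfolding transl_L1_def
      by (rule nn_integral_eq_integral[OF transl_L1_integrable[OF weak_grad_onD(3)[OF wg]]]) simp
    also have "\<dots> \<le> ennreal \<epsilon>" by (rule ennreal_leI[OF small[OF ns]])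
    finally show "(\<integral>\<^sup>+x. ennreal \<bar>G i j (x + s *\<^sub>R e) - G i j x\<bar> * indicator ?K x \<partial>lborel) \<le> ennreal \<epsilon>" .
  qed (use r in auto)
  have "(\<integral>\<^sup>+x. diff_err H G r x * indicator ?K x \<partial>lborel)
    = (\<integral>\<^sup>+x. (\<integral>\<^sup>+e. (\<Sum>i\<in>UNIV. ennreal \<bar>H i (x + e) - H i x - (\<Sum>j\<in>UNIV. e $ j * G i j x)\<bar>)
        * indicator (ball 0 r) e * indicator ?K x \<partial>lborel) \<partial>lborel)"
    unfolding diff_err_def by (intro nn_integral_cong nn_integral_multc[symmetric]) measurable
  also have "\<dots> = (\<integral>\<^sup>+e. (\<integral>\<^sup>+x. (\<Sum>i\<in>UNIV. ennreal \<bar>H i (x + e) - H i x - (\<Sum>j\<in>UNIV. e $ j * G i j x)\<bar>)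
        * indicator (ball 0 r) e * indicator ?K x \<partial>lborel) \<partial>lborel)"
    by (rule lborel_pair.Fubini') measurable
  also have "\<dots> \<le> (\<integral>\<^sup>+e. ennreal (r * c) * indicator (ball (0 :: real^'n) r) e \<partial>lborel)"
  proof (rule nn_integral_mono)
    fix e :: "real^'n"
    show "(\<integral>\<^sup>+x. (\<Sum>i\<in>UNIV. ennreal \<bar>H i (x + e) - H i x - (\<Sum>j\<in>UNIV. e $ j * G i j x)\<bar>)
        * indicator (ball 0 r) e * indicator ?K x \<partial>lborel) \<le> ennreal (r * c) * indicator (ball 0 r) e"
    proof (cases "e \<in> ball 0 r")
      case True
      hence e: "norm e < r" by simp
      have "(\<integral>\<^sup>+x. (\<Sum>i\<in>UNIV. ennreal \<bar>H i (x + e) - H i x - (\<Sum>j\<in>UNIV. e $ j * G i j x)\<bar>)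
        * indicator (ball 0 r) e * indicator ?K x \<partial>lborel)
        = (\<integral>\<^sup>+x. (\<Sum>i\<in>UNIV. ennreal \<bar>H i (x + e) - H i x - (\<Sum>j\<in>UNIV. e $ j * G i j x)\<bar> * indicator ?K x) \<partial>lborel)"
        using True by (simp add: sum_distrib_right del: sum_ennreal)
      also have "\<dots> = (\<Sum>i\<in>UNIV. (\<integral>\<^sup>+x. ennreal \<bar>H i (x + e) - H i x - (\<Sum>j\<in>UNIV. e $ j * G i j x)\<bar> * indicator ?K x \<partial>lborel))"
        by (rule nn_integral_sum) measurable
      also have "\<dots> \<le> (\<Sum>i\<in>(UNIV :: 'n set). ennreal (norm e) * (\<Sum>j\<in>(UNIV :: 'n set). ennreal \<epsilon>))"
        by (intro sum_mono inc e)
      also have "\<dots> = ennreal (norm e * c)"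
        using \<open>\<epsilon> \<ge> 0\<close> by (simp add: c_def ennreal_mult ennreal_of_nat_eq_real_of_nat mult_ac)
      also have "\<dots> \<le> ennreal (r * c)" using e c by (intro ennreal_leI mult_right_mono) auto
      finally show ?thesis using True by simp
    qed simp
  qed
  also have "\<dots> = ennreal (r * c) * ennreal (r ^ CARD('n) * unit_ball_vol TYPE('n))"
    using emeasure_ball_cart[of r "0::real^'n"] r by (simp add: nn_integral_cmult_indicator)
  also have "\<dots> = ennreal (r * c * (r ^ CARD('n) * unit_ball_vol TYPE('n)))"
    using r c unit_ball_vol_pos[where 'n = 'n] by (intro ennreal_mult[symmetric]) auto
  finally show ?thesis by (simp only: c_def)
qed

text \<open>Normalised errors along suitable radii tend to 0 in L1, so their infimum vanishes a.e.
  The radius may depend on x and on the tolerance, which is all that the comparison with the density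
  bound requires.\<close>

lemma weak_grad_approx_differentiable:
  fixes H :: "'n \<Rightarrow> real^'n \<Rightarrow> real"
  assumes wg: "\<And>i. weak_grad_on (ball x0 R) (H i) (G i)" and R: "R > 0"
  shows "AE x in lborel. x \<in> ball x0 (R / 2) \<longrightarrow>
     (\<forall>\<epsilon>>0. \<exists>r>0. r < R / 4 \<and> diff_err H G r x < ennreal (\<epsilon> * r ^ Suc CARD('n)))"
proof -
  let ?K = "ball x0 (R / 2)"
  define N where "N = CARD('n)"
  define \<omega> where "\<omega> = unit_ball_vol TYPE('n)"
  have N: "N > 0" by (simp add: N_def)
  have \<omega>: "\<omega> > 0" unfolding \<omega>_def by (rule unit_ball_vol_pos)
  have [measurable]: "diff_err H G r \<in> borel_measurable borel" for r
    by (intro borel_measurable_diff_err weak_grad_onD[OF wg])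
  have "\<exists>r>0. r < R / 4 \<and> (\<integral>\<^sup>+x. diff_err H G r x * indicator ?K x \<partial>lborel) \<le> ennreal (1 / Suc k * r ^ Suc N)" for k
  proof -
    \<comment> \<open>Cancels the factors n^2 and \<omega> of \<open>diff_err_L1\<close>.\<close>
    define \<epsilon> where "\<epsilon> = 1 / Suc k / (real N * real N * \<omega>)"
    have \<epsilon>: "\<epsilon> > 0" using N \<omega> by (simp add: \<epsilon>_def)
    have "\<exists>\<delta>>0. \<forall>z. norm z < \<delta> \<longrightarrow> transl_L1 (G (fst p) (snd p)) z < \<epsilon>" for p
      by (rule transl_L1_small[OF weak_grad_onD(3)[OF wg] \<epsilon>, of "fst p" "snd p"]) blast
    then obtain \<delta> where \<delta>: "\<And>p. \<delta> p > 0"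
      "\<And>p z. norm z < \<delta> p \<Longrightarrow> transl_L1 (G (fst p) (snd p)) z < \<epsilon>"
      by metis
    define r where "r = min (Min (range \<delta>)) (R / 8)"
    have "Min (range \<delta>) > 0" using \<delta>(1) by auto
    hence r: "r > 0" "r < R / 4" using R by (auto simp: r_def)
    have "r \<le> \<delta> p" for p by (auto simp: r_def intro: min.coboundedI1)
    hence sm: "transl_L1 (G i j) z \<le> \<epsilon>" if "norm z < r" for i j z
      using \<delta>(2)[of z "(i, j)"] that by (force intro: less_imp_le order_less_le_trans)
    have "(\<integral>\<^sup>+x. diff_err H G r x * indicator ?K x \<partial>lborel) \<le> ennreal (r * (real N * real N * \<epsilon>) * (r ^ N * \<omega>))"
      unfolding N_def \<omega>_def by (rule diff_err_L1[OF wg r sm]) (use \<epsilon> in auto)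
    also have "r * (real N * real N * \<epsilon>) * (r ^ N * \<omega>) = 1 / Suc k * r ^ Suc N"
      using N \<omega> by (simp add: \<epsilon>_def)
    finally show ?thesis using r by blast
  qed
  then obtain r where r: "\<And>k. r k > 0" "\<And>k. r k < R / 4"
    "\<And>k. (\<integral>\<^sup>+x. diff_err H G (r k) x * indicator ?K x \<partial>lborel) \<le> ennreal (1 / Suc k * r k ^ Suc N)"
    by metis
  \<comment> \<open>An infimum replaces the extraction of an a.e. convergent subsequence: its
    integral is at most 1 / (k + 1) for every k.\<close>
  define g where "g = (\<lambda>x. INF k. diff_err H G (r k) x * indicator ?K x * ennreal (1 / r k ^ Suc N))"
  have [measurable]: "g \<in> borel_measurable borel" unfolding g_def by measurable
  have "(\<integral>\<^sup>+x. g x \<partial>lborel) \<le> ennreal (1 / Suc k)" for k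
  proof -
    have "(\<integral>\<^sup>+x. g x \<partial>lborel) \<le> (\<integral>\<^sup>+x. diff_err H G (r k) x * indicator ?K x * ennreal (1 / r k ^ Suc N) \<partial>lborel)"
      unfolding g_def by (intro nn_integral_mono INF_lower) auto
    also have "\<dots> = (\<integral>\<^sup>+x. diff_err H G (r k) x * indicator ?K x \<partial>lborel) * ennreal (1 / r k ^ Suc N)"
      by (rule nn_integral_multc) measurable
    also have "\<dots> \<le> ennreal (1 / Suc k * r k ^ Suc N) * ennreal (1 / r k ^ Suc N)"
      by (intro mult_right_mono r) auto
    also have "\<dots> = ennreal (1 / Suc k * r k ^ Suc N * (1 / r k ^ Suc N))"
      using r(1)[of k] by (intro ennreal_mult[symmetric]) auto
    also have "1 / Suc k * r k ^ Suc N * (1 / r k ^ Suc N) = 1 / Suc k"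
      using r(1)[of k] by simp
    finally show ?thesis .
  qed
  hence small: "(\<integral>\<^sup>+x. g x \<partial>lborel) \<le> ennreal \<epsilon>" if \<epsilon>: "\<epsilon> > 0" for \<epsilon>
  proof -
    obtain k where "inverse (real (Suc k)) < \<epsilon>" using reals_Archimedean[OF \<epsilon>] by blast
    hence "ennreal (1 / Suc k) \<le> ennreal \<epsilon>" by (intro ennreal_leI) (simp add: inverse_eq_divide)
    with \<open>(\<integral>\<^sup>+x. g x \<partial>lborel) \<le> ennreal (1 / Suc k)\<close> show ?thesis by (rule order_trans)
  qed
  have "(\<integral>\<^sup>+x. g x \<partial>lborel) \<le> 0"
    by (rule ennreal_le_epsilon) (use small in auto)
  hence "(\<integral>\<^sup>+x. g x \<partial>lborel) = 0" by simp
  hence "AE x in lborel. g x = 0" by (subst (asm) nn_integral_0_iff_AE) auto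
  thus ?thesis
  proof eventually_elim
    case (elim x)
    show ?case
    proof (intro impI allI)
      fix \<epsilon> :: real assume x: "x \<in> ?K" and \<epsilon>: "\<epsilon> > 0"
      have "g x < ennreal \<epsilon>" using elim \<epsilon> by simp
      then obtain k where k: "diff_err H G (r k) x * indicator ?K x * ennreal (1 / r k ^ Suc N) < ennreal \<epsilon>"
        unfolding g_def by (auto simp: INF_less_iff)
      have "diff_err H G (r k) x < ennreal (\<epsilon> * r k ^ Suc N)"
      proof (rule ccontr)
        assume "\<not> ?thesis"
        hence "ennreal (\<epsilon> * r k ^ Suc N) * ennreal (1 / r k ^ Suc N) \<le> diff_err H G (r k) x * ennreal (1 / r k ^ Suc N)"
          by (intro mult_right_mono) auto
        moreover have "ennreal (\<epsilon> * r k ^ Suc N) * ennreal (1 / r k ^ Suc N) = ennreal \<epsilon>"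
          using r(1)[of k] \<epsilon> by (simp add: ennreal_mult[symmetric])
        ultimately show False using k x by simp
      qed
      thus "\<exists>r>0. r < R / 4 \<and> diff_err H G r x < ennreal (\<epsilon> * r ^ Suc CARD('n))"
        using r unfolding N_def by blast
    qed
  qed
qed

section \<open>Distortion\<close>

text \<open>A step r / 2 along v raises the right side by r / 2 and leaves the left side fixed by
  orthogonality; a perturbation below r / 4 changes each side by less than r / 4.\<close>

lemma fat_cone_set_wedge:
  fixes v w c :: "real^'n"
  assumes v: "norm v = 1" and w: "norm w = 1" and vw: "v \<bullet> w = 0"
  shows "fat_cone_set {y. \<bar>(y - c) \<bullet> w\<bar> \<le> (y - c) \<bullet> v}"
  unfolding fat_cone_set_def
proof (intro conjI exI[of _ v] ballI allI impI subsetI v)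
  show "closed {y. \<bar>(y - c) \<bullet> w\<bar> \<le> (y - c) \<bullet> v}"
    by (intro closed_Collect_le continuous_intros)
  fix a z :: "real^'n" and r :: real
  assume a: "a \<in> {y. \<bar>(y - c) \<bullet> w\<bar> \<le> (y - c) \<bullet> v}" and r: "r > 0"
    and z: "z \<in> ball (a + (r / 2) *\<^sub>R v) (r / 4)"
  define h where "h = z - (a + (r / 2) *\<^sub>R v)"
  have h: "norm h < r / 4" using z by (simp add: h_def dist_norm norm_minus_commute)
  have zc: "z - c = (a - c) + (r / 2) *\<^sub>R v + h" by (simp add: h_def)
  have "\<bar>h \<bullet> w\<bar> < r / 4" "\<bar>h \<bullet> v\<bar> < r / 4"
    using Cauchy_Schwarz_ineq2[of h w] Cauchy_Schwarz_ineq2[of h v] h v w by simp_all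
  moreover have "(z - c) \<bullet> w = (a - c) \<bullet> w + h \<bullet> w"
    unfolding zc by (simp add: inner_add_left vw)
  moreover have "(z - c) \<bullet> v = (a - c) \<bullet> v + r / 2 + h \<bullet> v"
    unfolding zc using v by (simp add: inner_add_left norm_eq_1)
  ultimately show "z \<in> {y. \<bar>(y - c) \<bullet> w\<bar> \<le> (y - c) \<bullet> v}" using a by simp
qed

lemma matrix_vector_mult_nth: "(A *v e) $ i = (\<Sum>j\<in>UNIV. e $ j * A $ i $ j)" for A :: "real^'n^'m"
  by (simp add: matrix_vector_mult_def mult.commute)

text \<open>The error h enters both sides of the wedge inequality, whence 2 s.\<close>

lemma wedge_preimage_bound:
  fixes A :: "real^'n^'n"
  assumes "\<bar>(A *v e + h) \<bullet> w\<bar> \<le> (A *v e + h) \<bullet> v" "norm v = 1" "norm w = 1"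
    and "norm h \<le> s" "norm e \<le> r"
  shows "\<bar>(transpose A *v w) \<bullet> e\<bar> \<le> norm (transpose A *v v) * r + 2 * s"
proof -
  have t: "(transpose A *v x) \<bullet> e = (A *v e) \<bullet> x" for x
    by (simp only: transpose_matrix_vector dot_lmul_matrix) (rule inner_commute)
  have "\<bar>h \<bullet> w\<bar> \<le> s" "\<bar>h \<bullet> v\<bar> \<le> s"
    using Cauchy_Schwarz_ineq2[of h w] Cauchy_Schwarz_ineq2[of h v] assms by simp_all
  moreover have "(transpose A *v v) \<bullet> e \<le> norm (transpose A *v v) * r"
    using norm_cauchy_schwarz[of "transpose A *v v" e] mult_left_mono[OF assms(5), of "norm (transpose A *v v)"]
    by simp
  ultimately show ?thesis
    using assms(1) unfolding t inner_add_left by linarith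
qed

text \<open>The blown-up preimage is covered by S1, where the first-order error is at least \<theta>
  r, and by a slab S2 orthogonal to A^T w. Chebyshev bounds S1 by \<theta> r^n,
  \<open>emeasure_slab_le\<close> bounds S2, and the density bound says that together they measure
  at least \<kappa> r^n. The claim is the limit \<theta> to 0.\<close>

lemma wedge_density_imp_distortion:
  fixes H :: "'n \<Rightarrow> real^'n \<Rightarrow> real" and A :: "real^'n^'n"
  assumes Hm: "\<And>i. H i \<in> borel_measurable borel"
    and A: "\<And>i j. A $ i $ j = G i j x" and c: "\<And>i. c $ i = H i x"
    and approx: "\<And>\<epsilon>. \<epsilon> > 0 \<Longrightarrow> \<exists>r>0. r < R \<and> diff_err H G r x < ennreal (\<epsilon> * r ^ Suc CARD('n))"
    and v: "norm v = 1" and w: "norm w = 1"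
    and dens: "\<And>r. 0 < r \<Longrightarrow> r < R \<Longrightarrow> ennreal (\<kappa> * r ^ CARD('n)) \<le>
       emeasure lborel {y\<in>ball x r. \<bar>((\<chi> i. H i y) - c) \<bullet> w\<bar> \<le> ((\<chi> i. H i y) - c) \<bullet> v}"
    and "\<kappa> > 0"
  shows "norm (transpose A *v w) \<le> 2 * 2 ^ CARD('n) * unit_ball_vol TYPE('n) / \<kappa> * norm (transpose A *v v)"
proof -
  define N where "N = CARD('n)"
  define \<omega> where "\<omega> = unit_ball_vol TYPE('n)"
  have \<omega>: "\<omega> > 0" unfolding \<omega>_def by (rule unit_ball_vol_pos)
  define p where "p = transpose A *v v"
  define q where "q = transpose A *v w"
  note Hm [measurable]
  have main: "\<kappa> \<le> \<theta> + 2 * 2 ^ N * \<omega> * (norm p + 2 * \<theta>) / norm q" if \<theta>: "\<theta> > 0" and q: "q \<noteq> 0" for \<theta>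
  proof -
    \<comment> \<open>The tolerance is the square of \<open>\<theta>\<close> because Chebyshev at
      height \<theta> r consumes one factor.\<close>
    obtain r where r: "r > 0" "r < R" and er: "diff_err H G r x < ennreal (\<theta>\<^sup>2 * r ^ Suc N)"
      using approx[of "\<theta>\<^sup>2"] \<theta> unfolding N_def by auto
    define D where "D = (\<lambda>e. \<Sum>i\<in>UNIV. \<bar>H i (x + e) - H i x - (\<Sum>j\<in>UNIV. e $ j * G i j x)\<bar>)"
    have [measurable]: "D \<in> borel_measurable borel" unfolding D_def by measurable
    have D0: "D e \<ge> 0" for e by (simp add: D_def sum_nonneg)
    define S where "S = {y\<in>ball x r. \<bar>((\<chi> i. H i y) - c) \<bullet> w\<bar> \<le> ((\<chi> i. H i y) - c) \<bullet> v}"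
    have Sm [measurable]: "S \<in> sets borel" unfolding S_def inner_vec_def by simp
    define S1 where "S1 = {e\<in>ball 0 r. \<theta> * r \<le> D e}"
    define u where "u = inverse (norm q) *\<^sub>R q"
    \<comment> \<open>The bound of \<open>wedge_preimage_bound\<close> for error size \<theta> r,
      divided by |q| since u is a unit vector.\<close>
    define t where "t = (norm p + 2 * \<theta>) * r / norm q"
    define S2 where "S2 = {e\<in>ball 0 r. \<bar>u \<bullet> e\<bar> \<le> t}"
    have [measurable]: "S1 \<in> sets borel" "S2 \<in> sets borel" unfolding S1_def S2_def by measurable
    have sub: "e \<in> S1 \<union> S2" if "x + e \<in> S" for e
    proof (cases "\<theta> * r \<le> D e")
      case True
      thus ?thesis using that by (simp add: S1_def S_def dist_norm)
    next
      case False
      define h where "h = (\<chi> i. H i (x + e)) - c - A *v e"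
      have e: "norm e < r" using that by (simp add: S_def dist_norm)
      have "norm h \<le> (\<Sum>i\<in>UNIV. \<bar>h $ i\<bar>)" by (rule norm_le_l1_cart)
      also have "\<dots> = D e" by (simp add: h_def D_def c matrix_vector_mult_nth A)
      finally have h: "norm h \<le> \<theta> * r" using False by simp
      have "\<bar>(A *v e + h) \<bullet> w\<bar> \<le> (A *v e + h) \<bullet> v"
        using that by (simp add: S_def h_def)
      hence "\<bar>q \<bullet> e\<bar> \<le> norm p * r + 2 * (\<theta> * r)"
        unfolding p_def q_def by (rule wedge_preimage_bound[OF _ v w h]) (use e in simp)
      hence "\<bar>u \<bullet> e\<bar> \<le> t"
        using q by (simp add: u_def t_def abs_mult field_simps)
      thus ?thesis using e by (simp add: S2_def)
    qed
    have S1: "emeasure lborel S1 \<le> ennreal (\<theta> * r ^ N)"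
    proof -
      have "ennreal (\<theta> * r) * emeasure lborel S1 = (\<integral>\<^sup>+e. ennreal (\<theta> * r) * indicator S1 e \<partial>lborel)"
        by (simp add: nn_integral_cmult_indicator)
      also have "\<dots> \<le> (\<integral>\<^sup>+e. ennreal (D e) * indicator (ball 0 r) e \<partial>lborel)"
        by (intro nn_integral_mono) (auto simp: S1_def indicator_def intro: ennreal_leI)
      also have "\<dots> = diff_err H G r x" by (simp add: diff_err_def D_def)
      also have "\<dots> \<le> ennreal (\<theta>\<^sup>2 * r ^ Suc N)" using er by simp
      finally have "ennreal (1 / (\<theta> * r)) * (ennreal (\<theta> * r) * emeasure lborel S1)
          \<le> ennreal (1 / (\<theta> * r)) * ennreal (\<theta>\<^sup>2 * r ^ Suc N)" by (rule mult_left_mono) simp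
      moreover have "ennreal (1 / (\<theta> * r)) * (ennreal (\<theta> * r) * emeasure lborel S1) = emeasure lborel S1"
        using r \<theta> by (simp add: mult.assoc[symmetric] ennreal_mult[symmetric])
      moreover have "ennreal (1 / (\<theta> * r)) * ennreal (\<theta>\<^sup>2 * r ^ Suc N) = ennreal (\<theta> * r ^ N)"
        using r \<theta> by (simp add: ennreal_mult[symmetric] power2_eq_square)
      ultimately show ?thesis by simp
    qed
    have S2: "emeasure lborel S2 \<le> ennreal (2 * t / r * ((2 * r) ^ N * \<omega>))"
      unfolding S2_def N_def \<omega>_def
      by (rule emeasure_slab_le) (use q r \<theta> in \<open>auto simp: u_def t_def\<close>)
    have "ennreal (\<kappa> * r ^ N) \<le> emeasure lborel S"
      using dens[OF r] by (simp add: N_def S_def)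
    also have "\<dots> = (\<integral>\<^sup>+e. indicator S (x + e) \<partial>lborel)"
      using lborel_translate_nn[of "indicator S" x] Sm by simp
    also have "\<dots> \<le> (\<integral>\<^sup>+e. indicator (S1 \<union> S2) e \<partial>lborel)"
      using sub by (intro nn_integral_mono) (auto simp: indicator_def)
    also have "\<dots> = emeasure lborel (S1 \<union> S2)" by simp
    also have "\<dots> \<le> emeasure lborel S1 + emeasure lborel S2"
      by (intro emeasure_subadditive) auto
    also have "\<dots> \<le> ennreal (\<theta> * r ^ N) + ennreal (2 * t / r * ((2 * r) ^ N * \<omega>))"
      by (intro add_mono S1 S2)
    also have "\<dots> = ennreal (\<theta> * r ^ N + 2 * t / r * ((2 * r) ^ N * \<omega>))"
      using r \<theta> \<omega> by (intro ennreal_plus[symmetric]) (auto simp: t_def)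
    finally have "\<kappa> * r ^ N \<le> \<theta> * r ^ N + 2 * t / r * ((2 * r) ^ N * \<omega>)"
      using r \<theta> \<omega> by (subst (asm) ennreal_le_iff) (auto simp: t_def)
    also have "\<dots> = (\<theta> + 2 * 2 ^ N * \<omega> * (norm p + 2 * \<theta>) / norm q) * r ^ N"
      using r q by (simp add: t_def power_mult_distrib field_simps)
    finally show ?thesis using r by simp
  qed
  have "norm q \<le> 2 * 2 ^ N * \<omega> / \<kappa> * norm p"
  proof (cases "q = 0")
    case False
    hence q: "norm q > 0" by simp
    have "((\<lambda>\<theta>. \<theta> + 2 * 2 ^ N * \<omega> * (norm p + 2 * \<theta>) / norm q) \<longlongrightarrow> 0 + 2 * 2 ^ N * \<omega> * (norm p + 2 * 0) / norm q) (at_right 0)"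
      by (intro tendsto_intros) (use q in auto)
    moreover have "\<forall>\<^sub>F \<theta> in at_right 0. \<kappa> \<le> \<theta> + 2 * 2 ^ N * \<omega> * (norm p + 2 * \<theta>) / norm q"
      using main False by (auto simp: eventually_at_filter)
    ultimately have "\<kappa> \<le> 0 + 2 * 2 ^ N * \<omega> * (norm p + 2 * 0) / norm q"
      by (intro tendsto_lowerbound) auto
    thus ?thesis using q \<open>\<kappa> > 0\<close> by (simp add: field_simps)
  qed (use \<omega> \<open>\<kappa> > 0\<close> in simp)
  thus ?thesis by (simp add: p_def q_def N_def \<omega>_def)
qed

section \<open>Localisation of a.e. statements and uniqueness of weak differentials\<close>

lemma AE_lebesgue_local:
  fixes \<Omega> :: "'a::euclidean_space set"
  assumes "\<And>x. x \<in> \<Omega> \<Longrightarrow> \<exists>r>0. AE y in lebesgue. y \<in> ball x r \<longrightarrow> P y"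
  shows "AE y in lebesgue. y \<in> \<Omega> \<longrightarrow> P y"
proof -
  define \<F> where "\<F> = {ball x r |x r. r > 0 \<and> (AE y in lebesgue. y \<in> ball x r \<longrightarrow> P y)}"
  obtain \<F>' where \<F>': "\<F>' \<subseteq> \<F>" "countable \<F>'" "\<Union>\<F>' = \<Union>\<F>"
  proof (rule Lindelof)
    show "open S" if "S \<in> \<F>" for S using that by (auto simp: \<F>_def)
  qed
  have "\<forall>B\<in>\<F>'. AE y in lebesgue. y \<in> B \<longrightarrow> P y"
  proof
    fix B assume "B \<in> \<F>'"
    then obtain x r where "B = ball x r" "AE y in lebesgue. y \<in> ball x r \<longrightarrow> P y"
      using \<F>'(1) unfolding \<F>_def by blast
    thus "AE y in lebesgue. y \<in> B \<longrightarrow> P y" by (simp only:)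
  qed
  hence "AE y in lebesgue. \<forall>B\<in>\<F>'. y \<in> B \<longrightarrow> P y"
    by (rule AE_ball_countable[OF \<F>'(2), THEN iffD2])
  moreover have "\<Omega> \<subseteq> \<Union>\<F>'"
  proof
    fix x assume "x \<in> \<Omega>"
    then obtain r where "r > 0" "AE y in lebesgue. y \<in> ball x r \<longrightarrow> P y" using assms by blast
    hence "x \<in> ball x r" "ball x r \<in> \<F>" by (auto simp: \<F>_def)
    thus "x \<in> \<Union>\<F>'" using \<F>'(3) by blast
  qed
  ultimately show ?thesis by (auto elim!: eventually_mono)
qed

text \<open>The difference of the gradients is orthogonal to every admissible bump. Halving the
  radius makes all bumps of radius below R / 2 centred in the smaller ball admissible.\<close>

lemma weak_grad_on_unique:
  fixes H :: "real^'n \<Rightarrow> real"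
  assumes wg: "weak_grad_on (ball x0 R) H G" and wg': "weak_grad_on (ball x0 R) H' G'" and "R > 0"
    and eq: "AE x in lborel. x \<in> ball x0 R \<longrightarrow> H x = H' x"
  shows "AE x in lborel. x \<in> ball x0 (R / 2) \<longrightarrow> G j x = G' j x"
proof -
  have "AE x in lborel. x \<in> ball x0 (R / 2) \<longrightarrow> G j x - G' j x = 0"
  proof (rule bump_orthogonal_imp_AE_0[where \<delta> = "R / 2"])
    show "integrable lborel (\<lambda>x. G j x - G' j x)"
      using weak_grad_onD(3)[OF wg] weak_grad_onD(3)[OF wg'] by (intro Bochner_Integration.integrable_diff)
    fix x \<rho> assume x: "x \<in> ball x0 (R / 2)" and \<rho>: "0 < \<rho>" "\<rho> < R / 2"
    have sub: "cball x \<rho> \<subseteq> ball x0 R"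
    proof
      fix z assume "z \<in> cball x \<rho>"
      thus "z \<in> ball x0 R" using x \<rho> dist_triangle[of x0 z x] by simp
    qed
    have i: "integrable lborel (\<lambda>y. g y * bump \<rho> (y - x))" if "integrable lborel g" for g
      by (rule integrable_mult_bounded[OF that, where B = 1]) (auto simp: bump_nonneg bump_le_1)
    have "(\<integral>y. H y * bump_grad \<rho> (y - x) (axis j 1) \<partial>lborel) = (\<integral>y. H' y * bump_grad \<rho> (y - x) (axis j 1) \<partial>lborel)"
    proof (rule integral_cong_AE)
      have m: "(\<lambda>y. bump_grad \<rho> (y - x) (axis j 1)) \<in> borel_measurable lborel"
        by (rule measurable_compose[OF _ borel_measurable_bump_grad]) simp
      show "(\<lambda>y. H y * bump_grad \<rho> (y - x) (axis j 1)) \<in> borel_measurable lborel"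
        using weak_grad_onD(1)[OF wg] by (intro borel_measurable_times m) simp
      show "(\<lambda>y. H' y * bump_grad \<rho> (y - x) (axis j 1)) \<in> borel_measurable lborel"
        using weak_grad_onD(1)[OF wg'] by (intro borel_measurable_times m) simp
      show "AE y in lborel. H y * bump_grad \<rho> (y - x) (axis j 1) = H' y * bump_grad \<rho> (y - x) (axis j 1)"
        using eq
      proof eventually_elim
        case (elim y)
        show ?case
        proof (cases "y \<in> cball x \<rho>")
          case True
          thus ?thesis using elim sub by auto
        next
          case False
          hence "norm (y - x) > \<rho>" by (simp add: dist_norm norm_minus_commute)
          from bump_grad_eq_0[OF \<rho>(1) this] show ?thesis by simp
        qed
      qed
    qed
    moreover have "(\<integral>y. H y * bump_grad \<rho> (y - x) (axis j 1) \<partial>lborel) = - (\<integral>y. G j y * bump \<rho> (y - x) \<partial>lborel)"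
      using wg \<rho>(1) sub unfolding weak_grad_on_def by blast
    moreover have "(\<integral>y. H' y * bump_grad \<rho> (y - x) (axis j 1) \<partial>lborel) = - (\<integral>y. G' j y * bump \<rho> (y - x) \<partial>lborel)"
      using wg' \<rho>(1) sub unfolding weak_grad_on_def by blast
    ultimately have "(\<integral>y. G j y * bump \<rho> (y - x) \<partial>lborel) = (\<integral>y. G' j y * bump \<rho> (y - x) \<partial>lborel)"
      by linarith
    thus "(\<integral>y. (G j y - G' j y) * bump \<rho> (y - x) \<partial>lborel) = 0"
      using i[OF weak_grad_onD(3)[OF wg, of j]] i[OF weak_grad_onD(3)[OF wg', of j]]
      by (simp add: left_diff_distrib)
  qed (use \<open>R > 0\<close> in auto)
  thus ?thesis by eventually_elim auto
qed

lemma weak_diff_matrix_local_rep: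
  fixes f :: "real^'n \<Rightarrow> real^'n"
  assumes D: "weak_diff_matrix \<Omega> f D" and L: "\<And>i. Lp_loc (real CARD('n)) \<Omega> (\<lambda>x. f x $ i)"
    and "open \<Omega>" "cball x0 R \<subseteq> \<Omega>"
  shows "\<exists>H G. (\<forall>i. weak_grad_on (ball x0 R) (H i) (G i)) \<and>
    (AE x in lborel. x \<in> ball x0 R \<longrightarrow> (\<forall>i. f x $ i = H i x) \<and> (\<forall>i j. D x $ i $ j = G i j x))"
proof -
  have "\<forall>i. \<exists>HG. weak_grad_on (ball x0 R) (fst HG) (snd HG) \<and>
     (AE x in lborel. x \<in> ball x0 R \<longrightarrow> f x $ i = fst HG x) \<and>
     (\<forall>j. AE x in lborel. x \<in> ball x0 R \<longrightarrow> D x $ i $ j = snd HG j x)"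
  proof
    fix i
    have g: "Lp_loc (real CARD('n)) \<Omega> (\<lambda>x. D x $ i $ j)"
      and w: "weak_partial \<Omega> (\<lambda>x. f x $ i) j (\<lambda>x. D x $ i $ j)" for j
      using D by (simp_all add: weak_diff_matrix_def)
    obtain H G where HG: "weak_grad_on (ball x0 R) H G"
      "AE x in lebesgue. x \<in> ball x0 R \<longrightarrow> f x $ i = H x"
      "\<And>j. AE x in lebesgue. x \<in> ball x0 R \<longrightarrow> D x $ i $ j = G j x"
      by (rule weak_partial_local_rep[OF L g w assms(3,4)]) blast
    thus "\<exists>HG. weak_grad_on (ball x0 R) (fst HG) (snd HG) \<and>
       (AE x in lborel. x \<in> ball x0 R \<longrightarrow> f x $ i = fst HG x) \<and>
       (\<forall>j. AE x in lborel. x \<in> ball x0 R \<longrightarrow> D x $ i $ j = snd HG j x)"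
      unfolding AE_completion_iff by (intro exI[of _ "(H, G)"]) simp
  qed
  from choice[OF this] obtain HG where HG: "\<forall>i. weak_grad_on (ball x0 R) (fst (HG i)) (snd (HG i)) \<and>
     (AE x in lborel. x \<in> ball x0 R \<longrightarrow> f x $ i = fst (HG i) x) \<and>
     (\<forall>j. AE x in lborel. x \<in> ball x0 R \<longrightarrow> D x $ i $ j = snd (HG i) j x)" ..
  have "AE x in lborel. \<forall>i\<in>UNIV. x \<in> ball x0 R \<longrightarrow> f x $ i = fst (HG i) x"
    using HG by (intro AE_finite_allI) auto
  moreover have "AE x in lborel. \<forall>i\<in>UNIV. \<forall>j\<in>UNIV. x \<in> ball x0 R \<longrightarrow> D x $ i $ j = snd (HG i) j x"
    using HG by (intro AE_finite_allI) auto
  ultimately have "AE x in lborel. x \<in> ball x0 R \<longrightarrow>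
      (\<forall>i. f x $ i = fst (HG i) x) \<and> (\<forall>i j. D x $ i $ j = snd (HG i) j x)"
    by eventually_elim blast
  thus ?thesis
    using HG by (intro exI[of _ "\<lambda>i. fst (HG i)"] exI[of _ "\<lambda>i. snd (HG i)"]) simp
qed

text \<open>Carries the sign of the Jacobian from the given weak differential to any other
  one.\<close>

lemma weak_diff_matrix_unique:
  fixes f :: "real^'n \<Rightarrow> real^'n"
  assumes D: "weak_diff_matrix \<Omega> f D" and D': "weak_diff_matrix \<Omega> f D'"
    and L: "\<And>i. Lp_loc (real CARD('n)) \<Omega> (\<lambda>x. f x $ i)" and \<Omega>: "open \<Omega>"
  shows "AE x in lebesgue. x \<in> \<Omega> \<longrightarrow> D x = D' x"
proof (rule AE_lebesgue_local)
  fix x0 assume "x0 \<in> \<Omega>"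
  then obtain R where R: "R > 0" "cball x0 R \<subseteq> \<Omega>"
    using \<Omega> open_contains_cball by blast
  obtain H G where HG: "\<forall>i. weak_grad_on (ball x0 R) (H i) (G i)"
    and ae: "AE x in lborel. x \<in> ball x0 R \<longrightarrow> (\<forall>i. f x $ i = H i x) \<and> (\<forall>i j. D x $ i $ j = G i j x)"
    using weak_diff_matrix_local_rep[OF D L \<Omega> R(2)] by blast
  obtain H' G' where HG': "\<forall>i. weak_grad_on (ball x0 R) (H' i) (G' i)"
    and ae': "AE x in lborel. x \<in> ball x0 R \<longrightarrow> (\<forall>i. f x $ i = H' i x) \<and> (\<forall>i j. D' x $ i $ j = G' i j x)"
    using weak_diff_matrix_local_rep[OF D' L \<Omega> R(2)] by blast
  have "AE x in lborel. x \<in> ball x0 (R / 2) \<longrightarrow> G i j x = G' i j x" for i j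
  proof (rule weak_grad_on_unique[OF HG[rule_format] HG'[rule_format] R(1)])
    show "AE x in lborel. x \<in> ball x0 R \<longrightarrow> H i x = H' i x"
      using ae ae' by eventually_elim simp
  qed
  hence "AE x in lborel. \<forall>i\<in>UNIV. \<forall>j\<in>UNIV. x \<in> ball x0 (R / 2) \<longrightarrow> G i j x = G' i j x"
    by (intro AE_finite_allI) auto
  with ae ae' have "AE x in lborel. x \<in> ball x0 (R / 2) \<longrightarrow> D x = D' x"
  proof eventually_elim
    case (elim x)
    show ?case
    proof
      assume x: "x \<in> ball x0 (R / 2)"
      hence "x \<in> ball x0 R" using R(1) by auto
      thus "D x = D' x" using elim x by (simp add: vec_eq_iff)
    qed
  qed
  thus "\<exists>r>0. AE x in lebesgue. x \<in> ball x0 r \<longrightarrow> D x = D' x"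
    using R(1) AE_completion by (intro exI[of _ "R / 2"]) auto
qed

text \<open>The exceptional null set comes only from the choice of representatives and from
  approximate differentiability, so it is fixed before v and w range over uncountably many pairs.
  The wedge has its apex at f x and thus varies with x; the uniform \<open>\<kappa>\<close> makes K
  independent of x, v, w and D.\<close>

lemma qns_morphism_distortion:
  fixes f :: "real^'n \<Rightarrow> real^'n"
  assumes f: "qns_morphism \<Omega> \<Omega>' f" and \<Omega>: "open \<Omega>" "open \<Omega>'"
    and L: "\<And>i. Lp_loc (real CARD('n)) \<Omega> (\<lambda>x. f x $ i)"
  obtains K where "K \<ge> 0" "\<And>D. weak_diff_matrix \<Omega> f D \<Longrightarrow> AE x in lebesgue. x \<in> \<Omega> \<longrightarrow>
     (\<forall>v w. norm v = 1 \<longrightarrow> norm w = 1 \<longrightarrow> v \<bullet> w = 0 \<longrightarrow>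
        norm (transpose (D x) *v w) \<le> K * norm (transpose (D x) *v v))"
proof -
  obtain \<kappa> where \<kappa>: "\<kappa> > 0"
    and meas: "\<And>E. fat_cone_set E \<Longrightarrow> {x\<in>\<Omega>. f x \<in> E} \<in> sets lebesgue"
    and dens: "\<And>E a r. fat_cone_set E \<Longrightarrow> a \<in> \<Omega> \<Longrightarrow> f a \<in> E \<Longrightarrow> r > 0 \<Longrightarrow> ball a r \<subseteq> \<Omega> \<Longrightarrow>
       ennreal (\<kappa> * r ^ CARD('n)) \<le> emeasure lebesgue {x\<in>ball a r. f x \<in> E}"
    by (rule qns_morphism_density[OF f \<Omega>]) blast
  define K where "K = 2 * 2 ^ CARD('n) * unit_ball_vol TYPE('n) / \<kappa>"
  show thesis
  proof (rule that[of K])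
    show "K \<ge> 0" using \<kappa> unit_ball_vol_pos[where 'n = 'n] by (simp add: K_def)
    fix D assume D: "weak_diff_matrix \<Omega> f D"
    show "AE x in lebesgue. x \<in> \<Omega> \<longrightarrow> (\<forall>v w. norm v = 1 \<longrightarrow> norm w = 1 \<longrightarrow> v \<bullet> w = 0 \<longrightarrow>
        norm (transpose (D x) *v w) \<le> K * norm (transpose (D x) *v v))"
    proof (rule AE_lebesgue_local)
      fix x0 assume "x0 \<in> \<Omega>"
      then obtain R where R: "R > 0" "cball x0 R \<subseteq> \<Omega>"
        using \<Omega>(1) open_contains_cball by blast
      obtain H G where HG: "\<forall>i. weak_grad_on (ball x0 R) (H i) (G i)"
        and ae: "AE x in lborel. x \<in> ball x0 R \<longrightarrow> (\<forall>i. f x $ i = H i x) \<and> (\<forall>i j. D x $ i $ j = G i j x)"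
        using weak_diff_matrix_local_rep[OF D L \<Omega>(1) R(2)] by blast
      have Hm [measurable]: "H i \<in> borel_measurable borel" for i using weak_grad_onD(1) HG by blast
      have "AE x in lborel. x \<in> ball x0 (R / 2) \<longrightarrow>
         (\<forall>\<epsilon>>0. \<exists>r>0. r < R / 4 \<and> diff_err H G r x < ennreal (\<epsilon> * r ^ Suc CARD('n)))"
        by (rule weak_grad_approx_differentiable[OF HG[rule_format] R(1)])
      with ae have "AE x in lborel. x \<in> ball x0 (R / 2) \<longrightarrow> (\<forall>v w. norm v = 1 \<longrightarrow> norm w = 1 \<longrightarrow> v \<bullet> w = 0 \<longrightarrow>
        norm (transpose (D x) *v w) \<le> K * norm (transpose (D x) *v v))"
      proof eventually_elim
        case (elim x)
        show ?case
        proof (intro impI allI)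
          fix v w :: "real^'n"
          assume x: "x \<in> ball x0 (R / 2)" and vw: "norm v = 1" "norm w = 1" "v \<bullet> w = 0"
          have xR: "x \<in> ball x0 R" using x R(1) by auto
          have x\<Omega>: "x \<in> \<Omega>" using xR R(2) ball_subset_cball by blast
          let ?E = "{y. \<bar>(y - f x) \<bullet> w\<bar> \<le> (y - f x) \<bullet> v}"
          have E: "fat_cone_set ?E" by (rule fat_cone_set_wedge[OF vw])
          show "norm (transpose (D x) *v w) \<le> K * norm (transpose (D x) *v v)"
            unfolding K_def
          proof (rule wedge_density_imp_distortion[OF Hm _ _ _ vw(1,2) _ \<kappa>])
            show "D x $ i $ j = G i j x" for i j using elim(1) xR by blast
            show "f x $ i = H i x" for i using elim(1) xR by blast
            show "\<exists>r>0. r < R / 4 \<and> diff_err H G r x < ennreal (\<epsilon> * r ^ Suc CARD('n))" if "\<epsilon> > 0" for \<epsilon>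
              using elim(2) x that by blast
            fix r assume r: "0 < r" "r < R / 4"
            have bR: "ball x r \<subseteq> ball x0 R"
            proof
              fix z assume "z \<in> ball x r"
              thus "z \<in> ball x0 R" using x r dist_triangle[of x0 z x] by simp
            qed
            have b\<Omega>: "ball x r \<subseteq> \<Omega>" using bR R(2) ball_subset_cball by blast
            have "{y\<in>ball x r. f y \<in> ?E} = ball x r \<inter> {y\<in>\<Omega>. f y \<in> ?E}" using b\<Omega> by auto
            hence m: "{y\<in>ball x r. f y \<in> ?E} \<in> sets lebesgue" using meas[OF E] by auto
            let ?S = "{y\<in>ball x r. \<bar>((\<chi> i. H i y) - f x) \<bullet> w\<bar> \<le> ((\<chi> i. H i y) - f x) \<bullet> v}"
            have "emeasure lebesgue {y\<in>ball x r. f y \<in> ?E} = emeasure lborel ?S"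
            proof (rule emeasure_lebesgue_lborel_AE[OF m])
              show "?S \<in> sets borel" unfolding inner_vec_def by simp
              show "AE y in lebesgue. y \<in> {y\<in>ball x r. f y \<in> ?E} \<longleftrightarrow> y \<in> ?S"
                using AE_completion[OF ae]
              proof eventually_elim
                case (elim y)
                have "f y = (\<chi> i. H i y)" if "y \<in> ball x r"
                  using elim that bR by (auto simp: vec_eq_iff)
                thus ?case by auto
              qed
            qed
            moreover have "ennreal (\<kappa> * r ^ CARD('n)) \<le> emeasure lebesgue {y\<in>ball x r. f y \<in> ?E}"
              by (rule dens[OF E x\<Omega> _ r(1) b\<Omega>]) simp
            ultimately show "ennreal (\<kappa> * r ^ CARD('n)) \<le> emeasure lborel ?S" by simp
          qed
        qed
      qed
      thus "\<exists>r>0. AE x in lebesgue. x \<in> ball x0 r \<longrightarrow> (\<forall>v w. norm v = 1 \<longrightarrow> norm w = 1 \<longrightarrow> v \<bullet> w = 0 \<longrightarrow>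
        norm (transpose (D x) *v w) \<le> K * norm (transpose (D x) *v v))"
        using R(1) by (intro exI[of _ "R / 2"] conjI AE_completion) simp_all
    qed
  qed
qed

theorem theorem1p4:
  fixes \<Omega> \<Omega>' :: "(real^'n) set" and f :: "real^'n \<Rightarrow> real^'n"
  assumes "CARD('n) \<ge> 2"
    and "domain \<Omega>" and "domain \<Omega>'"
    and "qns_morphism \<Omega> \<Omega>' f"
    and "\<forall>i. sobolev_1n_loc \<Omega> (\<lambda>x. f x $ i)"
    and "\<exists>D. weak_diff_matrix \<Omega> f D \<and> (AE x in lebesgue. x \<in> \<Omega> \<longrightarrow> det (D x) \<ge> 0)"
  shows "quasiregular \<Omega> f"
proof -
  have \<Omega>: "open \<Omega>" "open \<Omega>'" using assms(2,3) by (auto simp: domain_def)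
  have L: "Lp_loc (real CARD('n)) \<Omega> (\<lambda>x. f x $ i)" for i
    using assms(5) by (simp add: sobolev_1n_loc_def)
  obtain D1 where D1: "weak_diff_matrix \<Omega> f D1" "AE x in lebesgue. x \<in> \<Omega> \<longrightarrow> det (D1 x) \<ge> 0"
    using assms(6) by blast
  obtain K where K: "K \<ge> 0" and dist: "\<And>D. weak_diff_matrix \<Omega> f D \<Longrightarrow> AE x in lebesgue. x \<in> \<Omega> \<longrightarrow>
     (\<forall>v w. norm v = 1 \<longrightarrow> norm w = 1 \<longrightarrow> v \<bullet> w = 0 \<longrightarrow>
        norm (transpose (D x) *v w) \<le> K * norm (transpose (D x) *v v))"
    by (rule qns_morphism_distortion[OF assms(4) \<Omega> L]) blast
  have "(1 + K) ^ CARD('n) \<ge> 1" using K by (intro one_le_power) simp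
  hence K1: "(1 + K) ^ CARD('n) * fact CARD('n) \<ge> 1"
    using mult_mono[of 1 "(1 + K) ^ CARD('n)" 1 "fact CARD('n)"] K by simp
  \<comment> \<open>At a.e. x the differentials D and D1 coincide, so D inherits the nonnegative
    determinant and the linear-algebra estimate applies.\<close>
  have "AE x in lebesgue. x \<in> \<Omega> \<longrightarrow>
      onorm (\<lambda>v. D x *v v) ^ CARD('n) \<le> (1 + K) ^ CARD('n) * fact CARD('n) * det (D x)"
    if D: "weak_diff_matrix \<Omega> f D" for D
    using dist[OF D] D1(2) weak_diff_matrix_unique[OF D D1(1) L \<Omega>(1)]
  proof eventually_elim
    case (elim x)
    show ?case
    proof
      assume x: "x \<in> \<Omega>"
      show "onorm (\<lambda>v. D x *v v) ^ CARD('n) \<le> (1 + K) ^ CARD('n) * fact CARD('n) * det (D x)"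
        by (rule onorm_power_le_det[OF _ K]) (use elim x in auto)
    qed
  qed
  thus ?thesis
    unfolding quasiregular_def
    using qns_morphism_continuous[OF assms(4) \<Omega> D1(1) L] assms(5) K1 by blast
qed

end
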